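(* Let $\mu>0$, $\gamma>1$. Consider the one-dimensional full compressible Navier–Stokes system with zero heat conduction $$\rho_t+(\rho u)_x=0,\quad (\rho u)_t+(\rho u^2+p)_x=\mu u_{xx},\quad (\rho e)_t+(\rho e u)_x+p u_x=\mu u_x^2,\qquad (x,t)\in\mathbb{R}\times(0,T],$$ with $p=(\gamma-1)\rho e$ and initial data $(\rho,u,e)(x,0)=(\rho_0,u_0,e_0)(x)$, where $\rho_0,u_0,e_0$ are continuous, $\operatorname{supp}\rho_0=[0,1]$, $\rho_0>0$ in $I:=(0,1)$, and $e_0\ge0$, $e_0\not\equiv0$ in $I$. Suppose that there exist positive numbers $\lambda_5,\lambda_6,\lambda_7,\lambda_8$ with $0<\lambda_7,\lambda_8<1$ such that either $$\frac{(\rho_0)_x}{\rho_0}+\frac{(e_0)_x}{\rho_0}\ge\lambda_5\text{ in }(0,\lambda_7),\qquad u_0(\lambda_7)<0,\qquad u_0\le0\text{ in }(0,\lambda_7),$$ or $$\frac{(\rho_0)_x}{\rho_0}+\frac{(e_0)_x}{\rho_0}\le-\lambda_6\text{ in }(\lambda_8,1),\qquad u_0(\lambda_8)>0,\qquad u_0\ge0\text{ in }(\lambda_8,1).$$ Then for every $T>0$ and every $m>2$ this Cauchy problem has no solution $(\rho,u,e)$ in $C^1([0,T];H^m(\mathbb{R}))$.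
   Context: $H^m(\mathbb{R})$ denotes the standard (inhomogeneous) Sobolev space. *)

theory Defs
  imports "HOL-Analysis.Analysis"
begin

definition test_fun :: "(real \<Rightarrow> real) \<Rightarrow> bool" where
  "test_fun \<phi> \<longleftrightarrow> (\<forall>n x. ((deriv ^^ n) \<phi>) differentiable (at x)) \<and> bounded {x. \<phi> x \<noteq> 0}"

definition loc_integrable :: "(real \<Rightarrow> real) \<Rightarrow> bool" where
  "loc_integrable f \<longleftrightarrow> (\<forall>a b. set_integrable lborel {a..b} f)"

definition weak_deriv :: "(real \<Rightarrow> real) \<Rightarrow> (real \<Rightarrow> real) \<Rightarrow> bool" where
  "weak_deriv f g \<longleftrightarrow> loc_integrable f \<and> loc_integrable g \<and>
     (\<forall>\<phi>. test_fun \<phi> \<longrightarrow>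
        (LINT x|lborel. f x * deriv \<phi> x) = - (LINT x|lborel. g x * \<phi> x))"

definition square_integrable :: "(real \<Rightarrow> real) \<Rightarrow> bool" where
  "square_integrable f \<longleftrightarrow> f \<in> borel_measurable lborel \<and> integrable lborel (\<lambda>x. (f x)\<^sup>2)"

definition sob_data :: "nat \<Rightarrow> (real \<Rightarrow> real) \<Rightarrow> (nat \<Rightarrow> real \<Rightarrow> real) \<Rightarrow> bool" where
  "sob_data k f D \<longleftrightarrow> D 0 = f \<and> (\<forall>j<k. weak_deriv (D j) (D (Suc j))) \<and>
     (\<forall>j\<le>k. square_integrable (D j))"

definition gagliardo :: "real \<Rightarrow> (real \<Rightarrow> real) \<Rightarrow> ennreal" where
  "gagliardo s g = (\<integral>\<^sup>+ x. (\<integral>\<^sup>+ y. ennreal ((g x - g y)\<^sup>2 / \<bar>x - y\<bar> powr (1 + 2 * s)) \<partial>lborel) \<partial>lborel)"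

definition in_H :: "real \<Rightarrow> (real \<Rightarrow> real) \<Rightarrow> bool" where
  "in_H m f \<longleftrightarrow> 0 \<le> m \<and> (\<exists>D. sob_data (nat \<lfloor>m\<rfloor>) f D \<and>
      (m - of_int \<lfloor>m\<rfloor> > 0 \<longrightarrow> gagliardo (m - of_int \<lfloor>m\<rfloor>) (D (nat \<lfloor>m\<rfloor>)) < \<infinity>))"

definition H_norm :: "real \<Rightarrow> (real \<Rightarrow> real) \<Rightarrow> real" where
  "H_norm m f = (let k = nat \<lfloor>m\<rfloor>; s = m - of_int \<lfloor>m\<rfloor>; D = (SOME D. sob_data k f D) in
      sqrt ((\<Sum>j\<le>k. LINT x|lborel. (D j x)\<^sup>2) + (if s > 0 then enn2real (gagliardo s (D k)) else 0)))"

definition C1_H :: "real \<Rightarrow> real \<Rightarrow> (real \<Rightarrow> real \<Rightarrow> real) \<Rightarrow> bool" where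
  "C1_H m T U \<longleftrightarrow> (\<exists>U'.
     (\<forall>t\<in>{0..T}. in_H m (\<lambda>x. U x t) \<and> in_H m (\<lambda>x. U' x t)) \<and>
     (\<forall>t\<in>{0..T}. ((\<lambda>s. H_norm m (\<lambda>x. (U x s - U x t) / (s - t) - U' x t)) \<longlongrightarrow> 0)
                    (at t within {0..T})) \<and>
     (\<forall>t\<in>{0..T}. ((\<lambda>s. H_norm m (\<lambda>x. U' x s - U' x t)) \<longlongrightarrow> 0) (at t within {0..T})))"

definition dt :: "real \<Rightarrow> (real \<Rightarrow> real \<Rightarrow> real) \<Rightarrow> real \<Rightarrow> real \<Rightarrow> real \<Rightarrow> bool" where
  "dt T F x t a \<longleftrightarrow> ((\<lambda>s. F x s) has_real_derivative a) (at t within {0..T})"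

definition dx :: "(real \<Rightarrow> real \<Rightarrow> real) \<Rightarrow> real \<Rightarrow> real \<Rightarrow> real \<Rightarrow> bool" where
  "dx F x t a \<longleftrightarrow> ((\<lambda>y. F y t) has_real_derivative a) (at x)"

definition NS_solution ::
  "real \<Rightarrow> real \<Rightarrow> real \<Rightarrow> (real \<Rightarrow> real) \<Rightarrow> (real \<Rightarrow> real) \<Rightarrow> (real \<Rightarrow> real)
   \<Rightarrow> (real \<Rightarrow> real \<Rightarrow> real) \<Rightarrow> (real \<Rightarrow> real \<Rightarrow> real) \<Rightarrow> (real \<Rightarrow> real \<Rightarrow> real) \<Rightarrow> bool" where
  "NS_solution \<mu> \<gamma> T \<rho>0 u0 e0 \<rho> u e \<longleftrightarrow>
    (let p = (\<lambda>x t. (\<gamma> - 1) * \<rho> x t * e x t) in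
     (\<forall>x. \<rho> x 0 = \<rho>0 x \<and> u x 0 = u0 x \<and> e x 0 = e0 x) \<and>
     (\<forall>t\<in>{0<..T}. \<forall>x. \<exists>a b.
        dt T \<rho> x t a \<and> dx (\<lambda>y s. \<rho> y s * u y s) x t b \<and> a + b = 0) \<and>
     (\<forall>t\<in>{0<..T}. AE x in lborel. \<exists>a b c g.
        dt T (\<lambda>y s. \<rho> y s * u y s) x t a \<and>
        dx (\<lambda>y s. \<rho> y s * (u y s)\<^sup>2 + p y s) x t b \<and>
        (\<forall>y. dx u y t (g y)) \<and> (g has_real_derivative c) (at x) \<and>
        a + b = \<mu> * c) \<and>
     (\<forall>t\<in>{0<..T}. \<forall>x. \<exists>a b c.
        dt T (\<lambda>y s. \<rho> y s * e y s) x t a \<and>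
        dx (\<lambda>y s. \<rho> y s * e y s * u y s) x t b \<and>
        dx u x t c \<and>
        a + b + p x t * c = \<mu> * c\<^sup>2))"

end

theory Submission
  imports Defs
begin

text \<open>Outside the support of the density the energy equation reads \<open>\<mu> u\<^sub>x\<^sup>2 = 0\<close>, so \<open>u\<close> is constant there and
  vanishes because it is square integrable. Hence for a short time the vacuum at \<open>x \<le> 0\<close> stays at rest
  and \<open>\<rho> = u = u\<^sub>x = 0\<close> at \<open>x = 0\<close>, which is one boundary condition too many: the momentum
  \<open>M(x,t) = \<integral>\<^sub>0\<^sup>x \<rho> u\<close> satisfies \<open>M\<^sub>t + u M\<^sub>x = \<mu> u\<^sub>x - p \<le> \<mu> (M\<^sub>x / \<rho>)\<^sub>x\<close> without a boundary term, since the
  stress vanishes at \<open>x = 0\<close>. This is a parabolic inequality with \<open>M = 0\<close> at \<open>x = 0\<close>, \<open>M \<le> 0\<close> initially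
  and \<open>M < 0\<close> at the inner boundary point, and Hopf's lemma yields \<open>u = M\<^sub>x / \<rho> < 0\<close> at \<open>x = 0\<close> for
  positive times, a contradiction. The right end of the support is treated by reflection.\<close>

section \<open>Smooth test functions\<close>

text \<open>Three obstacles shape the proof. \<open>H^m\<close> membership fixes functions of
  \<open>x\<close> only up to null sets at each time, and only \<open>C^1\<close> in
  \<open>x\<close> with a weak second derivative in \<open>L^2\<close> is extracted from it; so the
  equations must first be transferred to continuous representatives, and the momentum equation is
  used in integrated form. The pressure gradient has no sign. Integration from the vacuum boundary
  replaces it by the pressure itself, which is nonnegative because positivity of the density and the
  sign of the energy are carried along by the flow; this is why \<open>M\<close>, and not
  \<open>u\<close>, is compared with a barrier. Finally the parabolic operator degenerates at
  \<open>x = 0\<close>, where the density vanishes. The barrier is therefore weighted with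
  \<open>\<rho>\<close>: its steepness depends on an upper bound of the density only, and from below
  nothing but \<open>\<rho> > 0\<close> for \<open>x > 0\<close> enters. Times may be shortened at
  will, as a contradiction on any \<open>[0, \<tau>]\<close> suffices. The length is dictated by a
  bound \<open>B\<close> for \<open>u\<close> and its \<open>x\<close>-derivative.\<close>

definition flat :: "nat \<Rightarrow> real \<Rightarrow> real" where
  "flat k x = (if x > 0 then inverse x ^ k * exp (- inverse x) else 0)"

lemma flat_nonneg: "0 \<le> flat k x"
  by (simp add: flat_def)

lemma power_exp_minus_le:
  fixes y :: real assumes "y > 0" shows "y ^ n * exp (- y) \<le> fact n"
proof -
  have "y ^ n /\<^sub>R fact n \<le> exp y"
    using sum_le_suminf[of "\<lambda>i. y ^ i /\<^sub>R fact i" "{n}"] summable_exp_generic[of y] assms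
    by (auto simp: exp_def)
  then show ?thesis
    by (simp add: exp_minus field_simps)
qed

text \<open>Apply \<open>power_exp_minus_le\<close> with \<open>y = 1/x\<close> and exponent
  \<open>k + 2\<close>: the two spare powers of \<open>1/x\<close> leave a factor
  \<open>x^2\<close>. Difference quotients at \<open>0\<close> are then of order \<open>h\<close>,
  so the two branches join differentiably for every \<open>k\<close>.\<close>

lemma flat_quadratic: "\<bar>flat k x\<bar> \<le> fact (k + 2) * x\<^sup>2"
proof (cases "x > 0")
  case True
  have "inverse x ^ (k + 2) * exp (- inverse x) \<le> fact (k + 2)"
    using power_exp_minus_le[of "inverse x" "k + 2"] True by simp
  then have "inverse x ^ (k + 2) * exp (- inverse x) * x\<^sup>2 \<le> fact (k + 2) * x\<^sup>2"
    by (intro mult_right_mono) auto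
  moreover have "inverse x ^ (k + 2) * exp (- inverse x) * x\<^sup>2 = flat k x"
    using True by (simp add: flat_def power_add field_simps power2_eq_square)
  ultimately show ?thesis using flat_nonneg[of k x] by simp
next
  case False
  then show ?thesis by (simp add: flat_def)
qed

lemma flat_deriv: "(flat k has_real_derivative flat (k + 2) x - k * flat (k + 1) x) (at x)"
proof -
  consider "x > 0" | "x < 0" | "x = 0" by linarith
  then show ?thesis
  proof cases
    case 1
    have "((\<lambda>x. inverse x ^ k * exp (- inverse x)) has_real_derivative flat (k + 2) x - k * flat (k + 1) x) (at x)"
      using 1 by (auto intro!: derivative_eq_intros simp: flat_def field_simps power2_eq_square)
        (cases k; simp add: field_simps)
    then show ?thesis
      by (rule has_field_derivative_transform_within_open[of _ _ _ "{0<..}"]) (use 1 in \<open>auto simp: flat_def\<close>)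
  next
    case 2
    have "((\<lambda>x::real. 0) has_real_derivative flat (k + 2) x - k * flat (k + 1) x) (at x)"
      using 2 by (simp add: flat_def)
    then show ?thesis
      by (rule has_field_derivative_transform_within_open[of _ _ _ "{..<0}"]) (use 2 in \<open>auto simp: flat_def\<close>)
  next
    case 3
    have lim: "((\<lambda>h. fact (k + 2) * \<bar>h\<bar>) \<longlongrightarrow> 0) (at (0::real))"
      by (auto intro!: tendsto_eq_intros)
    have "((\<lambda>h. flat k h / h) \<longlongrightarrow> 0) (at 0)"
    proof (rule Lim_null_comparison[OF _ lim], rule always_eventually, rule allI)
      fix h :: real
      show "norm (flat k h / h) \<le> fact (k + 2) * \<bar>h\<bar>"
      proof (cases "h = 0")
        case False
        then show ?thesis
          using flat_quadratic[of k h]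
          by (simp add: divide_le_eq abs_mult power2_eq_square algebra_simps del: fact_Suc)
      qed simp
    qed
    then show ?thesis
      using 3 by (simp add: has_field_derivative_iff flat_def)
  qed
qed

text \<open>\<open>test_fun\<close> asks for all iterated derivatives. They are never computed: it
  is enough to have a class of functions that contains the building blocks and is closed under
  \<open>deriv\<close>. The derivative of \<open>flat k\<close> combines \<open>flat (k + 2)\<close>
  and \<open>flat (k + 1)\<close>, hence the parameter \<open>k\<close>.\<close>

inductive bumpy :: "(real \<Rightarrow> real) \<Rightarrow> bool" where
  flat: "bumpy (\<lambda>x. flat k (c * x + d))"
| add: "bumpy f \<Longrightarrow> bumpy g \<Longrightarrow> bumpy (\<lambda>x. f x + g x)"
| scale: "bumpy f \<Longrightarrow> bumpy (\<lambda>x. r * f x)"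
| mult: "bumpy f \<Longrightarrow> bumpy g \<Longrightarrow> bumpy (\<lambda>x. f x * g x)"

lemma bumpy_has_deriv:
  "bumpy f \<Longrightarrow> \<exists>g. bumpy g \<and> (\<forall>x. (f has_real_derivative g x) (at x))"
proof (induction rule: bumpy.induct)
  case (flat k c d)
  have "bumpy (\<lambda>x. c * (flat (k + 2) (c * x + d) + (- real k) * flat (k + 1) (c * x + d)))"
    by (intro bumpy.intros)
  moreover have "((\<lambda>x. flat k (c * x + d)) has_real_derivative
      c * (flat (k + 2) (c * x + d) + (- real k) * flat (k + 1) (c * x + d))) (at x)" for x
  proof -
    have "((\<lambda>x. c * x + d) has_real_derivative c) (at x)"
      by (auto intro!: derivative_eq_intros)
    from DERIV_chain2[of "flat k", OF flat_deriv this] show ?thesis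
      by (simp add: mult.commute[of _ c])
  qed
  ultimately show ?case by blast
next
  case (add f g)
  then obtain f' g' where "bumpy f'" "bumpy g'" "\<forall>x. (f has_real_derivative f' x) (at x)"
    "\<forall>x. (g has_real_derivative g' x) (at x)" by blast
  then show ?case
    by (intro exI[of _ "\<lambda>x. f' x + g' x"]) (auto intro!: bumpy.intros derivative_intros)
next
  case (scale f r)
  then obtain f' where "bumpy f'" "\<forall>x. (f has_real_derivative f' x) (at x)" by blast
  then show ?case
    by (intro exI[of _ "\<lambda>x. r * f' x"]) (auto intro!: bumpy.intros DERIV_cmult)
next
  case (mult f g)
  then obtain f' g' where d: "bumpy f'" "bumpy g'" "\<forall>x. (f has_real_derivative f' x) (at x)"
    "\<forall>x. (g has_real_derivative g' x) (at x)" by blast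
  have "bumpy (\<lambda>x. f' x * g x + g' x * f x)"
    by (intro bumpy.intros d mult)
  then show ?case
    using d by (intro exI[of _ "\<lambda>x. f' x * g x + g' x * f x"]) (auto intro!: DERIV_mult)
qed

lemma bumpy_deriv: "bumpy f \<Longrightarrow> bumpy (deriv f)"
  using bumpy_has_deriv[of f] DERIV_imp_deriv by (metis ext)

lemma bumpy_funpow_deriv: "bumpy f \<Longrightarrow> bumpy ((deriv ^^ n) f)"
  by (induction n) (auto intro: bumpy_deriv)

lemma bumpy_differentiable: "bumpy f \<Longrightarrow> f differentiable (at x)"
  using bumpy_has_deriv[of f] real_differentiable_def by blast

lemma bumpy_continuous: "bumpy f \<Longrightarrow> continuous_on S f"
  using bumpy_differentiable differentiable_imp_continuous_within
  by (metis continuous_at_imp_continuous_on)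

text \<open>Converges boundedly to the indicator of \<open>(a, b)\<close> as \<open>n \<rightarrow> \<infinity>\<close>.\<close>

definition bump :: "nat \<Rightarrow> real \<Rightarrow> real \<Rightarrow> real \<Rightarrow> real" where
  "bump n a b x = flat 0 (real (Suc n) * (x - a)) * flat 0 (real (Suc n) * (b - x))"

lemma bumpy_bump: "bumpy (bump n a b)"
proof -
  have "bumpy (\<lambda>x. flat 0 (real (Suc n) * x + (- real (Suc n) * a)) * flat 0 ((- real (Suc n)) * x + real (Suc n) * b))"
    by (intro bumpy.intros)
  also have "(\<lambda>x. flat 0 (real (Suc n) * x + (- real (Suc n) * a)) * flat 0 ((- real (Suc n)) * x + real (Suc n) * b)) = bump n a b"
    by (auto simp: bump_def algebra_simps intro!: ext)
  finally show ?thesis .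
qed

lemma flat0_le1: "flat 0 x \<le> 1"
  by (simp add: flat_def)

lemma bump_bounds: "0 \<le> bump n a b x" "bump n a b x \<le> 1"
  unfolding bump_def using flat_nonneg flat0_le1
  by (auto intro!: mult_nonneg_nonneg mult_le_one)

lemma bump_pos: "a < x \<Longrightarrow> x < b \<Longrightarrow> 0 < bump n a b x"
  by (simp add: bump_def flat_def)

lemma bump_zero: "x \<le> a \<or> b \<le> x \<Longrightarrow> bump n a b x = 0"
  by (auto simp: bump_def flat_def zero_less_mult_iff)

lemma bump_tendsto:
  assumes "a < x" "x < b" shows "(\<lambda>n. bump n a b x) \<longlonglongrightarrow> 1"
proof -
  have *: "(\<lambda>n. flat 0 (real (Suc n) * y)) \<longlonglongrightarrow> 1" if "y > 0" for y
  proof -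
    have "(\<lambda>n. exp (- (inverse (real (Suc n)) * inverse y))) \<longlonglongrightarrow> exp (- (0 * inverse y))"
      by (intro tendsto_intros LIMSEQ_inverse_real_of_nat)
    then show ?thesis using that by (simp add: flat_def)
  qed
  have "(\<lambda>n. bump n a b x) \<longlonglongrightarrow> 1 * 1"
    unfolding bump_def by (intro tendsto_mult *) (use assms in auto)
  then show ?thesis by simp
qed

lemma bump_integrable: "bump n a b integrable_on {s..t}"
  by (rule integrable_continuous_real[OF bumpy_continuous[OF bumpy_bump]])

lemma bump_integral_pos:
  assumes "a < b" shows "0 < integral {a..b} (bump n a b)"
proof -
  have "0 \<le> integral {a..b} (bump n a b)"
    by (rule integral_nonneg[OF bump_integrable]) (simp add: bump_bounds)
  moreover have "integral {a..b} (bump n a b) \<noteq> 0"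
  proof
    assume "integral {a..b} (bump n a b) = 0"
    then have "bump n a b x = 0" if "x \<in> {a..b}" for x
      using has_integral_0_cbox_imp_0[of a b "bump n a b" x] bump_integrable[of n a b a b] assms that
        bumpy_continuous[OF bumpy_bump] bump_bounds
      by (auto simp: has_integral_integral box_real cbox_interval)
    then show False using bump_pos[of a "(a + b) / 2" b n] assms by force
  qed
  ultimately show ?thesis by linarith
qed

lemma integral_bump_split:
  assumes "s \<le> a" "a < b" "b \<le> t"
  shows "integral {s..t} (bump n a b) = integral {a..b} (bump n a b)"
proof -
  have "integral {s..t} (bump n a b) = integral {s..t} (\<lambda>x. if x \<in> {a..b} then bump n a b x else 0)"
    by (rule integral_cong) (auto simp: bump_zero)
  also have "\<dots> = integral {a..b} (bump n a b)"
    using assms by (subst integral_restrict_Int) (simp add: Int_absorb1)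
  finally show ?thesis .
qed

text \<open>The primitive of a difference of two bumps of mass one climbs from 0 to 1 over
  \<open>[c, d]\<close> and falls back over \<open>[a, b]\<close>. Since both slopes are known
  exactly, testing a weak derivative with it produces a difference of two weighted averages.\<close>

lemma plateau_test_fun:
  assumes "c < d" "d \<le> a" "a < b"
  obtains \<phi> where "test_fun \<phi>"
    "\<And>x. (\<phi> has_real_derivative bump n c d x / integral {c..d} (bump n c d)
                              - bump n a b x / integral {a..b} (bump n a b)) (at x)"
    "\<And>x. 0 \<le> \<phi> x" "\<And>x. \<phi> x \<le> 1" "\<And>x. d \<le> x \<Longrightarrow> x \<le> a \<Longrightarrow> \<phi> x = 1"
    "\<And>x. x \<le> c \<or> b \<le> x \<Longrightarrow> \<phi> x = 0"
proof -
  define I J where "I = integral {c..d} (bump n c d)" and "J = integral {a..b} (bump n a b)"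
  have pos: "I > 0" "J > 0" using bump_integral_pos assms by (auto simp: I_def J_def)
  define q where "q x = bump n c d x / I - bump n a b x / J" for x
  have "bumpy (\<lambda>x. (1 / I) * bump n c d x + (- 1 / J) * bump n a b x)"
    by (intro bumpy.intros bumpy_bump)
  also have "(\<lambda>x. (1 / I) * bump n c d x + (- 1 / J) * bump n a b x) = q"
    by (auto simp: q_def)
  finally have bu: "bumpy q" .
  obtain F where F: "\<And>x. (F has_real_derivative q x) (at x)"
    using einterval_antiderivative[of "-\<infinity>" \<infinity> q] bu bumpy_differentiable
    by (auto simp: has_real_derivative_iff_has_vector_derivative intro: differentiable_imp_continuous_within)
  define \<phi> where "\<phi> x = F x - F c" for x
  have D: "(\<phi> has_real_derivative q x) (at x)" for x
    unfolding \<phi>_def by (auto intro!: derivative_eq_intros F)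
  have int: "(q has_integral \<phi> t - \<phi> s) {s..t}" if "s \<le> t" for s t
    using that D by (intro fundamental_theorem_of_calculus)
      (auto simp flip: has_real_derivative_iff_has_vector_derivative intro: has_field_derivative_at_within)
  have int': "integral {s..t} q = \<phi> t - \<phi> s" if "s \<le> t" for s t
    using int[OF that] by (rule integral_unique)
  have \<phi>c: "\<phi> c = 0" by (simp add: \<phi>_def)
  have intq: "integral {s..t} q = integral {s..t} (bump n c d) / I - integral {s..t} (bump n a b) / J" for s t
    unfolding q_def by (subst integral_diff) (auto intro!: bump_integrable integrable_on_divide)
  have zero_int: "integral {s..t} (bump n u v) = 0" if "t \<le> u \<or> v \<le> s" for s t u v
  proof -
    have "integral {s..t} (bump n u v) = integral {s..t} (\<lambda>x. 0)"
      by (rule integral_cong) (use that in \<open>auto intro!: bump_zero\<close>)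
    then show ?thesis by simp
  qed
  have one: "\<phi> x = 1" if "d \<le> x" "x \<le> a" for x
  proof -
    have "\<phi> x = integral {c..x} q"
      using int'[of c x] that assms \<phi>c by simp
    also have "\<dots> = I / I - 0 / J"
      using that assms unfolding intq
      by (subst integral_bump_split) (auto simp: I_def zero_int)
    finally show ?thesis using pos by simp
  qed
  have left: "\<phi> x = 0" if "x \<le> c" for x
  proof -
    have "\<phi> c - \<phi> x = integral {x..c} q" using int'[of x c] that by simp
    also have "\<dots> = 0" unfolding intq using assms by (simp add: zero_int)
    finally show ?thesis using \<phi>c by simp
  qed
  have right: "\<phi> x = 0" if "b \<le> x" for x
  proof -
    have "\<phi> x - \<phi> a = integral {a..x} q" using int'[of a x] that assms by simp
    also have "\<dots> = 0 / I - J / J" using that assms unfolding intq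
      by (subst (2) integral_bump_split) (auto simp: J_def zero_int)
    finally show ?thesis using one[of a] assms pos by simp
  qed
  have up: "\<phi> s \<le> \<phi> t" if "s \<le> t" "t \<le> a" for s t
  proof -
    have "0 \<le> integral {s..t} (bump n c d)"
      by (rule integral_nonneg[OF bump_integrable]) (simp add: bump_bounds)
    then have "0 \<le> integral {s..t} q"
      unfolding intq using that pos by (simp add: zero_int)
    then show ?thesis using int'[OF that(1)] by simp
  qed
  have down: "\<phi> t \<le> \<phi> s" if "s \<le> t" "d \<le> s" for s t
  proof -
    have "0 \<le> integral {s..t} (bump n a b)"
      by (rule integral_nonneg[OF bump_integrable]) (simp add: bump_bounds)
    then have "integral {s..t} q \<le> 0"
      unfolding intq using that pos by (simp add: zero_int)
    then show ?thesis using int'[OF that(1)] by simp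
  qed
  have bnd: "0 \<le> \<phi> x" "\<phi> x \<le> 1" for x
  proof -
    consider "x \<le> c" | "c \<le> x" "x \<le> a" | "a \<le> x" "x \<le> b" | "b \<le> x" by linarith
    then have "0 \<le> \<phi> x \<and> \<phi> x \<le> 1"
    proof cases
      case 2
      then show ?thesis using up[of c x] up[of x a] \<phi>c one[of a] assms by auto
    next
      case 3
      then show ?thesis using down[of x b] down[of a x] right[of b] one[of a] assms by auto
    qed (auto simp: left right)
    then show "0 \<le> \<phi> x" "\<phi> x \<le> 1" by auto
  qed
  have "test_fun \<phi>"
    unfolding test_fun_def
  proof (intro conjI allI)
    fix m x
    \<comment> \<open>\<open>\<phi>\<close> itself need not be \<open>bumpy\<close>; it is
      differentiable by construction, and all its higher derivatives are derivatives of the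
      \<open>bumpy\<close> function \<open>q\<close>.\<close>
    have "deriv \<phi> = q" using D DERIV_imp_deriv by blast
    then show "(deriv ^^ m) \<phi> differentiable at x"
      using D bumpy_differentiable[OF bumpy_funpow_deriv[OF bu]]
      by (cases m) (auto simp: funpow_Suc_right real_differentiable_def simp del: funpow.simps(2))
  next
    have "{x. \<phi> x \<noteq> 0} \<subseteq> {c..b}"
    proof
      fix x assume "x \<in> {x. \<phi> x \<noteq> 0}"
      then show "x \<in> {c..b}" using left[of x] right[of x] by (cases "x \<le> c"; cases "b \<le> x") auto
    qed
    then show "bounded {x. \<phi> x \<noteq> 0}"
      using bounded_subset bounded_closed_interval by blast
  qed
  then show thesis
    using that[of \<phi>] D bnd one left right unfolding q_def I_def J_def by blast
qed

section \<open>Absolutely continuous representatives\<close>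

text \<open>\<open>weak_deriv\<close> speaks of Lebesgue integrals over the line, whereas the
  calculus below uses gauge integrals over intervals. A continuous factor supported in
  \<open>[a, b]\<close> makes the two agree.\<close>

lemma loc_integrable_mult_compact:
  fixes g \<phi> :: "real \<Rightarrow> real"
  assumes g: "loc_integrable g" and \<phi>: "continuous_on UNIV \<phi>" and z: "\<And>x. x \<notin> {a..b} \<Longrightarrow> \<phi> x = 0"
  shows "integrable lborel (\<lambda>x. g x * \<phi> x)"
    and "(LINT x|lborel. g x * \<phi> x) = integral {a..b} (\<lambda>x. g x * \<phi> x)"
    and "(\<lambda>x. g x * \<phi> x) integrable_on {a..b}"
proof -
  have "compact (\<phi> ` {a..b})"
    using \<phi> by (intro compact_continuous_image) (auto intro: continuous_on_subset)
  then obtain C where "\<forall>y\<in>\<phi> ` {a..b}. \<bar>y\<bar> \<le> C"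
    by (meson compact_imp_bounded bounded_real)
  then have C: "\<bar>\<phi> x\<bar> \<le> C" if "x \<in> {a..b}" for x
    using that by blast
  have gi: "integrable lborel (\<lambda>x. indicator {a..b} x *\<^sub>R g x)"
    using g unfolding loc_integrable_def set_integrable_def by blast
  have [measurable]: "\<phi> \<in> borel_measurable borel"
    using \<phi> by (rule borel_measurable_continuous_onI)
  have "integrable lborel (\<lambda>x. (indicator {a..b} x *\<^sub>R g x) * \<phi> x)"
  proof (rule Bochner_Integration.integrable_bound[OF integrable_mult_right[OF gi, of C]])
    show "(\<lambda>x. (indicator {a..b} x *\<^sub>R g x) * \<phi> x) \<in> borel_measurable lborel"
      using borel_measurable_integrable[OF gi] by measurable
    show "AE x in lborel. norm (indicat_real {a..b} x *\<^sub>R g x * \<phi> x) \<le> norm (C * indicat_real {a..b} x *\<^sub>R g x)"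
    proof (rule AE_I2)
      fix x
      show "norm (indicat_real {a..b} x *\<^sub>R g x * \<phi> x) \<le> norm (C * indicat_real {a..b} x *\<^sub>R g x)"
      proof (cases "x \<in> {a..b}")
        case True
        then have "\<bar>\<phi> x\<bar> \<le> \<bar>C\<bar>" using C[of x] by linarith
        then show ?thesis
          using True by (simp add: abs_mult mult.commute mult_right_mono)
      qed auto
    qed
  qed
  moreover have e: "(\<lambda>x. (indicator {a..b} x *\<^sub>R g x) * \<phi> x) = (\<lambda>x. g x * \<phi> x)"
  proof
    fix x show "(indicator {a..b} x *\<^sub>R g x) * \<phi> x = g x * \<phi> x"
      using z[of x] by (cases "x \<in> {a..b}") (auto simp: indicator_def)
  qed
  ultimately show i: "integrable lborel (\<lambda>x. g x * \<phi> x)" by simp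
  have e2: "(\<lambda>x. indicator {a..b} x *\<^sub>R (g x * \<phi> x)) = (\<lambda>x. g x * \<phi> x)"
    using e by (simp add: mult.assoc)
  have s: "set_integrable lborel {a..b} (\<lambda>x. g x * \<phi> x)"
    unfolding set_integrable_def e2 by (rule i)
  show "(\<lambda>x. g x * \<phi> x) integrable_on {a..b}"
    using set_borel_integral_eq_integral(1)[OF s] .
  show "(LINT x|lborel. g x * \<phi> x) = integral {a..b} (\<lambda>x. g x * \<phi> x)"
    using set_borel_integral_eq_integral(2)[OF s] unfolding set_lebesgue_integral_def e2 .
qed

lemma test_fun_supported:
  assumes "test_fun \<phi>"
  obtains a b where "\<And>x. x \<notin> {a..b} \<Longrightarrow> \<phi> x = 0" "\<And>x. x \<notin> {a..b} \<Longrightarrow> deriv \<phi> x = 0"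
    "continuous_on UNIV \<phi>" "continuous_on UNIV (deriv \<phi>)"
proof -
  obtain r where r: "\<And>x. \<phi> x \<noteq> 0 \<Longrightarrow> \<bar>x\<bar> \<le> r"
    using assms unfolding test_fun_def bounded_real by blast
  have z: "\<phi> x = 0" if "x \<notin> {-r..r}" for x
    using that r[of x] by force
  have "deriv \<phi> x = 0" if "x \<notin> {-r..r}" for x
  proof -
    have "(\<phi> has_real_derivative 0) (at x)"
      by (rule has_field_derivative_transform_within_open[of "\<lambda>_. 0" _ _ "- {-r..r}"])
         (use that z in \<open>auto simp: open_Compl\<close>)
    then show ?thesis by (rule DERIV_imp_deriv)
  qed
  moreover have "continuous_on UNIV \<phi>" "continuous_on UNIV (deriv \<phi>)"
    using assms[unfolded test_fun_def, THEN conjunct1, rule_format, of 0]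
      assms[unfolded test_fun_def, THEN conjunct1, rule_format, of 1]
    by (auto simp: continuous_on_eq_continuous_at intro!: differentiable_imp_continuous_within)
  ultimately show thesis using z that by blast
qed

lemma loc_integrable_HK:
  assumes "loc_integrable g"
  shows "g integrable_on {a..b}" "(\<lambda>x. \<bar>g x\<bar>) integrable_on {a..b}"
  using assms set_borel_integral_eq_integral(1)[of "{a..b}" g]
    set_borel_integral_eq_integral(1)[of "{a..b}" "\<lambda>x. \<bar>g x\<bar>"]
  by (auto simp: loc_integrable_def intro: set_integrable_abs)

lemma bump_average_tendsto:
  fixes f :: "real \<Rightarrow> real"
  assumes f: "loc_integrable f" and "c < d"
  shows "(\<lambda>n. integral {c..d} (\<lambda>x. f x * (bump n c d x / integral {c..d} (bump n c d))))
           \<longlonglongrightarrow> integral {c..d} f / (d - c)"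
proof -
  have lim: "(\<lambda>n. integral {c..d} (\<lambda>x. h x * bump n c d x)) \<longlonglongrightarrow> integral {c..d} h"
    if h: "loc_integrable h" for h
  proof -
    \<comment> \<open>The bumps vanish at \<open>c\<close> and \<open>d\<close> for all
      \<open>n\<close>, so pointwise convergence to 1 is available on the open interval
      only.\<close>
    have "(\<lambda>n. integral {c<..<d} (\<lambda>x. h x * bump n c d x)) \<longlonglongrightarrow> integral {c<..<d} h"
    proof (rule dominated_convergence(2)[where h = "\<lambda>x. \<bar>h x\<bar>"])
      show "(\<lambda>x. h x * bump n c d x) integrable_on {c<..<d}" for n
        unfolding integrable_on_open_interval_real
        by (rule loc_integrable_mult_compact(3)[OF h])
          (auto intro!: bumpy_continuous bumpy_bump bump_zero)
      show "(\<lambda>x. \<bar>h x\<bar>) integrable_on {c<..<d}"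
        using loc_integrable_HK(2)[OF h] by (simp add: integrable_on_open_interval_real)
      show "norm (h x * bump n c d x) \<le> \<bar>h x\<bar>" for n x
        using bump_bounds[of n c d x] by (simp add: abs_mult mult_left_le)
      show "(\<lambda>n. h x * bump n c d x) \<longlonglongrightarrow> h x" if "x \<in> {c<..<d}" for x
        using tendsto_mult[OF tendsto_const bump_tendsto[of c x d], of "h x"] that by simp
    qed
    then show ?thesis by (simp add: integral_open_interval_real)
  qed
  have "loc_integrable (\<lambda>x. 1)"
    by (auto simp: loc_integrable_def set_integrable_def integrable_indicator_iff emeasure_lborel_Icc_eq)
  from lim[OF this] have "(\<lambda>n. integral {c..d} (bump n c d)) \<longlonglongrightarrow> d - c"
    using \<open>c < d\<close> by simp
  then have "(\<lambda>n. integral {c..d} (\<lambda>x. f x * bump n c d x) / integral {c..d} (bump n c d)) \<longlonglongrightarrow> integral {c..d} f / (d - c)"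
    using \<open>c < d\<close> by (intro tendsto_divide lim f) auto
  then show ?thesis by (simp add: divide_inverse mult.assoc[symmetric])
qed

text \<open>Testing with a plateau function whose slopes approximate \<open>\<plusminus>1/h\<close> on \<open>(c,d)\<close> and \<open>(a,b)\<close>.\<close>

lemma weak_deriv_averages:
  fixes f g :: "real \<Rightarrow> real"
  assumes w: "weak_deriv f g" and "c < d" "d \<le> a" "a < b"
  shows "\<bar>integral {c..d} f / (d - c) - integral {a..b} f / (b - a) + integral {d..a} g\<bar>
           \<le> integral {c..d} (\<lambda>x. \<bar>g x\<bar>) + integral {a..b} (\<lambda>x. \<bar>g x\<bar>)"
proof -
  have f: "loc_integrable f" and g: "loc_integrable g"
    using w by (auto simp: weak_deriv_def)
  let ?A = "\<lambda>n c d. integral {c..d} (\<lambda>x. f x * (bump n c d x / integral {c..d} (bump n c d)))"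
  have "\<bar>?A n c d - ?A n a b + integral {d..a} g\<bar>
           \<le> integral {c..d} (\<lambda>x. \<bar>g x\<bar>) + integral {a..b} (\<lambda>x. \<bar>g x\<bar>)" for n
  proof -
    define p q where "p x = bump n c d x / integral {c..d} (bump n c d)"
      and "q x = bump n a b x / integral {a..b} (bump n a b)" for x
    obtain \<phi> where \<phi>: "test_fun \<phi>" "\<And>x. (\<phi> has_real_derivative p x - q x) (at x)"
      "\<And>x. 0 \<le> \<phi> x" "\<And>x. \<phi> x \<le> 1" "\<And>x. d \<le> x \<Longrightarrow> x \<le> a \<Longrightarrow> \<phi> x = 1"
      "\<And>x. x \<le> c \<or> b \<le> x \<Longrightarrow> \<phi> x = 0"
      using plateau_test_fun[OF assms(2-4), of n] unfolding p_def q_def by blast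
    have cont: "continuous_on UNIV p" "continuous_on UNIV q" "continuous_on UNIV \<phi>"
      unfolding p_def q_def divide_inverse
      using DERIV_continuous_on[of UNIV \<phi>, OF \<phi>(2)]
      by (auto intro!: continuous_on_mult[OF bumpy_continuous[OF bumpy_bump] continuous_on_const])
    have pz: "p x = 0" if "x \<notin> {c..d}" for x using that by (auto simp: p_def intro!: bump_zero)
    have qz: "q x = 0" if "x \<notin> {a..b}" for x using that by (auto simp: q_def intro!: bump_zero)
    have \<phi>z: "\<phi> x = 0" if "x \<notin> {c..b}" for x using that by (auto intro!: \<phi>(6))
    note fp = loc_integrable_mult_compact[OF f cont(1) pz]
    note fq = loc_integrable_mult_compact[OF f cont(2) qz]
    note g\<phi> = loc_integrable_mult_compact[OF g cont(3) \<phi>z]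
    have "(LINT x|lborel. f x * deriv \<phi> x) = (LINT x|lborel. f x * p x - f x * q x)"
      using DERIV_imp_deriv[OF \<phi>(2)] by (simp add: right_diff_distrib)
    also have "\<dots> = integral {c..d} (\<lambda>x. f x * p x) - integral {a..b} (\<lambda>x. f x * q x)"
      using fp fq by simp
    finally have 1: "integral {c..d} (\<lambda>x. f x * p x) - integral {a..b} (\<lambda>x. f x * q x)
        = - integral {c..b} (\<lambda>x. g x * \<phi> x)"
      using w \<phi>(1) g\<phi>(2) unfolding weak_deriv_def by auto
    have i: "(\<lambda>x. g x * \<phi> x) integrable_on {s..t}" if "c \<le> s" "t \<le> b" for s t
      by (rule integrable_subinterval_real[OF g\<phi>(3)]) (use that in auto)
    \<comment> \<open>Rise, plateau and fall. The plateau contributes the integral of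
      \<open>g\<close> exactly; on the two flanks \<open>0 \<le> \<phi> \<le> 1\<close> leaves the
      error bound of the lemma.\<close>
    have 2: "integral {c..b} (\<lambda>x. g x * \<phi> x) = integral {c..d} (\<lambda>x. g x * \<phi> x)
        + integral {d..a} (\<lambda>x. g x * \<phi> x) + integral {a..b} (\<lambda>x. g x * \<phi> x)"
      using Henstock_Kurzweil_Integration.integral_combine[of c d b, OF _ _ g\<phi>(3)] Henstock_Kurzweil_Integration.integral_combine[of d a b "\<lambda>x. g x * \<phi> x"] i[of d b] assms
      by simp
    have 3: "integral {d..a} (\<lambda>x. g x * \<phi> x) = integral {d..a} g"
      by (rule integral_cong) (simp add: \<phi>(5))
    have 4: "\<bar>integral {s..t} (\<lambda>x. g x * \<phi> x)\<bar> \<le> integral {s..t} (\<lambda>x. \<bar>g x\<bar>)" if "c \<le> s" "t \<le> b" for s t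
    proof -
      have "norm (integral {s..t} (\<lambda>x. g x * \<phi> x)) \<le> integral {s..t} (\<lambda>x. \<bar>g x\<bar>)"
        by (rule integral_norm_bound_integral[OF i[OF that] loc_integrable_HK(2)[OF g]])
           (use \<phi>(3,4) in \<open>auto simp: abs_mult mult_left_le\<close>)
      then show ?thesis by simp
    qed
    show ?thesis
      using 1 2 3 4[of c d] 4[of a b] assms unfolding p_def q_def by simp
  qed
  moreover have "(\<lambda>n. \<bar>?A n c d - ?A n a b + integral {d..a} g\<bar>)
      \<longlonglongrightarrow> \<bar>integral {c..d} f / (d - c) - integral {a..b} f / (b - a) + integral {d..a} g\<bar>"
    using assms f by (intro tendsto_intros bump_average_tendsto)
  ultimately show ?thesis
    by (intro LIMSEQ_le_const2) auto
qed

lemma lebesgue_differentiation_right: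
  fixes f :: "real \<Rightarrow> real"
  assumes "\<And>a b. f integrable_on {a..b}"
  obtains N where "negligible N"
    "\<And>x. x \<notin> N \<Longrightarrow> ((\<lambda>h. integral {x..x + h} f / h) \<longlongrightarrow> f x) (at_right 0)"
proof -
  obtain N where N: "negligible N" "\<And>x e. \<lbrakk>x \<notin> N; 0 < e\<rbrakk> \<Longrightarrow>
               \<exists>d>0. \<forall>h. 0 < h \<and> h < d \<longrightarrow>
                         norm(integral (cbox x (x + h *\<^sub>R One)) f /\<^sub>R h ^ DIM(real) - f x) < e"
    using integrable_ccontinuous_explicit[of f] assms by (auto simp: cbox_interval)
  have "((\<lambda>h. integral {x..x + h} f / h) \<longlongrightarrow> f x) (at_right 0)" if "x \<notin> N" for x
  proof (rule tendstoI)
    fix e :: real assume "e > 0"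
    then show "\<forall>\<^sub>F h in at_right 0. dist (integral {x..x + h} f / h) (f x) < e"
      using N(2)[OF that \<open>e > 0\<close>] unfolding eventually_at_right_field
      by (auto simp: dist_real_def cbox_interval divide_inverse mult.commute)
  qed
  with N(1) that show thesis by blast
qed

lemma indefinite_integral_tendsto_0:
  fixes g :: "real \<Rightarrow> real"
  assumes "\<And>a b. g integrable_on {a..b}"
  shows "((\<lambda>h. integral {x..x + h} g) \<longlongrightarrow> 0) (at_right 0)"
proof -
  have "continuous_on {x..x+1} (\<lambda>y. integral {x..y} g)"
    by (rule indefinite_integral_continuous_1[OF assms])
  then have "((\<lambda>y. integral {x..y} g) \<longlongrightarrow> integral {x..x} g) (at x within {x..x+1})"
    unfolding continuous_on_def by (rule bspec) auto
  then have "((\<lambda>y. integral {x..y} g) \<longlongrightarrow> 0) (at_right x)"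
    by (simp add: at_within_Icc_at_right)
  then show ?thesis
    by (subst (asm) filterlim_at_right_to_0) (simp add: add.commute)
qed

text \<open>Let both flanks in \<open>weak_deriv_averages\<close> shrink. The averages of
  \<open>f\<close> converge at its Lebesgue points, and the error is an integral of
  \<open>\<bar>g\<bar>\<close> over a vanishing length. So \<open>N\<close> consists of bad points
  of \<open>f\<close> alone, and a single \<open>N\<close> serves for all pairs
  \<open>c < a\<close>.\<close>

lemma weak_deriv_ftc:
  fixes f g :: "real \<Rightarrow> real"
  assumes w: "weak_deriv f g"
  obtains N where "negligible N"
    "\<And>c a. c \<notin> N \<Longrightarrow> a \<notin> N \<Longrightarrow> c < a \<Longrightarrow> f a - f c = integral {c..a} g"
proof -
  have f: "loc_integrable f" and g: "loc_integrable g"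
    using w by (auto simp: weak_deriv_def)
  note fi = loc_integrable_HK[OF f] and gi = loc_integrable_HK[OF g]
  obtain N where N: "negligible N"
    "\<And>x. x \<notin> N \<Longrightarrow> ((\<lambda>h. integral {x..x + h} f / h) \<longlongrightarrow> f x) (at_right 0)"
    using lebesgue_differentiation_right[OF fi(1)] by blast
  have "f a - f c = integral {c..a} g" if ca: "c \<notin> N" "a \<notin> N" "c < a" for c a
  proof -
    have "((\<lambda>h. \<bar>integral {c..c + h} f / h - integral {a..a + h} f / h + (integral {c..a} g - integral {c..c+h} g)\<bar>)
      \<longlongrightarrow> \<bar>f c - f a + (integral {c..a} g - 0)\<bar>) (at_right 0)"
      using ca by (intro tendsto_intros N(2) indefinite_integral_tendsto_0 gi)
    moreover have "((\<lambda>h. integral {c..c + h} (\<lambda>x. \<bar>g x\<bar>) + integral {a..a + h} (\<lambda>x. \<bar>g x\<bar>)) \<longlongrightarrow> 0 + 0) (at_right 0)"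
      by (intro tendsto_intros indefinite_integral_tendsto_0 gi)
    moreover have "\<forall>\<^sub>F h in at_right 0. \<bar>integral {c..c + h} f / h - integral {a..a + h} f / h + (integral {c..a} g - integral {c..c+h} g)\<bar>
       \<le> integral {c..c + h} (\<lambda>x. \<bar>g x\<bar>) + integral {a..a + h} (\<lambda>x. \<bar>g x\<bar>)"
      unfolding eventually_at_right_field
    proof (intro exI conjI allI impI)
      show "0 < a - c" using ca by simp
      fix h assume h: "0 < h" "h < a - c"
      have "integral {c..a} g - integral {c..c+h} g = integral {c+h..a} g"
        using Henstock_Kurzweil_Integration.integral_combine[of c "c + h" a g] gi h by simp
      then show "\<bar>integral {c..c + h} f / h - integral {a..a + h} f / h + (integral {c..a} g - integral {c..c+h} g)\<bar>
       \<le> integral {c..c + h} (\<lambda>x. \<bar>g x\<bar>) + integral {a..a + h} (\<lambda>x. \<bar>g x\<bar>)"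
        using weak_deriv_averages[OF w, of c "c + h" a "a + h"] h by simp
    qed
    ultimately have "\<bar>f c - f a + (integral {c..a} g - 0)\<bar> \<le> 0 + 0"
      by (intro tendsto_le) auto
    then show ?thesis by simp
  qed
  with N(1) that show thesis by blast
qed

lemma AE_lborel_if_negligible:
  assumes "negligible N" "\<And>x. x \<notin> N \<Longrightarrow> P x"
  shows "AE x in lborel. P x"
proof -
  have "N \<in> null_sets lebesgue" using assms(1) by (simp add: negligible_iff_null_sets)
  then have "AE x in lebesgue. P x" by (rule AE_I'[of N]) (use assms(2) in auto)
  then show ?thesis by (simp add: AE_completion_iff)
qed

lemma negligible_if_AE_lborel:
  assumes "AE x in lborel. P x"
  obtains N where "negligible N" "\<And>x. x \<notin> N \<Longrightarrow> P x"
proof -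
  obtain N where "N \<in> null_sets lborel" "{x. \<not> P x} \<subseteq> N"
    using assms by (auto simp: eventually_ae_filter)
  then show thesis
    using that[of N] by (auto simp: negligible_iff_null_sets null_sets_completionI)
qed

lemma not_negligible_interval: "a < b \<Longrightarrow> \<not> negligible {a<..<b::real}"
  using open_not_negligible[of "{a<..<b}"] by (auto simp: greaterThanLessThan_empty_iff)

lemma AE_lborel_dense:
  fixes a b :: real
  assumes "AE x in lborel. P x" "a < b"
  shows "\<exists>x\<in>{a<..<b}. P x"
  using not_negligible_interval[OF assms(2)] negligible_subset
  by (metis assms(1) negligible_if_AE_lborel subsetI)

lemma AE_eq_continuous:
  fixes f g :: "real \<Rightarrow> real"
  assumes "AE x in lborel. f x = g x" "continuous_on UNIV f" "continuous_on UNIV g"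
  shows "f x = g x"
proof (rule ccontr)
  assume "f x \<noteq> g x"
  have "open {x. f x \<noteq> g x}"
    using assms by (intro open_Collect_neq) auto
  then obtain e where e: "e > 0" "ball x e \<subseteq> {x. f x \<noteq> g x}"
    using \<open>f x \<noteq> g x\<close> by (auto simp: open_contains_ball)
  obtain y where "y \<in> {x<..<x+e}" "f y = g y"
    using AE_lborel_dense[OF assms(1), of x "x + e"] e(1) by auto
  then show False using e(2) by (auto simp: subset_iff dist_real_def)
qed

lemma weak_deriv_primitive:
  fixes f g :: "real \<Rightarrow> real"
  assumes w: "weak_deriv f g"
  obtains F where "AE x in lborel. f x = F x" "\<And>a b. a \<le> b \<Longrightarrow> (g has_integral F b - F a) {a..b}"
proof -
  obtain N where N: "negligible N"
    "\<And>c a. c \<notin> N \<Longrightarrow> a \<notin> N \<Longrightarrow> c < a \<Longrightarrow> f a - f c = integral {c..a} g"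
    using weak_deriv_ftc[OF w] by blast
  have gi: "g integrable_on {a..b}" for a b
    using w by (auto simp: weak_deriv_def intro: loc_integrable_HK)
  have "\<not> {0<..<1} \<subseteq> N"
    using negligible_subset[OF N(1)] not_negligible_interval[of 0 1] by auto
  then obtain c where c: "c \<notin> N" by blast
  define F where "F x = f c + (if c \<le> x then integral {c..x} g else - integral {x..c} g)" for x
  have "AE x in lborel. f x = F x"
  proof (rule AE_lborel_if_negligible[OF N(1)])
    fix x assume "x \<notin> N"
    then show "f x = F x"
      using N(2)[of c x] N(2)[of x c] c by (cases c x rule: linorder_cases) (auto simp: F_def)
  qed
  moreover have "(g has_integral F b - F a) {a..b}" if "a \<le> b" for a b
  proof -
    have "F b - F a = integral {a..b} g"
      using that Henstock_Kurzweil_Integration.integral_combine[of c a b g] Henstock_Kurzweil_Integration.integral_combine[of a c b g] Henstock_Kurzweil_Integration.integral_combine[of a b c g] gi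
      by (auto simp: F_def)
    then show ?thesis using gi by (metis integrable_integral)
  qed
  ultimately show thesis by (rule that)
qed

lemma has_integral_imp_continuous:
  fixes F g :: "real \<Rightarrow> real"
  assumes "\<And>a b. a \<le> b \<Longrightarrow> (g has_integral F b - F a) {a..b}"
  shows "continuous_on UNIV F"
proof (rule continuous_at_imp_continuous_on, rule ballI)
  fix x
  have gi: "g integrable_on {x-1..x+1}" using assms[of "x-1" "x+1"] by auto
  have "continuous_on {x-1..x+1} (\<lambda>y. F (x-1) + integral {x-1..y} g)"
    by (intro continuous_intros indefinite_integral_continuous_1 gi)
  then have "continuous_on {x-1..x+1} F"
  proof (rule continuous_on_eq)
    fix y assume "y \<in> {x-1..x+1}"
    then have "integral {x-1..y} g = F y - F (x - 1)" using assms[of "x-1" y] by (simp add: integral_unique)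
    then show "F (x-1) + integral {x-1..y} g = F y" by simp
  qed
  then show "isCont F x"
    by (rule continuous_on_interior) auto
qed

lemma primitive_has_deriv:
  fixes F g :: "real \<Rightarrow> real"
  assumes "\<And>a b. a \<le> b \<Longrightarrow> (g has_integral F b - F a) {a..b}" "continuous_on UNIV g"
  shows "(F has_real_derivative g x) (at x)"
proof -
  have "((\<lambda>y. integral {x-1..y} g) has_real_derivative g x) (at x within {x-1..x+1})"
    by (rule integral_has_real_derivative) (use assms in \<open>auto intro: continuous_on_subset\<close>)
  then have "((\<lambda>y. F (x-1) + integral {x-1..y} g) has_real_derivative g x) (at x within {x-1..x+1})"
    by (auto intro!: derivative_eq_intros)
  then have "(F has_real_derivative g x) (at x within {x-1..x+1})"
  proof (rule has_field_derivative_transform_within[of _ _ _ _ 1])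
    fix y assume "y \<in> {x-1..x+1}" "dist y x < 1"
    then have "integral {x-1..y} g = F y - F (x - 1)" using assms(1)[of "x-1" y] by (simp add: integral_unique)
    then show "F (x-1) + integral {x-1..y} g = F y" by simp
  qed auto
  then show ?thesis
    by (simp add: at_within_Icc_at)
qed

text \<open>If \<open>F' = r\<close> almost everywhere, \<open>r\<close> agrees with the density of \<open>F\<close> by Lebesgue differentiation.\<close>

lemma primitive_AE_deriv:
  fixes F g r :: "real \<Rightarrow> real"
  assumes F: "\<And>a b. a \<le> b \<Longrightarrow> (g has_integral F b - F a) {a..b}"
    and r: "AE x in lborel. (F has_real_derivative r x) (at x)" and "continuous_on UNIV r"
  shows "(F has_real_derivative r x) (at x)"
proof (rule primitive_has_deriv[OF _ assms(3)])
  fix a b :: real assume ab: "a \<le> b"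
  have gi: "g integrable_on {a..b}" for a b
    using F[of a b] by (cases "a \<le> b") auto
  obtain N where N: "negligible N"
    "\<And>x. x \<notin> N \<Longrightarrow> ((\<lambda>h. integral {x..x + h} g / h) \<longlongrightarrow> g x) (at_right 0)"
    using lebesgue_differentiation_right[OF gi] by blast
  obtain M where M: "negligible M" "\<And>x. x \<notin> M \<Longrightarrow> (F has_real_derivative r x) (at x)"
    using negligible_if_AE_lborel[OF r] by blast
  have "g x = r x" if x: "x \<notin> N" "x \<notin> M" for x
  proof -
    have "((\<lambda>h. (F (x + h) - F x) / h) \<longlongrightarrow> r x) (at_right 0)"
      using M(2)[OF x(2)] unfolding DERIV_def
      by (rule filterlim_mono[OF _ order_refl at_le]) auto
    moreover have "\<forall>\<^sub>F h in at_right 0. (F (x + h) - F x) / h = integral {x..x + h} g / h"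
      unfolding eventually_at_right_field
      using integral_unique[OF F[of x]] by (intro exI[of _ 1]) auto
    ultimately have "((\<lambda>h. integral {x..x + h} g / h) \<longlongrightarrow> r x) (at_right 0)"
      by (rule Lim_transform_eventually)
    then show ?thesis
      by (rule tendsto_unique[OF trivial_limit_at_right_real N(2)[OF x(1)]])
  qed
  then show "(r has_integral F b - F a) {a..b}"
    using has_integral_spike[of "N \<union> M" "{a..b}" r g] F[OF ab] N(1) M(1) by auto
qed

section \<open>Sobolev embedding on the line with explicit constants\<close>

lemma L2_unit_interval:
  fixes g :: "real \<Rightarrow> real"
  assumes g: "square_integrable g" "(LINT x|lborel. (g x)\<^sup>2) \<le> s\<^sup>2" and "s > 0"
  shows "(\<lambda>x. \<bar>g x\<bar>) integrable_on {x..x+1}" "integral {x..x+1} (\<lambda>x. \<bar>g x\<bar>) \<le> s"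
proof -
  have [measurable]: "g \<in> borel_measurable borel" and i: "integrable lborel (\<lambda>x. (g x)\<^sup>2)"
    using g by (auto simp: square_integrable_def)
  have si: "set_integrable lborel {x..x+1} (\<lambda>x. (g x)\<^sup>2)"
    unfolding set_integrable_def by (rule integrable_mult_indicator[OF _ i]) auto
  \<comment> \<open>Young's inequality with weight \<open>s\<close>, so that over a unit interval
    each of the two terms integrates to at most \<open>s / 2\<close>.\<close>
  have ge: "\<bar>g y\<bar> \<le> (g y)\<^sup>2 / (2 * s) + s / 2" for y
  proof -
    have "2 * s * \<bar>g y\<bar> \<le> (g y)\<^sup>2 + s\<^sup>2"
      using sum_squares_bound[of "\<bar>g y\<bar>" s] by (simp add: power2_eq_square mult_ac)
    then show ?thesis using \<open>s > 0\<close> by (simp add: field_simps power2_eq_square)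
  qed
  have si2: "set_integrable lborel {x..x+1} (\<lambda>y. (g y)\<^sup>2 / (2 * s) + s / 2)"
    by (intro set_integral_add set_integrable_divide si)
      (simp add: set_integrable_def)
  have "set_integrable lborel {x..x+1} (\<lambda>y. \<bar>g y\<bar>)"
    by (rule set_integrable_bound[OF si2])
      (use ge \<open>s > 0\<close> in \<open>auto simp: set_borel_measurable_def intro!: AE_I2 order_trans[OF ge]\<close>)
  note * = set_borel_integral_eq_integral[OF this]
  then show "(\<lambda>x. \<bar>g x\<bar>) integrable_on {x..x+1}" by simp
  note ** = set_borel_integral_eq_integral[OF si]
  have "integral {x..x+1} (\<lambda>x. \<bar>g x\<bar>) \<le> integral {x..x+1} (\<lambda>y. (g y)\<^sup>2 / (2 * s) + s / 2)"
    using set_borel_integral_eq_integral[OF si2] * ge by (intro integral_le) auto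
  also have "\<dots> = integral {x..x+1} (\<lambda>y. (g y)\<^sup>2) / (2 * s) + s / 2"
    using ** by (subst integral_add) (auto intro: integrable_on_divide)
  also have "integral {x..x+1} (\<lambda>y. (g y)\<^sup>2) \<le> (LINT x|lborel. (g x)\<^sup>2)"
    unfolding **(2)[symmetric] set_lebesgue_integral_def
    by (rule integral_mono[OF si[unfolded set_integrable_def] i]) (auto simp: indicator_def)
  also have "(LINT x|lborel. (g x)\<^sup>2) / (2 * s) + s / 2 \<le> s\<^sup>2 / (2 * s) + s / 2"
    using g(2) \<open>s > 0\<close> by (intro add_right_mono divide_right_mono) auto
  also have "\<dots> = s" using \<open>s > 0\<close> by (simp add: field_simps power2_eq_square)
  finally show "integral {x..x+1} (\<lambda>x. \<bar>g x\<bar>) \<le> s"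
    using \<open>s > 0\<close> by (simp add: divide_right_mono)
qed

text \<open>On \<open>[x, x + 1]\<close> both the mean of \<open>\<bar>F\<bar>\<close> and the
  variation of \<open>F\<close> are at most \<open>s\<close> for each \<open>s > H\<close>, so
  \<open>\<bar>F x\<bar> \<le> 2 * s\<close>. The detour through \<open>s\<close> covers
  \<open>H = 0\<close>, where one cannot divide by \<open>H\<close>.\<close>

lemma sup_bound_L2:
  fixes F g :: "real \<Rightarrow> real"
  assumes F: "\<And>a b. a \<le> b \<Longrightarrow> (g has_integral F b - F a) {a..b}"
    and sq: "square_integrable F" "square_integrable g"
    and le: "(LINT x|lborel. (F x)\<^sup>2) \<le> H\<^sup>2" "(LINT x|lborel. (g x)\<^sup>2) \<le> H\<^sup>2" and "H \<ge> 0"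
  shows "\<bar>F x\<bar> \<le> 2 * H"
proof -
  have "\<bar>F x\<bar> / 2 \<le> s" if "H < s" for s
  proof -
    have s: "s > 0" "H\<^sup>2 \<le> s\<^sup>2" using that \<open>H \<ge> 0\<close> by (auto intro: power_mono)
    note Fb = L2_unit_interval[OF sq(1) order_trans[OF le(1) s(2)] s(1), of x]
    note gb = L2_unit_interval[OF sq(2) order_trans[OF le(2) s(2)] s(1), of x]
    have "\<bar>F x\<bar> - s \<le> \<bar>F y\<bar>" if y: "y \<in> {x..x+1}" for y
    proof -
      have i: "(\<lambda>z. \<bar>g z\<bar>) integrable_on {x..y}"
        by (rule integrable_subinterval_real[OF gb(1)]) (use y in auto)
      have "norm (integral {x..y} g) \<le> integral {x..y} (\<lambda>z. \<bar>g z\<bar>)"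
        using F[of x y] y i by (intro integral_norm_bound_integral) auto
      also have "\<dots> \<le> integral {x..x+1} (\<lambda>z. \<bar>g z\<bar>)"
        using y by (intro integral_subset_le i gb(1)) auto
      finally have "\<bar>F y - F x\<bar> \<le> s"
        using F[of x y] y gb(2) by (simp add: integral_unique)
      then show ?thesis by linarith
    qed
    then have "integral {x..x+1} (\<lambda>_. \<bar>F x\<bar> - s) \<le> integral {x..x+1} (\<lambda>y. \<bar>F y\<bar>)"
      using Fb(1) by (intro integral_le) auto
    then show ?thesis using Fb(2) by simp
  qed
  then have "\<bar>F x\<bar> / 2 \<le> H" by (rule dense_ge)
  then show ?thesis by simp
qed

lemma sob_data_H_norm:
  assumes "\<exists>D. sob_data (nat \<lfloor>m\<rfloor>) f D"
  obtains D where "sob_data (nat \<lfloor>m\<rfloor>) f D"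
    "\<And>j. j \<le> nat \<lfloor>m\<rfloor> \<Longrightarrow> (LINT x|lborel. (D j x)\<^sup>2) \<le> (H_norm m f)\<^sup>2"
proof -
  define D where "D = (SOME D. sob_data (nat \<lfloor>m\<rfloor>) f D)"
  have D: "sob_data (nat \<lfloor>m\<rfloor>) f D" unfolding D_def using assms by (rule someI_ex)
  have "(LINT x|lborel. (D j x)\<^sup>2) \<le> (H_norm m f)\<^sup>2" if "j \<le> nat \<lfloor>m\<rfloor>" for j
  proof -
    let ?R = "if m - of_int \<lfloor>m\<rfloor> > 0 then enn2real (gagliardo (m - of_int \<lfloor>m\<rfloor>) (D (nat \<lfloor>m\<rfloor>))) else 0"
    have "(LINT x|lborel. (D j x)\<^sup>2) \<le> (\<Sum>j\<le>nat \<lfloor>m\<rfloor>. LINT x|lborel. (D j x)\<^sup>2)"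
      by (rule member_le_sum) (use that in auto)
    also have "\<dots> \<le> (\<Sum>j\<le>nat \<lfloor>m\<rfloor>. LINT x|lborel. (D j x)\<^sup>2) + ?R"
      by simp
    also have "\<dots> = (H_norm m f)\<^sup>2"
      unfolding H_norm_def Let_def D_def[symmetric]
      by (subst real_sqrt_pow2) (auto intro!: add_nonneg_nonneg sum_nonneg)
    finally show ?thesis .
  qed
  with D that show thesis by blast
qed

lemma H_norm_nonneg: "0 \<le> H_norm m f"
  by (auto simp: H_norm_def Let_def intro!: add_nonneg_nonneg sum_nonneg)

text \<open>From \<open>m \<ge> 2\<close> there are two weak derivatives. \<open>F1\<close> is a
  primitive of the second one and equals the first one almost everywhere, hence \<open>F\<close> is
  a primitive of the continuous function \<open>F1\<close> and is classically differentiable.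
  \<open>G\<close> stands for the second derivative, which remains a mere integrable
  density.\<close>

lemma sobolev_representative:
  assumes "2 \<le> m" and "\<exists>D. sob_data (nat \<lfloor>m\<rfloor>) f D"
  obtains F F1 G where "AE x in lborel. f x = F x"
    "\<And>x. (F has_real_derivative F1 x) (at x)"
    "\<And>a b. a \<le> b \<Longrightarrow> (G has_integral F1 b - F1 a) {a..b}"
    "\<And>x. \<bar>F x\<bar> \<le> 2 * H_norm m f" "\<And>x. \<bar>F1 x\<bar> \<le> 2 * H_norm m f"
    "integrable lborel (\<lambda>x. (F x)\<^sup>2)"
proof -
  obtain D where D: "sob_data (nat \<lfloor>m\<rfloor>) f D"
    "\<And>j. j \<le> nat \<lfloor>m\<rfloor> \<Longrightarrow> (LINT x|lborel. (D j x)\<^sup>2) \<le> (H_norm m f)\<^sup>2"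
    using sob_data_H_norm[OF assms(2)] by blast
  have k: "2 \<le> nat \<lfloor>m\<rfloor>" using assms(1) by linarith
  have w': "\<And>j. j < nat \<lfloor>m\<rfloor> \<Longrightarrow> weak_deriv (D j) (D (Suc j))" and f: "D 0 = f"
    and sq': "\<And>j. j \<le> nat \<lfloor>m\<rfloor> \<Longrightarrow> square_integrable (D j)"
    using D(1) unfolding sob_data_def by auto
  have w: "weak_deriv (D 0) (D 1)" "weak_deriv (D 1) (D 2)"
  proof -
    have "0 < nat \<lfloor>m\<rfloor>" "1 < nat \<lfloor>m\<rfloor>" using k by linarith+
    from w'[OF this(1)] w'[OF this(2)] show "weak_deriv (D 0) (D 1)" "weak_deriv (D 1) (D 2)"
      by (auto simp: numeral_2_eq_2)
  qed
  have sq: "square_integrable (D 0)" "square_integrable (D 1)" "square_integrable (D 2)"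
    using k by (auto intro: sq')
  have le: "(LINT x|lborel. (D 0 x)\<^sup>2) \<le> (H_norm m f)\<^sup>2" "(LINT x|lborel. (D 1 x)\<^sup>2) \<le> (H_norm m f)\<^sup>2"
    "(LINT x|lborel. (D 2 x)\<^sup>2) \<le> (H_norm m f)\<^sup>2" using D(2) k by auto
  obtain F where F: "AE x in lborel. D 0 x = F x" "\<And>a b. a \<le> b \<Longrightarrow> (D 1 has_integral F b - F a) {a..b}"
    using weak_deriv_primitive[OF w(1)] by blast
  obtain F1 where F1: "AE x in lborel. D 1 x = F1 x" "\<And>a b. a \<le> b \<Longrightarrow> (D 2 has_integral F1 b - F1 a) {a..b}"
    using weak_deriv_primitive[OF w(2)] by blast
  note c = has_integral_imp_continuous[OF F(2)] has_integral_imp_continuous[OF F1(2)]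
  have [measurable]: "F \<in> borel_measurable borel" "F1 \<in> borel_measurable borel"
    "D 0 \<in> borel_measurable borel" "D 1 \<in> borel_measurable borel"
    using c sq by (auto intro: borel_measurable_continuous_onI simp: square_integrable_def)
  have *: "square_integrable K \<and> (LINT x|lborel. (K x)\<^sup>2) \<le> (H_norm m f)\<^sup>2"
    if "AE x in lborel. d x = K x" "square_integrable d" "(LINT x|lborel. (d x)\<^sup>2) \<le> (H_norm m f)\<^sup>2"
      and [measurable]: "K \<in> borel_measurable borel" for d K
  proof -
    have [measurable]: "d \<in> borel_measurable borel" using that by (simp add: square_integrable_def)
    have "AE x in lborel. (d x)\<^sup>2 = (K x)\<^sup>2" using that(1) by auto
    then have "integrable lborel (\<lambda>x. (d x)\<^sup>2) = integrable lborel (\<lambda>x. (K x)\<^sup>2)"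
      "(LINT x|lborel. (d x)\<^sup>2) = (LINT x|lborel. (K x)\<^sup>2)"
      by (intro integrable_cong_AE integral_cong_AE; measurable)+
    then show ?thesis using that by (simp add: square_integrable_def)
  qed
  have sF: "square_integrable F" "(LINT x|lborel. (F x)\<^sup>2) \<le> (H_norm m f)\<^sup>2"
    using *[OF F(1) sq(1) le(1)] by auto
  have sF1: "square_integrable F1" "(LINT x|lborel. (F1 x)\<^sup>2) \<le> (H_norm m f)\<^sup>2"
    using *[OF F1(1) sq(2) le(2)] by auto
  have FF1: "(F1 has_integral F b - F a) {a..b}" if "a \<le> b" for a b
  proof -
    obtain N where "negligible N" "\<And>x. x \<notin> N \<Longrightarrow> D 1 x = F1 x"
      using negligible_if_AE_lborel[OF F1(1)] by blast
    then show ?thesis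
      using has_integral_spike[of N "{a..b}" F1 "D 1"] F(2)[OF that] by auto
  qed
  show thesis
  proof (rule that[of F F1 "D 2"])
    show "AE x in lborel. f x = F x" using F(1) f by simp
    show "(F has_real_derivative F1 x) (at x)" for x by (rule primitive_has_deriv[OF FF1 c(2)])
    show "(D 2 has_integral F1 b - F1 a) {a..b}" if "a \<le> b" for a b using F1(2) that .
    show "\<bar>F x\<bar> \<le> 2 * H_norm m f" for x
      by (rule sup_bound_L2[OF FF1 sF(1) sF1(1) sF(2) sF1(2) H_norm_nonneg])
    show "\<bar>F1 x\<bar> \<le> 2 * H_norm m f" for x
      by (rule sup_bound_L2[OF F1(2) sF1(1) sq(3) sF1(2) le(3) H_norm_nonneg])
    show "integrable lborel (\<lambda>x. (F x)\<^sup>2)" using sF(1) by (simp add: square_integrable_def)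
  qed
qed

section \<open>Differentiable curves in Sobolev spaces\<close>

lemma square_integrable_lincomb:
  assumes "square_integrable f" "square_integrable g"
  shows "square_integrable (\<lambda>x. a * f x + b * g x)"
proof -
  have [measurable]: "f \<in> borel_measurable borel" "g \<in> borel_measurable borel"
    and i: "integrable lborel (\<lambda>x. (f x)\<^sup>2)" "integrable lborel (\<lambda>x. (g x)\<^sup>2)"
    using assms by (auto simp: square_integrable_def)
  have "integrable lborel (\<lambda>x. (a * f x + b * g x)\<^sup>2)"
  proof (rule Bochner_Integration.integrable_bound)
    show "integrable lborel (\<lambda>x. 2 * a\<^sup>2 * (f x)\<^sup>2 + 2 * b\<^sup>2 * (g x)\<^sup>2)"
      by (intro Bochner_Integration.integrable_add integrable_mult_right i)
    have "(a * f x + b * g x)\<^sup>2 \<le> 2 * a\<^sup>2 * (f x)\<^sup>2 + 2 * b\<^sup>2 * (g x)\<^sup>2" for x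
      using zero_le_power2[of "a * f x - b * g x"] by (simp add: power2_eq_square algebra_simps)
    then show "AE x in lborel. norm ((a * f x + b * g x)\<^sup>2) \<le> norm (2 * a\<^sup>2 * (f x)\<^sup>2 + 2 * b\<^sup>2 * (g x)\<^sup>2)"
      by (auto intro!: AE_I2 order_trans[OF _ abs_ge_self])
  qed auto
  then show ?thesis by (simp add: square_integrable_def)
qed

lemma loc_integrable_lincomb:
  assumes "loc_integrable f" "loc_integrable g"
  shows "loc_integrable (\<lambda>x. a * f x + b * g x)"
  using assms unfolding loc_integrable_def by (auto intro!: set_integral_add)

lemma weak_deriv_lincomb:
  assumes "weak_deriv f f'" "weak_deriv g g'"
  shows "weak_deriv (\<lambda>x. a * f x + b * g x) (\<lambda>x. a * f' x + b * g' x)"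
  unfolding weak_deriv_def
proof (intro conjI allI impI)
  note l = assms[unfolded weak_deriv_def]
  show "loc_integrable (\<lambda>x. a * f x + b * g x)" "loc_integrable (\<lambda>x. a * f' x + b * g' x)"
    using l by (auto intro: loc_integrable_lincomb)
  fix \<phi> assume \<phi>: "test_fun \<phi>"
  obtain c d where t: "\<And>x. x \<notin> {c..d} \<Longrightarrow> \<phi> x = 0" "\<And>x. x \<notin> {c..d} \<Longrightarrow> deriv \<phi> x = 0"
    "continuous_on UNIV \<phi>" "continuous_on UNIV (deriv \<phi>)"
    using test_fun_supported[OF \<phi>] by blast
  have i: "integrable lborel (\<lambda>x. f x * deriv \<phi> x)" "integrable lborel (\<lambda>x. g x * deriv \<phi> x)"
    "integrable lborel (\<lambda>x. f' x * \<phi> x)" "integrable lborel (\<lambda>x. g' x * \<phi> x)"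
    using l by (auto intro!: loc_integrable_mult_compact(1) t)
  have "(LINT x|lborel. (a * f x + b * g x) * deriv \<phi> x)
      = (LINT x|lborel. a * (f x * deriv \<phi> x) + b * (g x * deriv \<phi> x))"
    by (simp add: algebra_simps)
  also have "\<dots> = a * (LINT x|lborel. f x * deriv \<phi> x) + b * (LINT x|lborel. g x * deriv \<phi> x)"
    using i by simp
  also have "\<dots> = a * (- (LINT x|lborel. f' x * \<phi> x)) + b * (- (LINT x|lborel. g' x * \<phi> x))"
    using l \<phi> by simp
  also have "\<dots> = - (LINT x|lborel. a * (f' x * \<phi> x) + b * (g' x * \<phi> x))"
    using i by simp
  also have "\<dots> = - (LINT x|lborel. (a * f' x + b * g' x) * \<phi> x)"
    by (simp add: algebra_simps)
  finally show "(LINT x|lborel. (a * f x + b * g x) * deriv \<phi> x) = - (LINT x|lborel. (a * f' x + b * g' x) * \<phi> x)" .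
qed

lemma sob_data_lincomb:
  assumes "sob_data k f D" "sob_data k g E"
  shows "sob_data k (\<lambda>x. a * f x + b * g x) (\<lambda>j x. a * D j x + b * E j x)"
  unfolding sob_data_def
proof (intro conjI allI impI)
  note d = assms[unfolded sob_data_def]
  show "(\<lambda>x. a * D 0 x + b * E 0 x) = (\<lambda>x. a * f x + b * g x)"
    using d by simp
  fix j
  show "weak_deriv (\<lambda>x. a * D j x + b * E j x) (\<lambda>x. a * D (Suc j) x + b * E (Suc j) x)" if "j < k"
    by (rule weak_deriv_lincomb) (use d that in blast)+
  show "square_integrable (\<lambda>x. a * D j x + b * E j x)" if "j \<le> k"
    by (rule square_integrable_lincomb) (use d that in blast)+
qed

definition sob_rep :: "real \<Rightarrow> (real \<Rightarrow> real) \<Rightarrow> (real \<Rightarrow> real) \<Rightarrow> (real \<Rightarrow> real) \<Rightarrow> (real \<Rightarrow> real) \<Rightarrow> bool" where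
  "sob_rep m f F F1 G \<longleftrightarrow> (AE x in lborel. f x = F x) \<and>
    (\<forall>x. (F has_real_derivative F1 x) (at x)) \<and>
    (\<forall>a b. a \<le> b \<longrightarrow> (G has_integral F1 b - F1 a) {a..b}) \<and>
    (\<forall>x. \<bar>F x\<bar> \<le> 2 * H_norm m f \<and> \<bar>F1 x\<bar> \<le> 2 * H_norm m f) \<and>
    integrable lborel (\<lambda>x. (F x)\<^sup>2)"

lemma sob_rep_exists:
  assumes "2 \<le> m" and "\<exists>D. sob_data (nat \<lfloor>m\<rfloor>) f D"
  shows "\<exists>F F1 G. sob_rep m f F F1 G"
  unfolding sob_rep_def by (rule sobolev_representative[OF assms]) blast

text \<open>No norm law for \<open>H_norm\<close> enters. The function \<open>h\<close> has some
  representative bounded by its own \<open>H_norm\<close>; two continuous functions that agree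
  almost everywhere agree, so this representative is the linear combination, which inherits the
  bound. That is what carries \<open>H_norm\<close> of a difference quotient over to the
  representatives.\<close>

lemma sob_rep_lincomb:
  assumes "2 \<le> m" and "\<exists>D. sob_data (nat \<lfloor>m\<rfloor>) f D" "\<exists>D. sob_data (nat \<lfloor>m\<rfloor>) g D"
    and F: "sob_rep m f F F1 F2" and G: "sob_rep m g G G1 G2"
    and h: "h = (\<lambda>x. a * f x + b * g x)"
  shows "\<exists>D. sob_data (nat \<lfloor>m\<rfloor>) h D"
    and "sob_rep m h (\<lambda>x. a * F x + b * G x) (\<lambda>x. a * F1 x + b * G1 x) (\<lambda>x. a * F2 x + b * G2 x)"
proof -
  show ex: "\<exists>D. sob_data (nat \<lfloor>m\<rfloor>) h D"
    using assms(2,3) sob_data_lincomb h by blast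
  obtain H H1 H2 where H: "sob_rep m h H H1 H2"
    using sob_rep_exists[OF assms(1) ex] by blast
  let ?K = "\<lambda>x. a * F x + b * G x" and ?K1 = "\<lambda>x. a * F1 x + b * G1 x"
  have dK: "(?K has_real_derivative ?K1 x) (at x)" for x
    using F G unfolding sob_rep_def by (auto intro!: derivative_intros DERIV_cmult)
  have dH: "(H has_real_derivative H1 x) (at x)" for x
    using H unfolding sob_rep_def by blast
  have aeK: "AE x in lborel. h x = ?K x"
    using F G unfolding sob_rep_def h by auto
  have "AE x in lborel. H x = ?K x"
    using aeK H unfolding sob_rep_def by auto
  then have eq: "H x = ?K x" for x
    by (rule AE_eq_continuous) (auto intro!: DERIV_continuous_on dK dH)
  then have "H = ?K" by auto
  then have "H1 x = ?K1 x" for x using dK dH DERIV_unique by metis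
  then have bd: "\<bar>?K x\<bar> \<le> 2 * H_norm m h \<and> \<bar>?K1 x\<bar> \<le> 2 * H_norm m h" for x
    using H eq unfolding sob_rep_def by metis
  have int: "((\<lambda>x. a * F2 x + b * G2 x) has_integral ?K1 t - ?K1 s) {s..t}" if "s \<le> t" for s t
  proof -
    have "((\<lambda>x. a * F2 x + b * G2 x) has_integral a * (F1 t - F1 s) + b * (G1 t - G1 s)) {s..t}"
      using F G that unfolding sob_rep_def by (intro has_integral_add has_integral_mult_right) auto
    then show ?thesis by (simp add: algebra_simps)
  qed
  have "integrable lborel (\<lambda>x. (?K x)\<^sup>2)"
    using H \<open>H = ?K\<close> unfolding sob_rep_def by auto
  then show "sob_rep m h ?K ?K1 (\<lambda>x. a * F2 x + b * G2 x)"
    using aeK dK bd int unfolding sob_rep_def by blast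
qed

lemma jointly_continuous:
  fixes w :: "real \<Rightarrow> real \<Rightarrow> real"
  assumes c: "\<And>t. t \<in> S \<Longrightarrow> continuous_on A (\<lambda>x. w x t)"
    and u: "\<And>t e. t \<in> S \<Longrightarrow> e > 0 \<Longrightarrow> \<exists>d>0. \<forall>s\<in>S. \<bar>s - t\<bar> < d \<longrightarrow> (\<forall>x\<in>A. \<bar>w x s - w x t\<bar> < e)"
  shows "continuous_on (A \<times> S) (\<lambda>(x, t). w x t)"
  unfolding continuous_on_iff
proof (intro ballI allI impI)
  fix p :: "real \<times> real" and e :: real
  assume p: "p \<in> A \<times> S" and e: "e > 0"
  obtain x t where xt: "p = (x, t)" "x \<in> A" "t \<in> S" using p by auto
  obtain d where d: "d > 0" "\<forall>s\<in>S. \<bar>s - t\<bar> < d \<longrightarrow> (\<forall>x\<in>A. \<bar>w x s - w x t\<bar> < e / 2)"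
    using u[OF xt(3), of "e / 2"] e by auto
  obtain d' where d': "d' > 0" "\<forall>y\<in>A. dist y x < d' \<longrightarrow> dist (w y t) (w x t) < e / 2"
    using c[OF xt(3), unfolded continuous_on_iff, rule_format, of x "e / 2"] e xt(2) by auto
  show "\<exists>d>0. \<forall>p'\<in>A \<times> S. dist p' p < d \<longrightarrow> dist (case p' of (x, t) \<Rightarrow> w x t) (case p of (x, t) \<Rightarrow> w x t) < e"
  proof (intro exI conjI ballI impI)
    show "min d d' > 0" using d d' by simp
    fix p' :: "real \<times> real" assume p': "p' \<in> A \<times> S" "dist p' p < min d d'"
    obtain y s where ys: "p' = (y, s)" "y \<in> A" "s \<in> S" using p' by auto
    have "dist y x < d'" "\<bar>s - t\<bar> < d"
      using p'(2) dist_fst_le[of p' p] dist_snd_le[of p' p] by (auto simp: ys xt dist_real_def)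
    then have "dist (w y t) (w x t) < e / 2" "\<bar>w y s - w y t\<bar> < e / 2"
      using d d' ys by auto
    then have "\<bar>w y s - w x t\<bar> < e"
      unfolding dist_real_def by linarith
    then show "dist (case p' of (x, t) \<Rightarrow> w x t) (case p of (x, t) \<Rightarrow> w x t) < e"
      unfolding ys xt dist_real_def by simp
  qed
qed

lemma tendsto_zero_uniform:
  fixes h :: "real \<Rightarrow> real" and w :: "real \<Rightarrow> real \<Rightarrow> real"
  assumes "(h \<longlongrightarrow> 0) (at t within S)" "\<And>s x. s \<in> S \<Longrightarrow> s \<noteq> t \<Longrightarrow> \<bar>w x s - w x t\<bar> \<le> h s" "e > 0"
  shows "\<exists>d>0. \<forall>s\<in>S. \<bar>s - t\<bar> < d \<longrightarrow> (\<forall>x. \<bar>w x s - w x t\<bar> < e)"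
proof -
  have "\<forall>\<^sub>F s in at t within S. dist (h s) 0 < e"
    using assms(1,3) by (rule tendstoD)
  then obtain d where d: "d > 0" "\<forall>s\<in>S. s \<noteq> t \<and> dist s t < d \<longrightarrow> dist (h s) 0 < e"
    unfolding eventually_at by blast
  have "\<bar>w x s - w x t\<bar> < e" if "s \<in> S" "\<bar>s - t\<bar> < d" for s x
  proof (cases "s = t")
    case False
    then have "\<bar>h s\<bar> < e" using d that by (auto simp: dist_real_def)
    then show ?thesis using assms(2)[OF that(1) False, of x] by linarith
  qed (use assms in auto)
  then show ?thesis using d(1) by blast
qed

text \<open>The sup norms of a representative and of its \<open>x\<close>-derivative are at most
  twice the Sobolev norm. Convergence of difference quotients in \<open>H_norm\<close> is therefore
  uniform in \<open>x\<close>: the time derivative exists at every \<open>x\<close>, and continuity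
  in time is uniform enough for joint continuity.\<close>

lemma C1_H_representative:
  assumes C: "C1_H m T U" and m: "2 \<le> m" and T: "T > 0"
  obtains V Vx Vt G B T0 where
    "\<And>t. t \<in> {0..T} \<Longrightarrow> AE x in lborel. U x t = V x t"
    "\<And>x t. t \<in> {0..T} \<Longrightarrow> ((\<lambda>y. V y t) has_real_derivative Vx x t) (at x)"
    "\<And>t a b. t \<in> {0..T} \<Longrightarrow> a \<le> b \<Longrightarrow> (G t has_integral Vx b t - Vx a t) {a..b}"
    "\<And>x t. t \<in> {0..T} \<Longrightarrow> (V x has_real_derivative Vt x t) (at t within {0..T})"
    "continuous_on (UNIV \<times> {0..T}) (\<lambda>(x, t). V x t)"
    "continuous_on (UNIV \<times> {0..T}) (\<lambda>(x, t). Vx x t)"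
    "continuous_on (UNIV \<times> {0..T}) (\<lambda>(x, t). Vt x t)"
    "\<And>t. t \<in> {0..T} \<Longrightarrow> integrable lborel (\<lambda>x. (V x t)\<^sup>2)"
    "0 < T0" "T0 \<le> T"
    "\<And>x t. t \<in> {0..T0} \<Longrightarrow> \<bar>V x t\<bar> \<le> B" "\<And>x t. t \<in> {0..T0} \<Longrightarrow> \<bar>Vx x t\<bar> \<le> B"
proof -
  let ?I = "{0..T}"
  obtain U' where inH: "\<And>t. t \<in> ?I \<Longrightarrow> in_H m (\<lambda>x. U x t)" "\<And>t. t \<in> ?I \<Longrightarrow> in_H m (\<lambda>x. U' x t)"
    and l1: "\<And>t. t \<in> ?I \<Longrightarrow> ((\<lambda>s. H_norm m (\<lambda>x. (U x s - U x t) / (s - t) - U' x t)) \<longlongrightarrow> 0) (at t within ?I)"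
    and l2: "\<And>t. t \<in> ?I \<Longrightarrow> ((\<lambda>s. H_norm m (\<lambda>x. U' x s - U' x t)) \<longlongrightarrow> 0) (at t within ?I)"
    using C unfolding C1_H_def by blast
  have sd: "\<exists>D. sob_data (nat \<lfloor>m\<rfloor>) (\<lambda>x. U x t) D" "\<exists>D. sob_data (nat \<lfloor>m\<rfloor>) (\<lambda>x. U' x t) D" if "t \<in> ?I" for t
    using inH[OF that] unfolding in_H_def by blast+
  have "\<forall>t\<in>?I. \<exists>F F1 G. sob_rep m (\<lambda>x. U x t) F F1 G"
    using sob_rep_exists[OF m] sd by blast
  then obtain F F1 G where F: "\<And>t. t \<in> ?I \<Longrightarrow> sob_rep m (\<lambda>x. U x t) (F t) (F1 t) (G t)"
    by metis
  have "\<forall>t\<in>?I. \<exists>F F1 G. sob_rep m (\<lambda>x. U' x t) F F1 G"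
    using sob_rep_exists[OF m] sd by blast
  then obtain E E1 E2 where E: "\<And>t. t \<in> ?I \<Longrightarrow> sob_rep m (\<lambda>x. U' x t) (E t) (E1 t) (E2 t)"
    by metis
  let ?q = "\<lambda>t s. H_norm m (\<lambda>x. (U x s - U x t) / (s - t) - U' x t)"
  \<comment> \<open>Two linear combinations in a row: the difference quotient of \<open>U\<close>,
    then the subtraction of \<open>U'\<close>. The factor \<open>1 / (s - t)\<close> stays inside
    the function whose \<open>H_norm\<close> is taken.\<close>
  have q: "\<bar>(F s x - F t x) / (s - t) - E t x\<bar> \<le> 2 * ?q t s \<and> \<bar>(F1 s x - F1 t x) / (s - t) - E1 t x\<bar> \<le> 2 * ?q t s"
    if st: "s \<in> ?I" "t \<in> ?I" for s t x
  proof -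
    let ?a = "1 / (s - t)"
    note r1 = sob_rep_lincomb[OF m sd(1)[OF st(1)] sd(1)[OF st(2)] F[OF st(1)] F[OF st(2)] refl, of ?a "- ?a"]
    note r2 = sob_rep_lincomb[OF m r1(1) sd(2)[OF st(2)] r1(2) E[OF st(2)] refl, of 1 "-1"]
    have "(\<lambda>x. 1 * (?a * U x s + - ?a * U x t) + - 1 * U' x t) = (\<lambda>x. (U x s - U x t) / (s - t) - U' x t)"
      by (auto simp: diff_divide_distrib)
    then show ?thesis
      using r2(2) unfolding sob_rep_def by (auto simp: diff_divide_distrib)
  qed
  have q': "\<bar>E s x - E t x\<bar> \<le> 2 * H_norm m (\<lambda>x. U' x s - U' x t)"
    if st: "s \<in> ?I" "t \<in> ?I" for s t x
    using sob_rep_lincomb(2)[OF m sd(2)[OF st(1)] sd(2)[OF st(2)] E[OF st(1)] E[OF st(2)] refl, of 1 "-1"]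
    unfolding sob_rep_def by auto
  have l1': "((\<lambda>s. 2 * ?q t s) \<longlongrightarrow> 0) (at t within ?I)" if "t \<in> ?I" for t
    using tendsto_mult[OF tendsto_const l1[OF that], of 2] by simp
  have l2': "((\<lambda>s. 2 * H_norm m (\<lambda>x. U' x s - U' x t)) \<longlongrightarrow> 0) (at t within ?I)" if "t \<in> ?I" for t
    using tendsto_mult[OF tendsto_const l2[OF that], of 2] by simp
  \<comment> \<open>A modulus of continuity at time \<open>t\<close> that works for \<open>F\<close>
    and \<open>F1\<close> alike: an increment is \<open>s - t\<close> times a difference quotient,
    and the quotient stays within \<open>2 * ?q t s\<close> of the time derivative.\<close>
  define h where "h t s = \<bar>s - t\<bar> * (2 * ?q t s + 2 * H_norm m (\<lambda>x. U' x t))" for t s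
  have h0: "(h t \<longlongrightarrow> 0) (at t within ?I)" if "t \<in> ?I" for t
  proof -
    have "((\<lambda>s. \<bar>s - t\<bar> * (2 * ?q t s + 2 * H_norm m (\<lambda>x. U' x t))) \<longlongrightarrow> \<bar>t - t\<bar> * (0 + 2 * H_norm m (\<lambda>x. U' x t))) (at t within ?I)"
      by (intro tendsto_intros l1' that)
    then show ?thesis by (simp add: h_def[abs_def])
  qed
  have hb: "\<bar>d\<bar> \<le> h t s" if "\<bar>d / (s - t) - c\<bar> \<le> 2 * ?q t s" "\<bar>c\<bar> \<le> 2 * H_norm m (\<lambda>x. U' x t)" "s \<noteq> t" for s t d c
  proof -
    have "\<bar>d / (s - t)\<bar> \<le> 2 * ?q t s + 2 * H_norm m (\<lambda>x. U' x t)"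
      using that(1,2) by linarith
    then have "\<bar>s - t\<bar> * \<bar>d / (s - t)\<bar> \<le> h t s"
      unfolding h_def by (rule mult_left_mono) simp
    moreover have "\<bar>s - t\<bar> * \<bar>d / (s - t)\<bar> = \<bar>d\<bar>"
      using that(3) by (simp add: abs_divide)
    ultimately show ?thesis by simp
  qed
  have bE: "\<bar>E t x\<bar> \<le> 2 * H_norm m (\<lambda>x. U' x t) \<and> \<bar>E1 t x\<bar> \<le> 2 * H_norm m (\<lambda>x. U' x t)" if "t \<in> ?I" for t x
    using E[OF that] unfolding sob_rep_def by blast
  have bF: "\<bar>F t x\<bar> \<le> 2 * H_norm m (\<lambda>x. U x t) \<and> \<bar>F1 t x\<bar> \<le> 2 * H_norm m (\<lambda>x. U x t)" if "t \<in> ?I" for t x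
    using F[OF that] unfolding sob_rep_def by blast
  have uF: "\<exists>d>0. \<forall>s\<in>?I. \<bar>s - t\<bar> < d \<longrightarrow> (\<forall>x. \<bar>F s x - F t x\<bar> < e)" if "t \<in> ?I" "e > 0" for t e
    by (rule tendsto_zero_uniform[OF h0[OF that(1)] hb that(2)]) (use q bE that in blast)+
  have uF1: "\<exists>d>0. \<forall>s\<in>?I. \<bar>s - t\<bar> < d \<longrightarrow> (\<forall>x. \<bar>F1 s x - F1 t x\<bar> < e)" if "t \<in> ?I" "e > 0" for t e
    by (rule tendsto_zero_uniform[OF h0[OF that(1)] hb that(2)]) (use q bE that in blast)+
  have uE: "\<exists>d>0. \<forall>s\<in>?I. \<bar>s - t\<bar> < d \<longrightarrow> (\<forall>x. \<bar>E s x - E t x\<bar> < e)" if "t \<in> ?I" "e > 0" for t e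
    by (rule tendsto_zero_uniform[OF l2'[OF that(1)] q' that(2)]) (use that in auto)
  have dF: "(F t has_real_derivative F1 t x) (at x)" if "t \<in> ?I" for t x
    using F[OF that] unfolding sob_rep_def by blast
  have dE: "(E t has_real_derivative E1 t x) (at x)" if "t \<in> ?I" for t x
    using E[OF that] unfolding sob_rep_def by blast
  have cF1: "continuous_on UNIV (F1 t)" if "t \<in> ?I" for t
    using F[OF that] unfolding sob_rep_def by (intro has_integral_imp_continuous) blast
  obtain d where d: "d > 0" "\<forall>s\<in>?I. \<bar>s - 0\<bar> < d \<longrightarrow> (\<forall>x. \<bar>F s x - F 0 x\<bar> < 1)"
    using uF[of 0 1] T by auto
  obtain d' where d': "d' > 0" "\<forall>s\<in>?I. \<bar>s - 0\<bar> < d' \<longrightarrow> (\<forall>x. \<bar>F1 s x - F1 0 x\<bar> < 1)"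
    using uF1[of 0 1] T by auto
  \<comment> \<open>Up to time \<open>T0\<close> the functions stay within 1 of their values at time
    0, which explains the \<open>+ 1\<close> in \<open>B\<close>. The halves turn the strict
    conditions \<open>< d\<close> and \<open>< d'\<close> into a closed time interval.\<close>
  define T0 where "T0 = min T (min (d / 2) (d' / 2))"
  define B where "B = 2 * H_norm m (\<lambda>x. U x 0) + 1"
  show thesis
  proof (rule that[of "\<lambda>x t. F t x" "\<lambda>x t. F1 t x" G "\<lambda>x t. E t x" T0 B])
    fix x t assume t: "t \<in> ?I"
    show "AE x in lborel. U x t = F t x" "integrable lborel (\<lambda>x. (F t x)\<^sup>2)"
      using F[OF t] unfolding sob_rep_def by blast+
    show "(F t has_real_derivative F1 t x) (at x)" using dF[OF t] .
    show "(G t has_integral F1 t b - F1 t a) {a..b}" if "a \<le> b" for a b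
      using F[OF t] that unfolding sob_rep_def by blast
    have "((\<lambda>s. (F s x - F t x) / (s - t) - E t x) \<longlongrightarrow> 0) (at t within ?I)"
      by (rule Lim_null_comparison[OF _ l1'[OF t]])
         (use q t in \<open>auto simp: eventually_at_filter intro!: always_eventually\<close>)
    then show "((\<lambda>s. F s x) has_real_derivative E t x) (at t within ?I)"
      unfolding has_field_derivative_iff by (simp add: LIM_zero_iff)
  next
    show "continuous_on (UNIV \<times> ?I) (\<lambda>(x, t). F t x)"
      by (rule jointly_continuous) (auto intro!: DERIV_continuous_on dF uF)
    show "continuous_on (UNIV \<times> ?I) (\<lambda>(x, t). F1 t x)"
      by (rule jointly_continuous) (auto intro!: cF1 uF1)
    show "continuous_on (UNIV \<times> ?I) (\<lambda>(x, t). E t x)"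
      by (rule jointly_continuous) (auto intro!: DERIV_continuous_on dE uE)
    show "0 < T0" "T0 \<le> T" using T d d' by (auto simp: T0_def)
    fix x t assume t: "t \<in> {0..T0}"
    have "\<bar>F t x - F 0 x\<bar> < 1" "\<bar>F1 t x - F1 0 x\<bar> < 1"
      using d d' t by (auto simp: T0_def)
    then show "\<bar>F t x\<bar> \<le> B" "\<bar>F1 t x\<bar> \<le> B"
      using bF[of 0 x] T unfolding B_def by auto
  qed
qed

section \<open>Flows bordering on vacuum\<close>

lemma positive_maximum:
  fixes W :: "real \<Rightarrow> real \<Rightarrow> real"
  assumes c: "continuous_on ({a..b} \<times> {0..T}) (\<lambda>(x, t). W x t)"
    and bd: "\<And>t. t \<in> {0..T} \<Longrightarrow> W a t \<le> 0" "\<And>t. t \<in> {0..T} \<Longrightarrow> W b t \<le> 0"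
    and init: "\<And>x. x \<in> {a..b} \<Longrightarrow> W x 0 \<le> 0"
    and pos: "x0 \<in> {a..b}" "t0 \<in> {0..T}" "W x0 t0 > 0"
  obtains x t where "a < x" "x < b" "0 < t" "t \<le> T" "W x t > 0"
    "\<And>y s. y \<in> {a..b} \<Longrightarrow> s \<in> {0..T} \<Longrightarrow> W y s \<le> W x t"
proof -
  have "compact ({a..b} \<times> {0..T})" by (intro compact_Times compact_Icc)
  moreover have "{a..b} \<times> {0..T} \<noteq> {}" using pos by auto
  ultimately obtain p where p: "p \<in> {a..b} \<times> {0..T}"
    "\<forall>p'\<in>{a..b} \<times> {0..T}. (\<lambda>(x, t). W x t) p' \<le> (\<lambda>(x, t). W x t) p"
    using continuous_attains_sup[OF _ _ c] by blast
  obtain x t where xt: "p = (x, t)" by fastforce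
  have mx: "W y s \<le> W x t" if "y \<in> {a..b}" "s \<in> {0..T}" for y s
    using p(2) that unfolding xt by auto
  have W: "W x t > 0" using mx[OF pos(1,2)] pos(3) by linarith
  have "x \<in> {a..b}" "t \<in> {0..T}" using p(1) unfolding xt by auto
  moreover have "x \<noteq> a" "x \<noteq> b" "t \<noteq> 0"
    using W bd init calculation by force+
  ultimately show thesis using that[of x t] W mx by auto
qed

lemma deriv_zero_at_max:
  fixes f :: "real \<Rightarrow> real"
  assumes "(f has_real_derivative d) (at x)" "\<forall>\<^sub>F y in at x. f y \<le> f x"
  shows "d = 0"
proof -
  obtain r where "r > 0" "\<forall>y. y \<noteq> x \<and> dist y x < r \<longrightarrow> f y \<le> f x"
    using assms(2) unfolding eventually_at by auto
  then have "\<forall>y. \<bar>x - y\<bar> < r \<longrightarrow> f y \<le> f x"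
    by (metis abs_minus_commute dist_real_def order_refl)
  with DERIV_local_max[OF assms(1) \<open>r > 0\<close>] show ?thesis by blast
qed

text \<open>Comparison with earlier times alone suffices. This admits a maximum at the final time
  \<open>T\<close>, where only a one-sided derivative exists; an interior maximum gives the same
  inequality.\<close>

lemma deriv_nonneg_at_late_max:
  fixes f :: "real \<Rightarrow> real"
  assumes f: "(f has_real_derivative d) (at t within {0..T})" and t: "0 < t" "t \<le> T"
    and mx: "\<forall>\<^sub>F s in at t within {0..T}. f s \<le> f t"
  shows "0 \<le> d"
proof -
  have le: "at t within {0..t} \<le> at t within {0..T}"
    using t by (intro at_le) auto
  have "((\<lambda>s. (f s - f t) / (s - t)) \<longlongrightarrow> d) (at t within {0..t})"
    using f tendsto_mono[OF le] unfolding has_field_derivative_iff by blast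
  moreover have "\<forall>\<^sub>F s in at t within {0..t}. 0 \<le> (f s - f t) / (s - t)"
  proof -
    have "\<forall>\<^sub>F s in at t within {0..t}. f s \<le> f t"
      using mx filter_leD[OF le] by blast
    moreover have "\<forall>\<^sub>F s in at t within {0..t}. s \<in> {0..t}"
      by (simp add: eventually_at_filter)
    ultimately show ?thesis
      by eventually_elim (auto intro: divide_nonpos_nonpos)
  qed
  moreover have "at t within {0..t} \<noteq> bot"
    using t by (simp add: at_within_Icc_at_left)
  ultimately show ?thesis by (rule tendsto_lowerbound)
qed

text \<open>Evaluated at a positive maximum of \<open>ga\<^sup>+ gb\<^sup>+ q\<close>. The window \<open>ga, gb > 0\<close> is transported
  inwards by the velocity, so no boundary values of \<open>q\<close> and no characteristics are needed.\<close>

lemma transport_comparison: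
  fixes q ga gb v :: "real \<Rightarrow> real \<Rightarrow> real"
  assumes c: "continuous_on ({a..b} \<times> {0..T}) (\<lambda>(x, t). ga x t)"
      "continuous_on ({a..b} \<times> {0..T}) (\<lambda>(x, t). gb x t)"
      "continuous_on ({a..b} \<times> {0..T}) (\<lambda>(x, t). q x t)"
    and bd: "\<And>t. t \<in> {0..T} \<Longrightarrow> ga a t \<le> 0" "\<And>t. t \<in> {0..T} \<Longrightarrow> gb b t \<le> 0"
    and init: "\<And>x. x \<in> {a..b} \<Longrightarrow> q x 0 \<le> 0"
    and dx: "\<And>x t. x \<in> {a<..<b} \<Longrightarrow> t \<in> {0<..T} \<Longrightarrow> ((\<lambda>y. ga y t) has_real_derivative gax x t) (at x)"
      "\<And>x t. x \<in> {a<..<b} \<Longrightarrow> t \<in> {0<..T} \<Longrightarrow> ((\<lambda>y. gb y t) has_real_derivative gbx x t) (at x)"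
      "\<And>x t. x \<in> {a<..<b} \<Longrightarrow> t \<in> {0<..T} \<Longrightarrow> ((\<lambda>y. q y t) has_real_derivative qx x t) (at x)"
    and dt: "\<And>x t. x \<in> {a<..<b} \<Longrightarrow> t \<in> {0<..T} \<Longrightarrow> (ga x has_real_derivative gat x t) (at t within {0..T})"
      "\<And>x t. x \<in> {a<..<b} \<Longrightarrow> t \<in> {0<..T} \<Longrightarrow> (gb x has_real_derivative gbt x t) (at t within {0..T})"
      "\<And>x t. x \<in> {a<..<b} \<Longrightarrow> t \<in> {0<..T} \<Longrightarrow> (q x has_real_derivative qt x t) (at t within {0..T})"
    and tr: "\<And>x t. x \<in> {a<..<b} \<Longrightarrow> t \<in> {0<..T} \<Longrightarrow> gat x t + v x t * gax x t \<le> 0"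
      "\<And>x t. x \<in> {a<..<b} \<Longrightarrow> t \<in> {0<..T} \<Longrightarrow> gbt x t + v x t * gbx x t \<le> 0"
      "\<And>x t. x \<in> {a<..<b} \<Longrightarrow> t \<in> {0<..T} \<Longrightarrow> ga x t > 0 \<Longrightarrow> gb x t > 0 \<Longrightarrow> q x t > 0 \<Longrightarrow>
         qt x t + v x t * qx x t < 0"
    and pt: "x0 \<in> {a..b}" "t0 \<in> {0..T}" "ga x0 t0 > 0" "gb x0 t0 > 0"
  shows "q x0 t0 \<le> 0"
proof (rule ccontr)
  assume "\<not> q x0 t0 \<le> 0"
  then have q0: "q x0 t0 > 0" by simp
  \<comment> \<open>The positive parts make \<open>W\<close> vanish where the window is closed, in
    particular at \<open>x = a\<close> and \<open>x = b\<close>. Near a positive maximum both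
    cut-offs are inactive and \<open>W\<close> is the differentiable product
    \<open>?f\<close>.\<close>
  define W where "W x t = max 0 (ga x t) * max 0 (gb x t) * q x t" for x t
  have cW: "continuous_on ({a..b} \<times> {0..T}) (\<lambda>(x, t). W x t)"
    using c unfolding W_def case_prod_unfold by (intro continuous_intros)
  obtain x t where xt: "a < x" "x < b" "0 < t" "t \<le> T" "W x t > 0"
    "\<And>y s. y \<in> {a..b} \<Longrightarrow> s \<in> {0..T} \<Longrightarrow> W y s \<le> W x t"
  proof (rule positive_maximum[OF cW])
    show "W a t \<le> 0" "W b t \<le> 0" if "t \<in> {0..T}" for t
      using bd that by (auto simp: W_def)
    show "W x 0 \<le> 0" if "x \<in> {a..b}" for x
      using init[OF that] by (auto simp: W_def intro!: mult_nonneg_nonpos mult_nonneg_nonneg)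
    show "x0 \<in> {a..b}" "t0 \<in> {0..T}" using pt by auto
    show "W x0 t0 > 0" using pt q0 by (simp add: W_def)
  qed blast
  have x: "x \<in> {a<..<b}" and t: "t \<in> {0<..T}" using xt by auto
  have g: "ga x t > 0" "gb x t > 0"
  proof -
    have "\<not> ga x t \<le> 0" "\<not> gb x t \<le> 0" using xt(5) by (auto simp: W_def max_absorb1)
    then show "ga x t > 0" "gb x t > 0" by auto
  qed
  then have q: "q x t > 0"
    using xt(5) zero_less_mult_pos[of "ga x t * gb x t" "q x t"] by (simp add: W_def)
  let ?f = "\<lambda>y s. ga y s * gb y s * q y s"
  have le: "?f y s \<le> ?f x t" if "y \<in> {a..b}" "s \<in> {0..T}" "0 < ga y s" "0 < gb y s" for y s
    using xt(6)[OF that(1,2)] that(3,4) g by (simp add: W_def)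
  have "((\<lambda>y. ?f y t) has_real_derivative (gax x t * gb x t + gbx x t * ga x t) * q x t + qx x t * (ga x t * gb x t)) (at x)"
    by (intro DERIV_mult dx x t)
  moreover have "\<forall>\<^sub>F y in at x. ?f y t \<le> ?f x t"
  proof -
    have "\<forall>\<^sub>F y in at x. 0 < ga y t" "\<forall>\<^sub>F y in at x. 0 < gb y t"
      using DERIV_isCont[OF dx(1)[OF x t]] DERIV_isCont[OF dx(2)[OF x t]] g
      unfolding isCont_def by (auto dest: order_tendstoD)
    moreover have "\<forall>\<^sub>F y in at x. y \<in> {a<..<b}"
      using x by (intro eventually_at_in_open') auto
    ultimately show ?thesis
      by eventually_elim (use t in \<open>auto intro!: le\<close>)
  qed
  ultimately have 1: "(gax x t * gb x t + gbx x t * ga x t) * q x t + qx x t * (ga x t * gb x t) = 0"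
    by (rule deriv_zero_at_max)
  have "((\<lambda>s. ?f x s) has_real_derivative (gat x t * gb x t + gbt x t * ga x t) * q x t + qt x t * (ga x t * gb x t)) (at t within {0..T})"
    by (intro DERIV_mult dt x t)
  moreover have "\<forall>\<^sub>F s in at t within {0..T}. ?f x s \<le> ?f x t"
  proof -
    have "\<forall>\<^sub>F s in at t within {0..T}. 0 < ga x s" "\<forall>\<^sub>F s in at t within {0..T}. 0 < gb x s"
      using DERIV_continuous[OF dt(1)[OF x t]] DERIV_continuous[OF dt(2)[OF x t]] g
      unfolding continuous_within by (auto dest: order_tendstoD)
    moreover have "\<forall>\<^sub>F s in at t within {0..T}. s \<in> {0..T}"
      by (simp add: eventually_at_filter)
    ultimately show ?thesis
      by eventually_elim (use x in \<open>auto intro!: le\<close>)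
  qed
  ultimately have 2: "0 \<le> (gat x t * gb x t + gbt x t * ga x t) * q x t + qt x t * (ga x t * gb x t)"
    using xt by (intro deriv_nonneg_at_late_max)
  have "(gat x t + v x t * gax x t) * (gb x t * q x t) \<le> 0"
    "(gbt x t + v x t * gbx x t) * (ga x t * q x t) \<le> 0"
    using tr(1,2)[OF x t] g q by (auto intro!: mult_nonpos_nonneg)
  moreover have "(qt x t + v x t * qx x t) * (ga x t * gb x t) < 0"
    using tr(3)[OF x t g q] g by (auto intro!: mult_neg_pos)
  \<comment> \<open>The left side is the derivative of the product along the velocity
    \<open>v\<close>. At the maximum its time part is nonnegative and its space part zero, yet by
    the product rule it is a sum of two nonpositive terms and a negative one.\<close>
  moreover have "(gat x t * gb x t + gbt x t * ga x t) * q x t + qt x t * (ga x t * gb x t)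
      + v x t * ((gax x t * gb x t + gbx x t * ga x t) * q x t + qx x t * (ga x t * gb x t))
    = (gat x t + v x t * gax x t) * (gb x t * q x t) + (gbt x t + v x t * gbx x t) * (ga x t * q x t)
      + (qt x t + v x t * qx x t) * (ga x t * gb x t)"
    by (simp add: algebra_simps)
  ultimately show False using 1 2 by simp
qed

lemma integrable_lborel_const_halfline:
  fixes f :: "real \<Rightarrow> real"
  assumes "integrable lborel f" "\<And>y. y \<le> a \<Longrightarrow> f y = c"
  shows "c = 0"
proof (rule ccontr)
  assume "c \<noteq> 0"
  have le: "\<bar>c\<bar> * real n \<le> (LINT x|lborel. \<bar>f x\<bar>)" for n
  proof -
    have "(LINT x|lborel. \<bar>c\<bar> * indicator {a - real n..a} x) \<le> (LINT x|lborel. \<bar>f x\<bar>)"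
    proof (rule integral_mono)
      show "integrable lborel (\<lambda>x. \<bar>c\<bar> * indicat_real {a - real n..a} x)"
        by (intro integrable_mult_right) (simp add: integrable_indicator_iff emeasure_lborel_Icc_eq)
      show "\<bar>c\<bar> * indicat_real {a - real n..a} x \<le> \<bar>f x\<bar>" for x
        using assms(2) by (auto simp: indicator_def)
    qed (use assms(1) in simp)
    then show ?thesis by simp
  qed
  obtain n :: nat where "(LINT x|lborel. \<bar>f x\<bar>) / \<bar>c\<bar> < real n"
    using reals_Archimedean2 by blast
  then have "(LINT x|lborel. \<bar>f x\<bar>) < \<bar>c\<bar> * real n"
    using \<open>c \<noteq> 0\<close> by (simp add: divide_less_eq mult.commute)
  with le[of n] show False by simp
qed

text \<open>The momentum equation is kept in the form \<open>(\<mu> u\<^sub>x - p)\<^sub>x = \<rho> (u\<^sub>t + u u\<^sub>x)\<close>: the stress is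
  classically differentiable although \<open>u\<^sub>x\<^sub>x\<close> need not be continuous.\<close>

locale flow =
  fixes \<mu> \<gamma> T B :: real and \<rho> \<rho>x \<rho>t u ux ut e ex et :: "real \<Rightarrow> real \<Rightarrow> real"
  assumes \<mu>: "\<mu> > 0" and \<gamma>: "\<gamma> > 1" and T: "T > 0"
    and cont: "continuous_on (UNIV \<times> {0..T}) (\<lambda>(x, t). \<rho> x t)" "continuous_on (UNIV \<times> {0..T}) (\<lambda>(x, t). \<rho>x x t)"
      "continuous_on (UNIV \<times> {0..T}) (\<lambda>(x, t). \<rho>t x t)" "continuous_on (UNIV \<times> {0..T}) (\<lambda>(x, t). u x t)"
      "continuous_on (UNIV \<times> {0..T}) (\<lambda>(x, t). ux x t)" "continuous_on (UNIV \<times> {0..T}) (\<lambda>(x, t). ut x t)"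
      "continuous_on (UNIV \<times> {0..T}) (\<lambda>(x, t). e x t)" "continuous_on (UNIV \<times> {0..T}) (\<lambda>(x, t). ex x t)"
      "continuous_on (UNIV \<times> {0..T}) (\<lambda>(x, t). et x t)"
    and dx: "\<And>x t. t \<in> {0..T} \<Longrightarrow> ((\<lambda>y. \<rho> y t) has_real_derivative \<rho>x x t) (at x)"
      "\<And>x t. t \<in> {0..T} \<Longrightarrow> ((\<lambda>y. u y t) has_real_derivative ux x t) (at x)"
      "\<And>x t. t \<in> {0..T} \<Longrightarrow> ((\<lambda>y. e y t) has_real_derivative ex x t) (at x)"
    and dt: "\<And>x t. t \<in> {0..T} \<Longrightarrow> (\<rho> x has_real_derivative \<rho>t x t) (at t within {0..T})"
      "\<And>x t. t \<in> {0..T} \<Longrightarrow> (u x has_real_derivative ut x t) (at t within {0..T})"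
      "\<And>x t. t \<in> {0..T} \<Longrightarrow> (e x has_real_derivative et x t) (at t within {0..T})"
    and mass: "\<And>x t. t \<in> {0<..T} \<Longrightarrow> \<rho>t x t + \<rho>x x t * u x t + \<rho> x t * ux x t = 0"
    and momentum: "\<And>x t. t \<in> {0<..T} \<Longrightarrow> ((\<lambda>y. \<mu> * ux y t - (\<gamma> - 1) * \<rho> y t * e y t) has_real_derivative
        \<rho> x t * (ut x t + u x t * ux x t)) (at x)"
    and energy: "\<And>x t. t \<in> {0<..T} \<Longrightarrow>
        \<rho> x t * (et x t + u x t * ex x t + (\<gamma> - 1) * e x t * ux x t) = \<mu> * (ux x t)\<^sup>2"
    and L2: "\<And>t. t \<in> {0..T} \<Longrightarrow> integrable lborel (\<lambda>x. (u x t)\<^sup>2)"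
    and bound: "\<And>x t. t \<in> {0..T} \<Longrightarrow> \<bar>u x t\<bar> \<le> B" "\<And>x t. t \<in> {0..T} \<Longrightarrow> \<bar>ux x t\<bar> \<le> B"
begin

section \<open>Propagation of vacuum, of positive density and of the sign of the energy\<close>

lemma B_nonneg: "B \<ge> 0"
  using bound(1)[of 0 0] T by auto

lemma cont_sub:
  assumes "A \<subseteq> UNIV \<times> {0..T}"
  shows "continuous_on A (\<lambda>(x, t). \<rho> x t)" "continuous_on A (\<lambda>(x, t). e x t)"
  by (rule cont(1,7)[THEN continuous_on_subset, OF assms])+

lemma slice_continuous:
  assumes "t \<in> {0..T}"
  shows "continuous_on A (\<lambda>y. \<rho> y t)" "continuous_on A (\<lambda>y. u y t)"
  by (rule DERIV_continuous_on, rule has_field_derivative_at_within, rule dx(1)[OF assms])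
     (rule DERIV_continuous_on, rule has_field_derivative_at_within, rule dx(2)[OF assms])

lemma u_lipschitz:
  assumes "t \<in> {0..T}" shows "\<bar>u x t - u y t\<bar> \<le> B * \<bar>x - y\<bar>"
proof -
  have "norm (u x t - u y t) \<le> B * norm (x - y)"
    by (rule field_differentiable_bound[of UNIV _ "\<lambda>x. ux x t"])
       (use dx(2) bound(2) assms in \<open>auto intro: has_field_derivative_at_within\<close>)
  then show ?thesis by simp
qed

text \<open>The square of the density solves a linear transport equation with zero initial values on
  the left, and the square spares any assumption on the sign of \<open>\<rho>\<close>. The window
  closes in at speed \<open>k\<close>, so only fluid from \<open>x \<le> 0\<close> is seen. The
  speed bound is a parameter because \<open>vacuum_at_rest\<close> improves it repeatedly, down to
  \<open>k = 0\<close>.\<close>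

lemma density_vanishes:
  assumes init: "\<And>x. x \<le> 0 \<Longrightarrow> \<rho> x 0 = 0"
    and k: "0 \<le> k" "\<And>x t. x \<le> 0 \<Longrightarrow> t \<in> {0<..T} \<Longrightarrow> \<bar>u x t\<bar> \<le> k"
    and xt: "t \<in> {0..T}" "x < - k * t"
  shows "\<rho> x t = 0"
proof -
  \<comment> \<open>With this \<open>R\<close> the left edge \<open>k * t - R\<close> of the window
    is still to the left of \<open>x\<close> at time \<open>t\<close>. In the next line
    \<open>2 * B\<close> dominates the rate \<open>-2 * ux\<close> at which the square grows, and
    the \<open>+ 1\<close> makes the inequality strict.\<close>
  define R where "R = k * T - x + 1"
  define l where "l = 2 * B + 1"
  have kt: "k * s \<le> k * T" if "s \<in> {0..T}" for s
    using that k(1) by (auto intro: mult_left_mono)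
  have "exp (- l * t) * (\<rho> x t)\<^sup>2 \<le> 0"
  proof (rule transport_comparison[where ga = "\<lambda>x t. x + R - k * t" and gb = "\<lambda>x t. - x - k * t"
        and gax = "\<lambda>_ _. 1" and gat = "\<lambda>_ _. - k" and gbx = "\<lambda>_ _. - 1" and gbt = "\<lambda>_ _. - k"
        and q = "\<lambda>x t. exp (- l * t) * (\<rho> x t)\<^sup>2" and v = u and a = "- R" and b = 0
        and qx = "\<lambda>x t. exp (- l * t) * (2 * \<rho> x t * \<rho>x x t)"
        and qt = "\<lambda>x t. - l * exp (- l * t) * (\<rho> x t)\<^sup>2 + exp (- l * t) * (2 * \<rho> x t * \<rho>t x t)"])
    show "continuous_on ({- R..0} \<times> {0..T}) (\<lambda>(x, t). exp (- l * t) * (\<rho> x t)\<^sup>2)"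
      using cont_sub(1)[of "{- R..0} \<times> {0..T}"] unfolding case_prod_unfold by (intro continuous_intros) auto
    show "x \<in> {- R..0}" "0 < x + R - k * t" "0 < - x - k * t"
    proof -
      have "0 \<le> k * t" "k * t \<le> k * T" using xt k(1) kt[of t] by auto
      then show "x \<in> {- R..0}" "0 < x + R - k * t" "0 < - x - k * t"
        using xt by (auto simp: R_def)
    qed
    fix y s assume y: "y \<in> {- R<..<0}" and s: "s \<in> {0<..T}"
    note us = k(2)[of y s]
    show "- k + u y s * 1 \<le> 0" "- k + u y s * - 1 \<le> 0" using us y s by auto
    have s': "s \<in> {0..T}" using s by auto
    show "((\<lambda>y. exp (- l * s) * (\<rho> y s)\<^sup>2) has_real_derivative exp (- l * s) * (2 * \<rho> y s * \<rho>x y s)) (at y)"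
      by (auto intro!: derivative_eq_intros dx(1) s')
    show "((\<lambda>s. exp (- l * s) * (\<rho> y s)\<^sup>2) has_real_derivative
        - l * exp (- l * s) * (\<rho> y s)\<^sup>2 + exp (- l * s) * (2 * \<rho> y s * \<rho>t y s)) (at s within {0..T})"
      by (auto intro!: derivative_eq_intros dt(1) s')
    assume "0 < exp (- l * s) * (\<rho> y s)\<^sup>2"
    then have pos: "0 < exp (- l * s) * (\<rho> y s)\<^sup>2" by simp
    have rt: "\<rho>t y s = - \<rho>x y s * u y s - \<rho> y s * ux y s" using mass[OF s, of y] by linarith
    have "- l * exp (- l * s) * (\<rho> y s)\<^sup>2 + exp (- l * s) * (2 * \<rho> y s * \<rho>t y s)
        + u y s * (exp (- l * s) * (2 * \<rho> y s * \<rho>x y s))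
      = (- l - 2 * ux y s) * (exp (- l * s) * (\<rho> y s)\<^sup>2)"
      unfolding rt by (simp add: algebra_simps power2_eq_square)
    also have "\<dots> < 0"
      using bound(2)[OF s', of y] pos by (intro mult_neg_pos) (auto simp: l_def)
    finally show "- l * exp (- l * s) * (\<rho> y s)\<^sup>2 + exp (- l * s) * (2 * \<rho> y s * \<rho>t y s)
        + u y s * (exp (- l * s) * (2 * \<rho> y s * \<rho>x y s)) < 0" .
  qed (use xt init k(1) in \<open>auto intro!: continuous_intros derivative_eq_intros simp: case_prod_unfold\<close>)
  then show ?thesis by (simp add: mult_le_0_iff)
qed

lemma velocity_vanishes:
  assumes z: "\<And>y. y < a \<Longrightarrow> \<rho> y t = 0" and t: "t \<in> {0<..T}" and "x < a"
  shows "u x t = 0"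
proof -
  have t': "t \<in> {0..T}" using t by auto
  have "ux y t = 0" if "y < a" for y
    using energy[OF t, of y] z[OF that] \<mu> by simp
  then have "((\<lambda>y. u y t) has_real_derivative 0) (at y within {..x})" if "y \<in> {..x}" for y
    using dx(2)[OF t', of y] \<open>x < a\<close> that by (auto intro: has_field_derivative_at_within)
  then obtain c where "\<And>y. y \<in> {..x} \<Longrightarrow> u y t = c"
    using has_field_derivative_zero_constant[of "{..x}" "\<lambda>y. u y t"] by auto
  then have uc: "u y t = u x t" if "y \<le> x" for y
    using that by auto
  have "(u x t)\<^sup>2 = 0"
  proof (rule integrable_lborel_const_halfline[OF L2[OF t'], of x])
    fix y assume "y \<le> x"
    then show "(u y t)\<^sup>2 = (u x t)\<^sup>2" by (rule uc[THEN arg_cong])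
  qed
  then show ?thesis by simp
qed

text \<open>The support can spread at most with the speed of the fluid, and the fluid is at rest in the
  vacuum; since \<open>u\<close> is Lipschitz, this halves the available speed bound on a short time interval.\<close>

lemma vacuum_at_rest:
  assumes init: "\<And>x. x \<le> 0 \<Longrightarrow> \<rho> x 0 = 0" and small: "B * T \<le> 1 / 2"
    and t: "t \<in> {0<..T}" and x: "x \<le> 0"
  shows "\<rho> x t = 0" "u x t = 0" "ux x t = 0"
proof -
  have "\<bar>u x t\<bar> \<le> B / 2 ^ n" if "t \<in> {0<..T}" "x \<le> 0" for n x t
    using that
  proof (induction n arbitrary: x t)
    case 0
    then show ?case using bound(1)[of t x] by auto
  next
    case (Suc n)
    let ?k = "B / 2 ^ n"
    have k: "0 \<le> ?k" using B_nonneg by simp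
    have t: "t \<in> {0..T}" using Suc.prems by auto
    have u0: "u y t = 0" if "y < - ?k * t" for y
      by (rule velocity_vanishes[OF density_vanishes[OF init k Suc.IH] Suc.prems(1) that]) (use t in auto)
    have "\<bar>u x t\<bar> \<le> B / 2 ^ Suc n + d" if "d > 0" for d
    proof -
      \<comment> \<open>Rest is known only strictly to the left of \<open>- ?k * t\<close>. Going a
        further \<open>d / (B + 1)\<close> to the left costs at most \<open>d\<close> by the
        Lipschitz bound, and the denominator is safe even if \<open>B = 0\<close>.\<close>
      define y where "y = - ?k * t - d / (B + 1)"
      have dB: "d / (B + 1) > 0" "B * (d / (B + 1)) \<le> d"
        using that B_nonneg by (auto simp: field_simps)
      have uy: "u y t = 0" by (rule u0) (use dB in \<open>simp add: y_def\<close>)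
      show ?thesis
      proof (cases "x < y")
        case True
        then show ?thesis using u0[of x] dB that k by (simp add: y_def)
      next
        case False
        have "\<bar>u x t\<bar> \<le> B * \<bar>x - y\<bar>" using u_lipschitz[OF t, of x y] uy by simp
        also have "\<dots> \<le> B * (?k * t + d / (B + 1))"
          using False Suc.prems(2) B_nonneg by (intro mult_left_mono) (auto simp: y_def)
        also have "\<dots> = ?k * (B * t) + B * (d / (B + 1))" by (simp add: algebra_simps)
        also have "\<dots> \<le> ?k * (1 / 2) + d"
          using dB(2) mult_left_mono[of t T B] t B_nonneg small k
          by (intro add_mono mult_left_mono) auto
        finally show ?thesis by simp
      qed
    qed
    then show ?case by (rule field_le_epsilon)
  qed
  moreover have "(\<lambda>n. B / 2 ^ n) \<longlonglongrightarrow> 0"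
    using LIMSEQ_divide_realpow_zero[of 2 B] by simp
  ultimately have u: "u x t = 0" if "t \<in> {0<..T}" "x \<le> 0" for x t
  proof -
    have "\<bar>u x t\<bar> \<le> 0"
      by (rule LIMSEQ_le_const[OF \<open>(\<lambda>n. B / 2 ^ n) \<longlonglongrightarrow> 0\<close>])
         (use \<open>\<And>x t n. t \<in> {0<..T} \<Longrightarrow> x \<le> 0 \<Longrightarrow> \<bar>u x t\<bar> \<le> B / 2 ^ n\<close> that in blast)
    then show ?thesis by simp
  qed
  then show "u x t = 0" using t x by blast
  have t': "t \<in> {0..T}" using t by auto
  have r: "\<rho> y t = 0" if "y < 0" for y
    using density_vanishes[OF init, of 0 t y] u t' that by auto
  have "\<rho> y t = 0" if "y \<le> 0" for y
  proof -
    have "continuous_on (closure {..<0}) (\<lambda>y. \<rho> y t)"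
      by (rule slice_continuous(1)[OF t'])
    then show ?thesis
      by (rule continuous_constant_on_closure) (use r that in auto)
  qed
  then show r: "\<rho> x t = 0" using x by blast
  show "ux x t = 0" using energy[OF t, of x] r \<mu> by simp
qed

text \<open>Because the fluid rests at \<open>x = 0\<close>, a particle needs infinite time to get
  there: positions change at most by factors \<open>exp (\<plusminus> B t)\<close>. The windows of
  the next two lemmas are therefore exponential, and positivity holds right up to the vacuum
  boundary.\<close>

lemma u_le_distance:
  assumes init: "\<And>x. x \<le> 0 \<Longrightarrow> \<rho> x 0 = 0" and small: "B * T \<le> 1 / 2"
    and t: "t \<in> {0<..T}" and x: "0 \<le> x"
  shows "\<bar>u x t\<bar> \<le> B * x"
proof -
  have "t \<in> {0..T}" using t by auto
  from u_lipschitz[OF this, of x 0] vacuum_at_rest(2)[OF init small t, of 0] x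
  show ?thesis by simp
qed

text \<open>A trajectory through \<open>(x, t)\<close> started between \<open>x exp (- B t)\<close>
  and \<open>x exp (B t)\<close>, which is a compact part of \<open>(0, 1)\<close> by hypothesis.
  The density is bounded below there initially and decays along the flow at most
  exponentially.\<close>

lemma density_positive:
  assumes init: "\<And>x. x \<le> 0 \<Longrightarrow> \<rho> x 0 = 0" "\<And>x. 0 < x \<Longrightarrow> x < 1 \<Longrightarrow> \<rho> x 0 > 0" and small: "B * T \<le> 1 / 2"
    and t: "t \<in> {0..T}" and x: "0 < x" "x * exp (B * t) < 1"
  shows "\<rho> x t > 0"
proof -
  \<comment> \<open>\<open>x1\<close> and \<open>x2\<close> are spread just wide enough for the
    window to contain \<open>x\<close> at time \<open>t\<close>, while \<open>[x1, x2]\<close> stays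
    inside \<open>(0, 1)\<close>.\<close>
  obtain x2 where x2: "x * exp (B * t) < x2" "x2 < 1" using dense[OF x(2)] by blast
  obtain x1 where x1: "0 < x1" "x1 < x * exp (- B * t)" using dense[of 0 "x * exp (- B * t)"] x(1) by auto
  have ee: "exp (- B * t) \<le> 1" "1 \<le> exp (B * t)" using B_nonneg t by auto
  have x12: "x1 < x" "x < x2"
  proof -
    have "x * exp (- B * t) \<le> x * 1" "x * 1 \<le> x * exp (B * t)"
      by (intro mult_left_mono ee; use x(1) in simp)+
    then show "x1 < x" "x < x2" using x1 x2 by linarith+
  qed
  have t0: "0 \<in> {0..T}" using T by auto
  have "{x1..x2} \<noteq> {}" using x12 by auto
  then have "\<exists>y0\<in>{x1..x2}. \<forall>y\<in>{x1..x2}. \<rho> y0 0 \<le> \<rho> y 0"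
    by (rule continuous_attains_inf[OF compact_Icc _ slice_continuous(1)[OF t0]])
  then obtain y0 where y0: "y0 \<in> {x1..x2}" "\<forall>y\<in>{x1..x2}. \<rho> y0 0 \<le> \<rho> y 0"
    by (rule bexE)
  define c where "c = \<rho> y0 0"
  have c: "c > 0" using init(2)[of y0] y0(1) x1 x2 unfolding c_def by auto
  \<comment> \<open>Along the flow \<open>q\<close> obeys a linear equation with coefficients
    \<open>-(m - l + ux)\<close> for \<open>q\<close> and \<open>-(l - ux)\<close> for the constant
    \<open>c\<close>. With \<open>\<bar>ux\<bar> \<le> B\<close>, the choice
    \<open>l = B + 1\<close>, \<open>m = 2 * l\<close> makes both brackets at least 1.\<close>
  define l m where "l = B + 1" and "m = 2 * B + 2"
  have "exp (- m * t) * (c - exp (l * t) * \<rho> x t) \<le> 0"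
  proof (rule transport_comparison[where ga = "\<lambda>x t. x * exp (- B * t) - x1" and gb = "\<lambda>x t. x2 - x * exp (B * t)"
        and gax = "\<lambda>x t. exp (- B * t)" and gat = "\<lambda>x t. - B * x * exp (- B * t)"
        and gbx = "\<lambda>x t. - exp (B * t)" and gbt = "\<lambda>x t. - B * x * exp (B * t)"
        and q = "\<lambda>x t. exp (- m * t) * (c - exp (l * t) * \<rho> x t)" and v = u and a = x1 and b = x2
        and qx = "\<lambda>x t. - exp (- m * t) * (exp (l * t) * \<rho>x x t)"
        and qt = "\<lambda>x t. - m * (exp (- m * t) * (c - exp (l * t) * \<rho> x t))
                   - exp (- m * t) * (l * exp (l * t) * \<rho> x t + exp (l * t) * \<rho>t x t)"])
    show "continuous_on ({x1..x2} \<times> {0..T}) (\<lambda>(x, t). exp (- m * t) * (c - exp (l * t) * \<rho> x t))"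
      using cont_sub(1)[of "{x1..x2} \<times> {0..T}"] unfolding case_prod_unfold by (intro continuous_intros) auto
    show "x \<in> {x1..x2}" "0 < x * exp (- B * t) - x1" "0 < x2 - x * exp (B * t)"
      using x12 x1 x2 by auto
    show "x1 * exp (- B * s) - x1 \<le> 0" "x2 - x2 * exp (B * s) \<le> 0" if "s \<in> {0..T}" for s
      using that B_nonneg x1 x12 x(1) by auto
    show "exp (- m * 0) * (c - exp (l * 0) * \<rho> y 0) \<le> 0" if "y \<in> {x1..x2}" for y
      using y0(2) that by (simp add: c_def)
    fix y s assume y: "y \<in> {x1<..<x2}" and s: "s \<in> {0<..T}"
    have s': "s \<in> {0..T}" using s by auto
    have uy: "\<bar>u y s\<bar> \<le> B * y" using u_le_distance[OF init(1) small s, of y] y x1 by auto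
    have "- B * y * exp (- B * s) + u y s * exp (- B * s) = (u y s - B * y) * exp (- B * s)"
      by (simp add: algebra_simps)
    also have "\<dots> \<le> 0" using uy by (intro mult_nonpos_nonneg) auto
    finally show "- B * y * exp (- B * s) + u y s * exp (- B * s) \<le> 0" .
    have "- B * y * exp (B * s) + u y s * - exp (B * s) = (- u y s - B * y) * exp (B * s)"
      by (simp add: algebra_simps)
    also have "\<dots> \<le> 0" using uy by (intro mult_nonpos_nonneg) auto
    finally show "- B * y * exp (B * s) + u y s * - exp (B * s) \<le> 0" .
    show "((\<lambda>y. exp (- m * s) * (c - exp (l * s) * \<rho> y s)) has_real_derivative
        - exp (- m * s) * (exp (l * s) * \<rho>x y s)) (at y)"
      by (auto intro!: derivative_eq_intros dx(1) s')
    show "((\<lambda>s. exp (- m * s) * (c - exp (l * s) * \<rho> y s)) has_real_derivative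
        - m * (exp (- m * s) * (c - exp (l * s) * \<rho> y s))
         - exp (- m * s) * (l * exp (l * s) * \<rho> y s + exp (l * s) * \<rho>t y s)) (at s within {0..T})"
      by (auto intro!: derivative_eq_intros dt(1) s' simp: algebra_simps)
    let ?q = "exp (- m * s) * (c - exp (l * s) * \<rho> y s)"
    assume q: "0 < ?q"
    have rt: "\<rho>t y s = - \<rho>x y s * u y s - \<rho> y s * ux y s" using mass[OF s, of y] by linarith
    have "- m * ?q - exp (- m * s) * (l * exp (l * s) * \<rho> y s + exp (l * s) * \<rho>t y s)
        + u y s * (- exp (- m * s) * (exp (l * s) * \<rho>x y s))
       = - (m - l + ux y s) * ?q - (l - ux y s) * (exp (- m * s) * c)"
      unfolding rt by (simp add: algebra_simps)
    also have "\<dots> < 0"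
    proof -
      have "m - l + ux y s > 0" "l - ux y s > 0"
        using bound(2)[OF s', of y] B_nonneg unfolding m_def l_def by linarith+
      then have "(m - l + ux y s) * ?q > 0" "(l - ux y s) * (exp (- m * s) * c) > 0"
        using q c by (auto intro!: mult_pos_pos)
      then show ?thesis by linarith
    qed
    finally show "- m * ?q - exp (- m * s) * (l * exp (l * s) * \<rho> y s + exp (l * s) * \<rho>t y s)
        + u y s * (- exp (- m * s) * (exp (l * s) * \<rho>x y s)) < 0" .
  qed (use t in \<open>auto intro!: continuous_intros derivative_eq_intros simp: case_prod_unfold\<close>)
  then have "c \<le> exp (l * t) * \<rho> x t" by (simp add: mult_le_0_iff)
  then show ?thesis using c by (meson exp_gt_zero less_le_trans zero_less_mult_pos)
qed

text \<open>Viscous dissipation only adds energy. Where \<open>\<rho> > 0\<close> the energy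
  equation can be divided by \<open>\<rho>\<close>, and then a negative \<open>e\<close> cannot
  appear along the flow; the window restricts attention to exactly such points.\<close>

lemma energy_nonneg:
  assumes init: "\<And>x. x \<le> 0 \<Longrightarrow> \<rho> x 0 = 0" "\<And>x. 0 < x \<Longrightarrow> x < 1 \<Longrightarrow> \<rho> x 0 > 0"
      "\<And>x. 0 < x \<Longrightarrow> x < 1 \<Longrightarrow> e x 0 \<ge> 0" and small: "B * T \<le> 1 / 2"
    and t: "t \<in> {0..T}" and x: "0 < x" "x * exp (B * t) < 1"
  shows "e x t \<ge> 0"
proof -
  obtain x2 where x2: "x * exp (B * t) < x2" "x2 < 1" using dense[OF x(2)] by blast
  obtain x1 where x1: "0 < x1" "x1 < x * exp (- B * t)" using dense[of 0 "x * exp (- B * t)"] x(1) by auto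
  have ee: "exp (- B * t) \<le> 1" "1 \<le> exp (B * t)" using B_nonneg t by auto
  have x12: "x1 < x" "x < x2"
  proof -
    have "x * exp (- B * t) \<le> x * 1" "x * 1 \<le> x * exp (B * t)"
      by (intro mult_left_mono ee; use x(1) in simp)+
    then show "x1 < x" "x < x2" using x1 x2 by linarith+
  qed
  \<comment> \<open>The compression term contributes a rate of size at most
    \<open>(\<gamma> - 1) * B\<close>; the \<open>+ 1\<close> gives strictness.\<close>
  define l where "l = (\<gamma> - 1) * B + 1"
  have "- exp (- l * t) * e x t \<le> 0"
  proof (rule transport_comparison[where ga = "\<lambda>x t. x * exp (- B * t) - x1" and gb = "\<lambda>x t. x2 - x * exp (B * t)"
        and gax = "\<lambda>x t. exp (- B * t)" and gat = "\<lambda>x t. - B * x * exp (- B * t)"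
        and gbx = "\<lambda>x t. - exp (B * t)" and gbt = "\<lambda>x t. - B * x * exp (B * t)"
        and q = "\<lambda>x t. - exp (- l * t) * e x t" and v = u and a = x1 and b = x2
        and qx = "\<lambda>x t. - exp (- l * t) * ex x t"
        and qt = "\<lambda>x t. l * exp (- l * t) * e x t - exp (- l * t) * et x t"])
    show "continuous_on ({x1..x2} \<times> {0..T}) (\<lambda>(x, t). - exp (- l * t) * e x t)"
      using cont_sub(2)[of "{x1..x2} \<times> {0..T}"] unfolding case_prod_unfold by (intro continuous_intros) auto
    show "x \<in> {x1..x2}" "0 < x * exp (- B * t) - x1" "0 < x2 - x * exp (B * t)"
      using x12 x1 x2 by auto
    show "x1 * exp (- B * s) - x1 \<le> 0" "x2 - x2 * exp (B * s) \<le> 0" if "s \<in> {0..T}" for s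
      using that B_nonneg x1 x12 x(1) by auto
    show "- exp (- l * 0) * e y 0 \<le> 0" if "y \<in> {x1..x2}" for y
      using init(3)[of y] that x1 x2 by auto
    fix y s assume y: "y \<in> {x1<..<x2}" and s: "s \<in> {0<..T}"
    have s': "s \<in> {0..T}" using s by auto
    have uy: "\<bar>u y s\<bar> \<le> B * y" using u_le_distance[OF init(1) small s, of y] y x1 by auto
    have "- B * y * exp (- B * s) + u y s * exp (- B * s) = (u y s - B * y) * exp (- B * s)"
      by (simp add: algebra_simps)
    also have "\<dots> \<le> 0" using uy by (intro mult_nonpos_nonneg) auto
    finally show "- B * y * exp (- B * s) + u y s * exp (- B * s) \<le> 0" .
    have "- B * y * exp (B * s) + u y s * - exp (B * s) = (- u y s - B * y) * exp (B * s)"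
      by (simp add: algebra_simps)
    also have "\<dots> \<le> 0" using uy by (intro mult_nonpos_nonneg) auto
    finally show "- B * y * exp (B * s) + u y s * - exp (B * s) \<le> 0" .
    show "((\<lambda>y. - exp (- l * s) * e y s) has_real_derivative - exp (- l * s) * ex y s) (at y)"
      by (auto intro!: derivative_eq_intros dx(3) s')
    show "((\<lambda>s. - exp (- l * s) * e y s) has_real_derivative
        l * exp (- l * s) * e y s - exp (- l * s) * et y s) (at s within {0..T})"
      by (auto intro!: derivative_eq_intros dt(3) s' simp: algebra_simps)
    assume q: "0 < - exp (- l * s) * e y s" and gb: "0 < x2 - y * exp (B * s)"
    \<comment> \<open>The open window says \<open>y * exp (B * s) < x2 < 1\<close>, which is the
      range in which \<open>density_positive\<close> applies.\<close>
    have r: "\<rho> y s > 0"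
      by (rule density_positive[OF init(1,2) small s']) (use y x1 x2 gb in auto)
    have "\<rho> y s * (et y s + u y s * ex y s + (\<gamma> - 1) * e y s * ux y s) \<ge> 0"
      unfolding energy[OF s] using \<mu> by simp
    then have "et y s + u y s * ex y s + (\<gamma> - 1) * e y s * ux y s \<ge> 0"
      using r by (simp add: zero_le_mult_iff)
    then have "exp (- l * s) * (et y s + u y s * ex y s) \<ge> exp (- l * s) * (- (\<gamma> - 1) * e y s * ux y s)"
      by (intro mult_left_mono) (auto simp: algebra_simps)
    then have "l * exp (- l * s) * e y s - exp (- l * s) * et y s + u y s * (- exp (- l * s) * ex y s)
       \<le> - (l + (\<gamma> - 1) * ux y s) * (- exp (- l * s) * e y s)"
      by (simp add: algebra_simps)
    also have "\<dots> < 0"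
    proof -
      have "(\<gamma> - 1) * (- B) \<le> (\<gamma> - 1) * ux y s"
        using bound(2)[OF s', of y] \<gamma> by (intro mult_left_mono) auto
      then have "l + (\<gamma> - 1) * ux y s > 0" by (simp add: l_def)
      then have "(l + (\<gamma> - 1) * ux y s) * (- exp (- l * s) * e y s) > 0"
        using q by (rule mult_pos_pos)
      then show ?thesis by linarith
    qed
    finally show "l * exp (- l * s) * e y s - exp (- l * s) * et y s + u y s * (- exp (- l * s) * ex y s) < 0" .
  qed (use t in \<open>auto intro!: continuous_intros derivative_eq_intros simp: case_prod_unfold\<close>)
  then show ?thesis by (simp add: zero_le_mult_iff)
qed

end

section \<open>Hopf's lemma for the momentum at the vacuum boundary\<close>

context flow
begin

text \<open>Needed for two choices of \<open>q\<close>: the velocity, which gives the momentum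
  \<open>M\<close>, and the velocity plus a multiple of the barrier profile. Joint continuity comes
  from a Lipschitz bound in \<open>x\<close> that is uniform in \<open>t\<close>.\<close>

lemma mass_weighted_integral:
  fixes q qx qt :: "real \<Rightarrow> real \<Rightarrow> real"
  assumes c: "continuous_on (UNIV \<times> {0..T}) (\<lambda>(x, t). q x t)" "continuous_on (UNIV \<times> {0..T}) (\<lambda>(x, t). qt x t)"
    and "\<forall>t\<in>{0..T}. \<forall>x. (q x has_real_derivative qt x t) (at t within {0..T})"
    and \<tau>: "0 < \<tau>" "\<tau> \<le> T"
  defines "W \<equiv> \<lambda>x t. integral {0..x} (\<lambda>y. \<rho> y t * q y t)"
  shows "\<And>x t. t \<in> {0..\<tau>} \<Longrightarrow> x \<in> {0<..<a} \<Longrightarrow> ((\<lambda>x. W x t) has_real_derivative \<rho> x t * q x t) (at x)"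
    and "\<And>x t. t \<in> {0..\<tau>} \<Longrightarrow>
        (W x has_real_derivative integral {0..x} (\<lambda>y. \<rho>t y t * q y t + \<rho> y t * qt y t)) (at t within {0..\<tau>})"
    and "continuous_on ({0..a} \<times> {0..\<tau>}) (\<lambda>(x, t). W x t)"
proof -
  have qt: "(q x has_real_derivative qt x t) (at t within {0..T})" if "t \<in> {0..T}" for x t
    using assms(3) that by blast
  have c1: "continuous_on (UNIV \<times> {0..T}) (\<lambda>(x, t). \<rho> x t * q x t)"
    using c cont(1) unfolding case_prod_unfold by (intro continuous_intros)
  have c2: "continuous_on (UNIV \<times> {0..T}) (\<lambda>(x, t). \<rho>t x t * q x t + \<rho> x t * qt x t)"
    using c cont(1,3) unfolding case_prod_unfold by (intro continuous_intros)
  have sl: "continuous_on A (\<lambda>y. \<rho> y t * q y t)" if "t \<in> {0..T}" for t A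
  proof -
    have "continuous_on A (\<lambda>y. (\<lambda>(x, t). \<rho> x t * q x t) (y, t))"
      by (rule continuous_on_compose2[OF c1]) (use that in \<open>auto intro!: continuous_intros\<close>)
    then show ?thesis by simp
  qed
  show 1: "((\<lambda>x. W x t) has_real_derivative \<rho> x t * q x t) (at x)" if t: "t \<in> {0..\<tau>}" and x: "x \<in> {0<..<a}" for x t a
  proof -
    have "((\<lambda>x. W x t) has_real_derivative \<rho> x t * q x t) (at x within {0..a})"
      unfolding W_def by (rule integral_has_real_derivative[OF sl]) (use t x \<tau> in auto)
    then show ?thesis using x by (simp add: at_within_Icc_at)
  qed
  show 2: "(W x has_real_derivative integral {0..x} (\<lambda>y. \<rho>t y t * q y t + \<rho> y t * qt y t)) (at t within {0..\<tau>})"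
    if t: "t \<in> {0..\<tau>}" for x t
  proof -
    have "((\<lambda>s. integral (cbox 0 x) (\<lambda>y. \<rho> y s * q y s)) has_real_derivative
        integral (cbox 0 x) (\<lambda>y. \<rho>t y t * q y t + \<rho> y t * qt y t)) (at t within {0..\<tau>})"
    proof (rule leibniz_rule_field_derivative[where fx = "\<lambda>s y. \<rho>t y s * q y s + \<rho> y s * qt y s"])
      fix s y assume s: "s \<in> {0..\<tau>}"
      have s': "s \<in> {0..T}" using s \<tau> by auto
      have "((\<lambda>s. \<rho> y s * q y s) has_real_derivative \<rho>t y s * q y s + qt y s * \<rho> y s) (at s within {0..T})"
        by (intro DERIV_mult dt(1) qt s')
      then show "((\<lambda>s. \<rho> y s * q y s) has_real_derivative \<rho>t y s * q y s + \<rho> y s * qt y s) (at s within {0..\<tau>})"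
        using has_field_derivative_subset[of _ _ s "{0..T}" "{0..\<tau>}"] \<tau> by (simp add: mult.commute)
      show "(\<lambda>y. \<rho> y s * q y s) integrable_on cbox 0 x"
        unfolding cbox_interval by (intro integrable_continuous_real sl s')
    next
      have "continuous_on ({0..\<tau>} \<times> cbox 0 x) (\<lambda>p. (\<lambda>(x, t). \<rho>t x t * q x t + \<rho> x t * qt x t) (snd p, fst p))"
        by (rule continuous_on_compose2[OF c2]) (use \<tau> in \<open>auto intro!: continuous_intros\<close>)
      then show "continuous_on ({0..\<tau>} \<times> cbox 0 x) (\<lambda>(s, y). \<rho>t y s * q y s + \<rho> y s * qt y s)"
        by (simp add: case_prod_unfold)
    qed (use t in auto)
    then show ?thesis by (simp add: W_def[abs_def] cbox_interval)
  qed
  show "continuous_on ({0..a} \<times> {0..\<tau>}) (\<lambda>(x, t). W x t)"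
  proof -
    have "compact ((\<lambda>(x, t). \<rho> x t * q x t) ` ({0..a} \<times> {0..\<tau>}))"
      by (intro compact_continuous_image continuous_on_subset[OF c1] compact_Times compact_Icc) (use \<tau> in auto)
    then obtain K where "\<forall>z\<in>(\<lambda>(x, t). \<rho> x t * q x t) ` ({0..a} \<times> {0..\<tau>}). \<bar>z\<bar> \<le> K"
      by (meson compact_imp_bounded bounded_real)
    then have K: "\<bar>\<rho> x t * q x t\<bar> \<le> K" if "x \<in> {0..a}" "t \<in> {0..\<tau>}" for x t
      using that by fastforce
    have lip: "\<bar>W y t - W x t\<bar> \<le> K * \<bar>y - x\<bar>" if xy: "x \<in> {0..a}" "y \<in> {0..a}" "t \<in> {0..\<tau>}" for x y t
    proof -
      have t: "t \<in> {0..T}" using xy(3) \<tau> by auto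
      have *: "\<bar>W y t - W x t\<bar> \<le> K * (y - x)" if "0 \<le> x" "x \<le> y" "y \<le> a" for x y
      proof -
        have "W x t + integral {x..y} (\<lambda>y. \<rho> y t * q y t) = W y t"
          unfolding W_def using that
          by (intro Henstock_Kurzweil_Integration.integral_combine integrable_continuous_real sl t)
        moreover have "norm (integral {x..y} (\<lambda>y. \<rho> y t * q y t)) \<le> K * (y - x)"
          using that xy(3) K by (intro integral_bound sl t) auto
        ultimately show ?thesis by (simp add: abs_minus_commute)
      qed
      show ?thesis using *[of x y] *[of y x] xy by (cases "x \<le> y") (auto simp: abs_minus_commute)
    qed
    \<comment> \<open>Space and time trade places in \<open>jointly_continuous\<close>: here the
      uniform estimate is the one in \<open>x\<close>.\<close>
    have "continuous_on ({0..\<tau>} \<times> {0..a}) (\<lambda>(t, x). W x t)"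
    proof (rule jointly_continuous)
      show "continuous_on {0..\<tau>} (\<lambda>t. W x t)" for x
        by (rule DERIV_continuous_on[OF 2])
      fix x r :: real assume x: "x \<in> {0..a}" and r: "r > 0"
      have K0: "K \<ge> 0" using K[of x 0] x \<tau> by (auto intro: order_trans[OF abs_ge_zero])
      show "\<exists>d>0. \<forall>y\<in>{0..a}. \<bar>y - x\<bar> < d \<longrightarrow> (\<forall>t\<in>{0..\<tau>}. \<bar>W y t - W x t\<bar> < r)"
      proof (intro exI conjI ballI impI)
        show "0 < r / (K + 1)" using r K0 by simp
        fix y t assume y: "y \<in> {0..a}" "\<bar>y - x\<bar> < r / (K + 1)" and t: "t \<in> {0..\<tau>}"
        have "K * \<bar>y - x\<bar> \<le> (K + 1) * \<bar>y - x\<bar>" by (intro mult_right_mono) auto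
        also have "\<dots> < r" using y(2) K0 by (simp add: less_divide_eq mult.commute)
        finally show "\<bar>W y t - W x t\<bar> < r" using lip[OF x y(1) t] by linarith
      qed
    qed
    then have "continuous_on ({0..a} \<times> {0..\<tau>}) (\<lambda>p. (\<lambda>(t, x). W x t) (snd p, fst p))"
      by (rule continuous_on_compose2) (auto intro!: continuous_intros)
    then show ?thesis by (simp add: case_prod_unfold)
  qed
qed

text \<open>The barrier \<open>\<integral>\<^sub>0\<^sup>x \<rho> (1 - exp (k (y + V t - a))) dy\<close> travels towards \<open>x = 0\<close> with speed \<open>V = 2 a / \<tau>\<close>,
  hence is negative near \<open>x = 0\<close> at time \<open>\<tau>\<close>; it is a supersolution for \<open>k\<close> large, since diffusion
  spreads profiles of steepness \<open>k\<close> with a speed proportional to \<open>k\<close>.\<close>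

lemma inflow_impossible:
  assumes init: "\<And>x. x \<le> 0 \<Longrightarrow> \<rho> x 0 = 0" "\<And>x. 0 < x \<Longrightarrow> x < 1 \<Longrightarrow> \<rho> x 0 > 0"
      "\<And>x. 0 < x \<Longrightarrow> x < 1 \<Longrightarrow> e x 0 \<ge> 0"
    and small: "B * T \<le> 1 / 2" and a: "0 < a" "a * exp (B * T) < 1"
    and u0: "\<And>x. 0 < x \<Longrightarrow> x < a \<Longrightarrow> u x 0 \<le> 0" "u a 0 < 0"
  shows False
proof -
  have aT: "x * exp (B * t) < 1" if "0 \<le> x" "x \<le> a" "t \<in> {0..T}" for x t
  proof -
    have "x * exp (B * t) \<le> a * exp (B * T)"
      using that B_nonneg by (intro mult_mono) (auto intro: mult_left_mono)
    then show ?thesis using a(2) by simp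
  qed
  have \<rho>pos: "\<rho> x t > 0" if "0 < x" "x \<le> a" "t \<in> {0..T}" for x t
    by (rule density_positive[OF init(1,2) small]) (use that aT[of x t] in auto)
  have epos: "e x t \<ge> 0" if "0 < x" "x \<le> a" "t \<in> {0..T}" for x t
    by (rule energy_nonneg[OF init small]) (use that aT[of x t] in auto)
  define M where "M x t = integral {0..x} (\<lambda>y. \<rho> y t * u y t)" for x t
  have ut: "\<forall>t\<in>{0..T}. \<forall>x. (u x has_real_derivative ut x t) (at t within {0..T})"
    using dt(2) by blast
  note M = mass_weighted_integral[OF cont(4,6) ut T order_refl, folded M_def]
  have "M a 0 < 0"
  proof -
    have t0: "(0::real) \<in> {0..T}" using T by auto
    have cM: "continuous_on {0..a} (\<lambda>x. M x 0)"
    proof -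
      have "continuous_on {0..a} (\<lambda>x. (\<lambda>(x, t). M x t) (x, 0))"
        by (rule continuous_on_compose2[OF M(3)[of a]]) (use t0 in \<open>auto intro!: continuous_intros\<close>)
      then show ?thesis by simp
    qed
    have "isCont (\<lambda>x. u x 0) a" using dx(2)[OF t0] by (rule DERIV_isCont)
    then have "\<forall>\<^sub>F x in at a. u x 0 < 0"
      using u0(2) unfolding isCont_def by (rule order_tendstoD)
    then obtain d where d: "d > 0" "\<And>x. x \<noteq> a \<Longrightarrow> dist x a < d \<Longrightarrow> u x 0 < 0"
      unfolding eventually_at by auto
    define b where "b = max (a / 2) (a - d / 2)"
    have b: "0 < b" "b < a" using a d by (auto simp: b_def)
    have "M b 0 \<le> M 0 0"
    proof (rule DERIV_nonpos_imp_decreasing_open[where f = "\<lambda>x. M x 0"])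
      show "0 \<le> b" using b by simp
      show "continuous_on {0..b} (\<lambda>x. M x 0)" by (rule continuous_on_subset[OF cM]) (use b in auto)
      fix x assume "0 < x" "x < b"
      then show "\<exists>y. ((\<lambda>x. M x 0) has_real_derivative y) (at x) \<and> y \<le> 0"
        using M(1)[OF t0, of x a] b u0(1)[of x] \<rho>pos[of x 0] t0
        by (intro exI[of _ "\<rho> x 0 * u x 0"]) (auto intro: mult_nonneg_nonpos)
    qed
    moreover have "M a 0 < M b 0"
    proof (rule DERIV_neg_imp_decreasing_open[where f = "\<lambda>x. M x 0"])
      show "b < a" by (rule b)
      show "continuous_on {b..a} (\<lambda>x. M x 0)" by (rule continuous_on_subset[OF cM]) (use b in auto)
      fix x assume x: "b < x" "x < a"
      then have "u x 0 < 0" using d(2)[of x] d(1) by (auto simp: dist_real_def b_def)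
      then show "\<exists>y. ((\<lambda>x. M x 0) has_real_derivative y) (at x) \<and> y < 0"
        using M(1)[OF t0, of x a] b x \<rho>pos[of x 0] t0
        by (intro exI[of _ "\<rho> x 0 * u x 0"]) (auto intro: mult_pos_neg)
    qed
    ultimately show ?thesis by (simp add: M_def)
  qed
  \<comment> \<open>Half of the initial gap, so that by continuity
    \<open>M a t \<le> - \<delta>\<close> persists on a short time interval.\<close>
  define \<delta> where "\<delta> = - M a 0 / 2"
  have \<delta>: "\<delta> > 0" using \<open>M a 0 < 0\<close> by (simp add: \<delta>_def)
  obtain \<tau> where \<tau>: "0 < \<tau>" "\<tau> \<le> T" "\<And>t. t \<in> {0..\<tau>} \<Longrightarrow> M a t \<le> - \<delta>"
  proof -
    have "((\<lambda>t. M a t) \<longlongrightarrow> M a 0) (at 0 within {0..T})"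
      using DERIV_continuous[OF M(2)[of 0 a]] T unfolding continuous_within by auto
    then have "\<forall>\<^sub>F t in at 0 within {0..T}. M a t < - \<delta>"
      using \<open>M a 0 < 0\<close> by (intro order_tendstoD) (auto simp: \<delta>_def)
    then obtain d where d: "d > 0" "\<And>t. t \<in> {0..T} \<Longrightarrow> t \<noteq> 0 \<Longrightarrow> dist t 0 < d \<Longrightarrow> M a t < - \<delta>"
      unfolding eventually_at by blast
    have "M a t \<le> - \<delta>" if "t \<in> {0..min T (d / 2)}" for t
      using that d(2)[of t] d(1) \<open>M a 0 < 0\<close> by (cases "t = 0") (auto simp: \<delta>_def dist_real_def)
    then show thesis using that[of "min T (d / 2)"] T d(1) by auto
  qed
  have \<tau>T: "t \<in> {0..T}" if "t \<in> {0..\<tau>}" for t using that \<tau> by auto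
  obtain R where R: "R > 0" "\<And>x t. x \<in> {0..a} \<Longrightarrow> t \<in> {0..\<tau>} \<Longrightarrow> \<rho> x t \<le> R"
  proof -
    have "compact ((\<lambda>(x, t). \<rho> x t) ` ({0..a} \<times> {0..\<tau>}))"
      by (intro compact_continuous_image cont_sub compact_Times compact_Icc) (use \<tau> in auto)
    then obtain K where "\<forall>z\<in>(\<lambda>(x, t). \<rho> x t) ` ({0..a} \<times> {0..\<tau>}). \<bar>z\<bar> \<le> K"
      by (meson compact_imp_bounded bounded_real)
    then have K: "\<bar>\<rho> x t\<bar> \<le> K" if "x \<in> {0..a}" "t \<in> {0..\<tau>}" for x t
      using that by fastforce
    have "K > 0" using K[of a 0] \<rho>pos[of a 0] a(1) \<tau> by auto
    then show thesis using that[of K] K by (metis abs_le_D1)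
  qed
  define V where "V = 2 * a / \<tau>"
  \<comment> \<open>Chosen so that \<open>\<mu> * k = R * (V + B)\<close>: diffusion of the profile
    \<open>E\<close> then balances its motion with speed \<open>V\<close> plus the transport by a
    fluid of speed at most \<open>B\<close>, at the largest density \<open>R\<close>.\<close>
  define k where "k = R * (V + B) / \<mu>"
  have V: "V > 0" using a \<tau> by (simp add: V_def)
  have k: "k > 0" "\<mu> * k = R * (V + B)"
    using R V B_nonneg \<mu> by (auto simp: k_def intro!: mult_pos_pos divide_pos_pos)
  define E where "E x t = exp (k * (x + V * t - a))" for x t
  \<comment> \<open>Small enough for the barrier to contribute at most \<open>\<delta>\<close> at
    \<open>x = a\<close>, where \<open>\<rho> \<le> R\<close> and
    \<open>E \<le> exp (k * V * \<tau>)\<close>.\<close>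
  define c where "c = \<delta> / (a * (R * exp (k * V * \<tau>)))"
  have c: "c > 0" using \<delta> a R by (simp add: c_def)
  \<comment> \<open>The integral of \<open>\<rho> * q\<close> is \<open>M\<close> minus
    \<open>c\<close> times the barrier; the claim \<open>W \<le> 0\<close> below is the comparison
    of \<open>M\<close> with it.\<close>
  define q where "q x t = u x t + c * (E x t - 1)" for x t
  define qt where "qt x t = ut x t + c * (k * V * E x t)" for x t
  define qx where "qx x t = ux x t + c * (k * E x t)" for x t
  have cE: "continuous_on A (\<lambda>(x, t). E x t)" for A
    unfolding E_def case_prod_unfold by (intro continuous_intros)
  have Ex: "((\<lambda>x. E x t) has_real_derivative k * E x t) (at x)" for x t
    unfolding E_def by (auto intro!: derivative_eq_intros)
  have Et: "(E x has_real_derivative k * V * E x t) (at t within A)" for x t A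
    unfolding E_def[abs_def] by (auto intro!: derivative_eq_intros)
  have cq: "continuous_on (UNIV \<times> {0..T}) (\<lambda>(x, t). q x t)" "continuous_on (UNIV \<times> {0..T}) (\<lambda>(x, t). qt x t)"
    using cont(4,6) cE[of "UNIV \<times> {0..T}"] unfolding q_def qt_def case_prod_unfold
    by (intro continuous_intros; simp)+
  have dqt: "\<forall>t\<in>{0..T}. \<forall>x. (q x has_real_derivative qt x t) (at t within {0..T})"
  proof (intro ballI allI)
    fix x t assume t: "t \<in> {0..T}"
    show "(q x has_real_derivative qt x t) (at t within {0..T})"
      unfolding q_def[abs_def] qt_def by (auto intro!: derivative_eq_intros dt(2) Et t)
  qed
  have dqx: "((\<lambda>x. q x t) has_real_derivative qx x t) (at x)" if "t \<in> {0..T}" for x t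
    unfolding q_def qx_def by (auto intro!: derivative_eq_intros dx(2) Ex that)
  define W where "W x t = integral {0..x} (\<lambda>y. \<rho> y t * q y t)" for x t
  note W = mass_weighted_integral[OF cq dqt \<tau>(1,2), folded W_def]
  have W0: "W 0 t = 0" for t by (simp add: W_def)
  have cWx: "continuous_on {0..a} (\<lambda>x. W x t)" if "t \<in> {0..\<tau>}" for t
  proof -
    have "continuous_on {0..a} (\<lambda>x. (\<lambda>(x, t). W x t) (x, t))"
      by (rule continuous_on_compose2[OF W(3)[of a]]) (use that in \<open>auto intro!: continuous_intros\<close>)
    then show ?thesis by simp
  qed
  have \<rho>0: "\<rho> 0 t = 0" if "t \<in> {0..T}" for t
    using vacuum_at_rest(1)[OF init(1) small, of t 0] init(1)[of 0] that by (cases "t = 0") auto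
  have \<rho>nn: "\<rho> x t \<ge> 0" if "x \<in> {0..a}" "t \<in> {0..T}" for x t
    using \<rho>0[OF that(2)] \<rho>pos[of x t] that by (cases "x = 0") auto
  have Wt_less: "integral {0..x} (\<lambda>y. \<rho>t y t * q y t + \<rho> y t * qt y t) < \<mu> * qx x t - \<rho> x t * u x t * q x t"
    if x: "0 < x" "x < a" and t: "0 < t" "t \<le> \<tau>" for x t
  proof -
    have t': "t \<in> {0<..T}" "t \<in> {0..T}" "t \<in> {0..\<tau>}" using t \<tau> by auto
    \<comment> \<open>\<open>S\<close> is the stress minus the convective flux of
      \<open>\<rho> q\<close>. By the mass and momentum equations its \<open>x\<close>-derivative is
      the time derivative of \<open>\<rho> q\<close> less the term \<open>P\<close> created by the
      barrier. \<open>S 0 = 0\<close> is the additional boundary condition supplied by the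
      vacuum.\<close>
    define S where "S y = \<mu> * ux y t - (\<gamma> - 1) * \<rho> y t * e y t - \<rho> y t * u y t * q y t" for y
    define P where "P y = \<rho> y t * (c * ((V + u y t) * (k * E y t)))" for y
    have dS: "(S has_real_derivative \<rho>t y t * q y t + \<rho> y t * qt y t - P y) (at y)" for y
    proof -
      have "(S has_real_derivative \<rho> y t * (ut y t + u y t * ux y t)
          - ((\<rho>x y t * u y t + ux y t * \<rho> y t) * q y t + qx y t * (\<rho> y t * u y t))) (at y)"
        unfolding S_def by (intro DERIV_diff momentum[OF t'(1)] DERIV_mult dx dqx t'(2))
      moreover have "\<rho> y t * (ut y t + u y t * ux y t)
          - ((\<rho>x y t * u y t + ux y t * \<rho> y t) * q y t + qx y t * (\<rho> y t * u y t))
        = \<rho>t y t * q y t + \<rho> y t * qt y t - P y"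
      proof -
        have rt: "\<rho>t y t = - \<rho>x y t * u y t - \<rho> y t * ux y t" using mass[OF t'(1), of y] by linarith
        show ?thesis unfolding rt qx_def qt_def P_def by (simp add: algebra_simps)
      qed
      ultimately show ?thesis by simp
    qed
    have iS: "((\<lambda>y. \<rho>t y t * q y t + \<rho> y t * qt y t - P y) has_integral S x - S 0) {0..x}"
      using x by (intro fundamental_theorem_of_calculus)
        (auto simp flip: has_real_derivative_iff_has_vector_derivative intro: has_field_derivative_at_within[OF dS])
    have S0: "S 0 = 0"
      using vacuum_at_rest[OF init(1) small t'(1), of 0] by (simp add: S_def)
    have "continuous_on {0..x} E'" if "E' = (\<lambda>y. E y t)" for E'
      unfolding that E_def by (intro continuous_intros)
    then have cP: "continuous_on {0..x} P"
      unfolding P_def by (intro continuous_intros slice_continuous t') auto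
    then have iP: "P integrable_on {0..x}" by (rule integrable_continuous_real)
    \<comment> \<open>Bounding \<open>\<rho>\<close> by \<open>R\<close> and \<open>u\<close> by
      \<open>B\<close> turns \<open>P\<close> into an exact derivative, so its integral needs no
      lower bound on the density. Dropping the boundary term with \<open>E 0 t\<close> afterwards
      makes the inequality strict.\<close>
    have iE: "((\<lambda>y. R * (c * ((V + B) * (k * E y t)))) has_integral
        R * (c * ((V + B) * E x t)) - R * (c * ((V + B) * E 0 t))) {0..x}"
      using x by (intro fundamental_theorem_of_calculus)
        (auto simp flip: has_real_derivative_iff_has_vector_derivative
          intro!: derivative_eq_intros has_field_derivative_at_within[OF Ex])
    have "P y \<le> R * (c * ((V + B) * (k * E y t)))" if "y \<in> {0..x}" for y
    proof -
      have "V + u y t \<le> V + B" using bound(1)[OF t'(2), of y] by auto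
      then have "c * ((V + u y t) * (k * E y t)) \<le> c * ((V + B) * (k * E y t))"
        using c k by (intro mult_left_mono mult_right_mono) (auto simp: E_def)
      then have "P y \<le> \<rho> y t * (c * ((V + B) * (k * E y t)))"
        unfolding P_def by (rule mult_left_mono) (use \<rho>nn[of y t] that x t' in auto)
      also have "\<dots> \<le> R * (c * ((V + B) * (k * E y t)))"
        using R(2)[of y t] that x t' c k V B_nonneg
        by (intro mult_right_mono) (auto simp: E_def)
      finally show ?thesis .
    qed
    then have "integral {0..x} P \<le> R * (c * ((V + B) * E x t)) - R * (c * ((V + B) * E 0 t))"
      using iP iE by (intro has_integral_le[OF integrable_integral iE]) auto
    also have "\<dots> < R * (c * ((V + B) * E x t))"
      using R c V B_nonneg by (simp add: E_def)
    also have "\<dots> = R * (V + B) * (c * E x t)" by simp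
    also have "\<dots> = \<mu> * (c * (k * E x t))"
      unfolding k(2)[symmetric] by simp
    finally have P: "integral {0..x} P < \<mu> * (c * (k * E x t))" .
    have "integral {0..x} (\<lambda>y. \<rho>t y t * q y t + \<rho> y t * qt y t) = S x + integral {0..x} P"
      using has_integral_add[OF iS integrable_integral[OF iP]] S0 by (simp add: integral_unique)
    also have "\<dots> < \<mu> * ux x t - \<rho> x t * u x t * q x t + \<mu> * (c * (k * E x t))"
    proof -
      have "(\<gamma> - 1) * \<rho> x t * e x t \<ge> 0"
        using \<gamma> \<rho>nn[of x t] epos[of x t] x t' by (intro mult_nonneg_nonneg) auto
      then show ?thesis using P by (simp add: S_def)
    qed
    finally show ?thesis by (simp add: qx_def algebra_simps)
  qed
  have W_le: "W x t \<le> 0" if box: "x \<in> {0..a}" "t \<in> {0..\<tau>}" for x t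
  proof (rule ccontr)
    assume "\<not> W x t \<le> 0"
    then have pos: "W x t > 0" by simp
    obtain x t where xt: "0 < x" "x < a" "0 < t" "t \<le> \<tau>" "W x t > 0"
      "\<And>y s. y \<in> {0..a} \<Longrightarrow> s \<in> {0..\<tau>} \<Longrightarrow> W y s \<le> W x t"
    proof (rule positive_maximum[OF W(3)[of a]])
      show "W 0 t \<le> 0" for t by (simp add: W0)
      show "x \<in> {0..a}" "t \<in> {0..\<tau>}" "W x t > 0" using box pos by auto
      show "W a t \<le> 0" if t: "t \<in> {0..\<tau>}" for t
      proof -
        have i: "(\<lambda>y. \<rho> y t * u y t) integrable_on {0..a}" "(\<lambda>y. \<rho> y t * (c * (E y t - 1))) integrable_on {0..a}"
          unfolding E_def by (intro integrable_continuous_real continuous_intros slice_continuous \<tau>T t)+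
        have "W a t = M a t + integral {0..a} (\<lambda>y. \<rho> y t * (c * (E y t - 1)))"
          unfolding W_def M_def q_def distrib_left by (rule integral_add[OF i])
        also have "integral {0..a} (\<lambda>y. \<rho> y t * (c * (E y t - 1))) \<le> integral {0..a} (\<lambda>y. R * (c * exp (k * V * \<tau>)))"
        proof (rule integral_le[OF i(2)])
          fix y assume y: "y \<in> {0..a}"
          have "V * t \<le> V * \<tau>" using t V by simp
          then have "k * (y + V * t - a) \<le> k * (V * \<tau>)"
            using y k by (intro mult_left_mono) auto
          then have "E y t \<le> exp (k * V * \<tau>)" by (simp add: E_def mult.assoc)
          then have "\<rho> y t * (c * (E y t - 1)) \<le> \<rho> y t * (c * exp (k * V * \<tau>))"
            using c \<rho>nn[OF y \<tau>T[OF t]] by (intro mult_left_mono) auto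
          also have "\<dots> \<le> R * (c * exp (k * V * \<tau>))"
            using R(2)[OF y t] c by (intro mult_right_mono) auto
          finally show "\<rho> y t * (c * (E y t - 1)) \<le> R * (c * exp (k * V * \<tau>))" .
        qed auto
        also have "\<dots> = \<delta>" using a R by (simp add: c_def)
        finally show ?thesis using \<tau>(3)[OF t] by simp
      qed
      \<comment> \<open>At time 0 the profile satisfies \<open>E \<le> 1\<close> on
        \<open>[0, a]\<close>, so \<open>u\<close> and the barrier term are both nonpositive for
        \<open>0 < y \<le> a\<close>; at \<open>y = 0\<close> the density vanishes.\<close>
      show "W x 0 \<le> 0" if x: "x \<in> {0..a}" for x
      proof -
        have t0: "0 \<in> {0..T}" using T by auto
        have i: "(\<lambda>y. \<rho> y 0 * q y 0) integrable_on {0..x}"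
          unfolding q_def E_def by (intro integrable_continuous_real continuous_intros slice_continuous t0)
        have "integral {0..x} (\<lambda>y. \<rho> y 0 * q y 0) \<le> integral {0..x} (\<lambda>y. 0)"
        proof (rule integral_le[OF i])
          fix y assume y: "y \<in> {0..x}"
          show "\<rho> y 0 * q y 0 \<le> 0"
          proof (cases "y = 0")
            case False
            then have "u y 0 \<le> 0" using u0(1)[of y] u0(2) y x by (cases "y = a") auto
            moreover have "E y 0 \<le> 1" using y x k by (auto simp: E_def mult_le_0_iff)
            then have "c * (E y 0 - 1) \<le> 0" using c by (simp add: mult_le_0_iff)
            ultimately have "q y 0 \<le> 0" by (simp add: q_def)
            then show ?thesis using \<rho>nn[of y 0] y x t0 by (auto intro: mult_nonneg_nonpos)
          qed (simp add: init(1))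
        qed auto
        then show ?thesis by (simp add: W_def)
      qed
    qed blast
    have t': "t \<in> {0..\<tau>}" "t \<in> {0..T}" using xt \<tau> by auto
    have rx: "\<rho> x t > 0" using \<rho>pos[of x t] xt t' by auto
    have "\<forall>\<^sub>F y in at x. y \<in> {0<..<a}" using xt by (intro eventually_at_in_open') auto
    then have "\<forall>\<^sub>F y in at x. W y t \<le> W x t"
      by eventually_elim (use xt t' in auto)
    then have "\<rho> x t * q x t = 0"
      using W(1)[OF t'(1), of x a] xt by (intro deriv_zero_at_max) auto
    then have q0: "q x t = 0" using rx by simp
    \<comment> \<open>The second order condition divided by the density: if \<open>q\<close> rose
      through its zero at \<open>x\<close>, then \<open>W_x = \<rho> q\<close> would be positive
      just to the right and \<open>W\<close> would exceed its maximum.\<close>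
    have "qx x t \<le> 0"
    proof (rule ccontr)
      assume "\<not> qx x t \<le> 0"
      then obtain d where d: "d > 0" "\<And>h. 0 < h \<Longrightarrow> h < d \<Longrightarrow> q x t < q (x + h) t"
        using DERIV_pos_inc_right[OF dqx[OF t'(2), of x]] by auto
      define y where "y = x + min d (a - x) / 2"
      have y: "x < y" "y < a" "y < x + d" using d xt by (auto simp: y_def min_def field_simps)
      have "W x t < W y t"
      proof (rule DERIV_pos_imp_increasing_open[where f = "\<lambda>x. W x t"])
        show "x < y" by (rule y)
        show "continuous_on {x..y} (\<lambda>x. W x t)" by (rule continuous_on_subset[OF cWx[OF t'(1)]]) (use xt y in auto)
        fix z assume z: "x < z" "z < y"
        then have "q z t > 0" using d(2)[of "z - x"] q0 y by auto
        moreover have "\<rho> z t > 0" using \<rho>pos[of z t] z y xt t' by auto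
        ultimately show "\<exists>d. ((\<lambda>x. W x t) has_real_derivative d) (at z) \<and> 0 < d"
          using W(1)[OF t'(1), of z a] z y xt by (intro exI[of _ "\<rho> z t * q z t"]) auto
      qed
      moreover have "W y t \<le> W x t" by (rule xt(6)) (use y xt(1) t' in auto)
      ultimately show False by simp
    qed
    then have "\<mu> * qx x t \<le> 0" using \<mu> by (simp add: mult_le_0_iff)
    then have neg: "integral {0..x} (\<lambda>y. \<rho>t y t * q y t + \<rho> y t * qt y t) < 0"
      using Wt_less[OF xt(1-4)] q0 by simp
    have "\<forall>\<^sub>F s in at t within {0..\<tau>}. s \<in> {0..\<tau>}" by (simp add: eventually_at_filter)
    then have "\<forall>\<^sub>F s in at t within {0..\<tau>}. W x s \<le> W x t"
      by eventually_elim (use xt in auto)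
    then have "0 \<le> integral {0..x} (\<lambda>y. \<rho>t y t * q y t + \<rho> y t * qt y t)"
      using W(2)[OF t'(1), of x] xt by (intro deriv_nonneg_at_late_max[where f = "W x"]) auto
    with neg show False by simp
  qed
  have \<tau>': "\<tau> \<in> {0..\<tau>}" "\<tau> \<in> {0..T}" "\<tau> \<in> {0<..T}" using \<tau> by auto
  \<comment> \<open>At \<open>(0, \<tau>)\<close> the velocity is zero and the exponent of
    \<open>E\<close> equals \<open>k * (V * \<tau> - a) = k * a > 0\<close>. Hence \<open>W\<close>
    increases from \<open>W 0 \<tau> = 0\<close>, against \<open>W_le\<close>.\<close>
  have "q 0 \<tau> > 0"
  proof -
    have "V * \<tau> - a > 0" using a \<tau> by (simp add: V_def)
    then have "E 0 \<tau> > 1" using k by (simp add: E_def)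
    then show ?thesis
      using vacuum_at_rest(2)[OF init(1) small \<tau>'(3), of 0] c by (simp add: q_def)
  qed
  moreover have "isCont (\<lambda>x. q x \<tau>) 0" using dqx[OF \<tau>'(2)] by (rule DERIV_isCont)
  ultimately have "\<forall>\<^sub>F x in at 0. q x \<tau> > 0"
    unfolding isCont_def by (intro order_tendstoD)
  then obtain d where d: "d > 0" "\<And>x. x \<noteq> 0 \<Longrightarrow> dist x 0 < d \<Longrightarrow> q x \<tau> > 0"
    unfolding eventually_at by auto
  define b where "b = min (a / 2) (d / 2)"
  have b: "0 < b" "b < a" "b < d" using a d by (auto simp: b_def)
  have "W 0 \<tau> < W b \<tau>"
  proof (rule DERIV_pos_imp_increasing_open[where f = "\<lambda>x. W x \<tau>"])
    show "0 < b" by (rule b)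
    show "continuous_on {0..b} (\<lambda>x. W x \<tau>)" by (rule continuous_on_subset[OF cWx[OF \<tau>'(1)]]) (use b in auto)
    fix z assume z: "0 < z" "z < b"
    then have "q z \<tau> > 0" using d(2)[of z] b by auto
    moreover have "\<rho> z \<tau> > 0" using \<rho>pos[of z \<tau>] z b \<tau>' by auto
    ultimately show "\<exists>d. ((\<lambda>x. W x \<tau>) has_real_derivative d) (at z) \<and> 0 < d"
      using W(1)[OF \<tau>'(1), of z a] z b by (intro exI[of _ "\<rho> z \<tau> * q z \<tau>"]) auto
  qed
  then show False using W_le[of b \<tau>] W0[of \<tau>] b \<tau>' by auto
qed

text \<open>The substitution \<open>x \<mapsto> 1 - x\<close> exchanges the ends of the support.
  Velocity and the \<open>x\<close>-derivatives of scalars change sign, while \<open>ux\<close>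
  keeps it as two signs cancel; outflow at the right end becomes inflow at the left.\<close>

lemma reflection:
  "flow \<mu> \<gamma> T B (\<lambda>x. \<rho> (1 - x)) (\<lambda>x t. - \<rho>x (1 - x) t) (\<lambda>x. \<rho>t (1 - x))
     (\<lambda>x t. - u (1 - x) t) (\<lambda>x. ux (1 - x)) (\<lambda>x t. - ut (1 - x) t)
     (\<lambda>x. e (1 - x)) (\<lambda>x t. - ex (1 - x) t) (\<lambda>x. et (1 - x))"
proof
  have c: "continuous_on (UNIV \<times> {0..T}) (\<lambda>(x, t). f (1 - x) t)"
    if "continuous_on (UNIV \<times> {0..T}) (\<lambda>(x, t). f x t)" for f :: "real \<Rightarrow> real \<Rightarrow> real"
  proof -
    have "continuous_on (UNIV \<times> {0..T}) (\<lambda>p. (\<lambda>(x, t). f x t) (1 - fst p, snd p))"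
      by (rule continuous_on_compose2[OF that]) (auto intro!: continuous_intros)
    then show ?thesis by (simp add: case_prod_unfold)
  qed
  show "continuous_on (UNIV \<times> {0..T}) (\<lambda>(x, t). \<rho> (1 - x) t)" "continuous_on (UNIV \<times> {0..T}) (\<lambda>(x, t). \<rho>t (1 - x) t)"
    "continuous_on (UNIV \<times> {0..T}) (\<lambda>(x, t). ux (1 - x) t)" "continuous_on (UNIV \<times> {0..T}) (\<lambda>(x, t). e (1 - x) t)"
    "continuous_on (UNIV \<times> {0..T}) (\<lambda>(x, t). et (1 - x) t)"
    by (rule c, rule cont)+
  show "continuous_on (UNIV \<times> {0..T}) (\<lambda>(x, t). - \<rho>x (1 - x) t)" "continuous_on (UNIV \<times> {0..T}) (\<lambda>(x, t). - u (1 - x) t)"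
    "continuous_on (UNIV \<times> {0..T}) (\<lambda>(x, t). - ut (1 - x) t)" "continuous_on (UNIV \<times> {0..T}) (\<lambda>(x, t). - ex (1 - x) t)"
    using continuous_on_minus[OF c[OF cont(2)]] continuous_on_minus[OF c[OF cont(4)]]
      continuous_on_minus[OF c[OF cont(6)]] continuous_on_minus[OF c[OF cont(8)]]
    by (auto simp: case_prod_unfold)
  show "\<mu> > 0" "\<gamma> > 1" "T > 0" by (fact \<mu> \<gamma> T)+
next
  fix x t
  have d: "((\<lambda>y. f (1 - y)) has_real_derivative - D) (at x)" if "(f has_real_derivative D) (at (1 - x))" for f D
  proof -
    have "((\<lambda>y::real. 1 - y) has_real_derivative - 1) (at x)"
      by (auto intro!: derivative_eq_intros)
    from DERIV_chain2[of f, OF that this] show ?thesis by simp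
  qed
  {
    assume t: "t \<in> {0..T}"
    show "((\<lambda>y. \<rho> (1 - y) t) has_real_derivative - \<rho>x (1 - x) t) (at x)"
      "((\<lambda>y. e (1 - y) t) has_real_derivative - ex (1 - x) t) (at x)"
      by (rule d, rule dx[OF t])+
    show "((\<lambda>y. - u (1 - y) t) has_real_derivative ux (1 - x) t) (at x)"
      using DERIV_minus[OF d[OF dx(2)[OF t]]] by simp
    show "(\<rho> (1 - x) has_real_derivative \<rho>t (1 - x) t) (at t within {0..T})"
      "(e (1 - x) has_real_derivative et (1 - x) t) (at t within {0..T})"
      by (rule dt[OF t])+
    show "((\<lambda>t. - u (1 - x) t) has_real_derivative - ut (1 - x) t) (at t within {0..T})"
      by (rule DERIV_minus[OF dt(2)[OF t]])
    show "\<bar>- u (1 - x) t\<bar> \<le> B" "\<bar>ux (1 - x) t\<bar> \<le> B" using bound[OF t] by simp_all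
  next
    assume t: "t \<in> {0<..T}"
    show "\<rho>t (1 - x) t + - \<rho>x (1 - x) t * - u (1 - x) t + \<rho> (1 - x) t * ux (1 - x) t = 0"
      using mass[OF t, of "1 - x"] by simp
    show "\<rho> (1 - x) t * (et (1 - x) t + - u (1 - x) t * - ex (1 - x) t + (\<gamma> - 1) * e (1 - x) t * ux (1 - x) t)
        = \<mu> * (ux (1 - x) t)\<^sup>2"
      using energy[OF t, of "1 - x"] by simp
    show "((\<lambda>y. \<mu> * ux (1 - y) t - (\<gamma> - 1) * \<rho> (1 - y) t * e (1 - y) t) has_real_derivative
        \<rho> (1 - x) t * (- ut (1 - x) t + - u (1 - x) t * ux (1 - x) t)) (at x)"
      using d[OF momentum[OF t, of "1 - x"]] by (simp add: algebra_simps)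
  }
next
  fix t assume "t \<in> {0..T}"
  then have "integrable lborel (\<lambda>x. (u x t)\<^sup>2)" by (rule L2)
  from lborel_integrable_real_affine[OF this, of "-1" 1]
  show "integrable lborel (\<lambda>x. (- u (1 - x) t)\<^sup>2)" by simp
qed

end

section \<open>Solutions of the Cauchy problem\<close>

text \<open>Points with \<open>F y = G y\<close> accumulate at \<open>x\<close>, so the difference
  quotient of \<open>F - G\<close> vanishes along them. No continuity away from \<open>x\<close> is
  required, which suits the momentum flux: its \<open>x\<close>-derivative is given at almost every
  point only.\<close>

lemma DERIV_unique_AE:
  fixes F G :: "real \<Rightarrow> real"
  assumes ae: "AE y in lborel. F y = G y" and x: "F x = G x"
    and d: "(F has_real_derivative b) (at x)" "(G has_real_derivative d) (at x)"
  shows "b = d"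
proof (rule ccontr)
  assume "b \<noteq> d"
  have "((\<lambda>y. F y - G y) has_real_derivative b - d) (at x)"
    by (intro DERIV_diff d)
  then have "((\<lambda>y. (F y - G y) / (y - x)) \<longlongrightarrow> b - d) (at x)"
    unfolding has_field_derivative_iff using x by simp
  then have "\<forall>\<^sub>F y in at x. (F y - G y) / (y - x) \<noteq> 0"
    by (rule tendsto_imp_eventually_ne) (use \<open>b \<noteq> d\<close> in simp)
  then obtain r where r: "r > 0" "\<And>y. y \<noteq> x \<Longrightarrow> dist y x < r \<Longrightarrow> (F y - G y) / (y - x) \<noteq> 0"
    unfolding eventually_at by auto
  obtain y where "y \<in> {x<..<x+r}" "F y = G y"
    using AE_lborel_dense[OF ae, of x "x + r"] r(1) by auto
  then show False using r(2)[of y] by (auto simp: dist_real_def)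
qed

text \<open>The exceptional null set depends on the time; a sequence of times suffices for the derivative.\<close>

lemma dt_unique_AE:
  assumes t: "t \<in> {0<..T}" and ae: "\<And>s. s \<in> {0..T} \<Longrightarrow> AE x in lborel. F x s = G x s"
    and G: "\<And>x. (G x has_real_derivative d x) (at t within {0..T})"
  shows "AE x in lborel. \<forall>a. dt T F x t a \<longrightarrow> a = d x"
proof -
  define s where "s n = t - t * inverse (real (Suc n))" for n
  have s: "s n \<in> {0..T} \<and> s n \<noteq> t" for n
  proof -
    have "0 < t * inverse (real (Suc n))" "t * inverse (real (Suc n)) \<le> t * 1"
      using t by (auto intro!: mult_left_mono simp: inverse_le_1_iff)
    then show ?thesis using t by (auto simp: s_def)
  qed
  have "s \<longlonglongrightarrow> t - t * 0"
    unfolding s_def by (intro tendsto_intros LIMSEQ_inverse_real_of_nat)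
  then have lim: "filterlim s (at t within {0..T}) sequentially"
    using s by (auto simp: filterlim_at)
  have "AE x in lborel. \<forall>n. F x (s n) = G x (s n)"
    unfolding AE_all_countable using ae s by blast
  moreover have "AE x in lborel. F x t = G x t" using ae t by auto
  ultimately show ?thesis
  proof eventually_elim
    case (elim x)
    show ?case
    proof (intro allI impI)
      fix a assume "dt T F x t a"
      then have "((\<lambda>s. (F x s - F x t) / (s - t)) \<longlongrightarrow> a) (at t within {0..T})"
        by (simp add: dt_def has_field_derivative_iff)
      from filterlim_compose[OF this lim]
      have "(\<lambda>n. (G x (s n) - G x t) / (s n - t)) \<longlonglongrightarrow> a" using elim by simp
      moreover have "(\<lambda>n. (G x (s n) - G x t) / (s n - t)) \<longlonglongrightarrow> d x"
        using filterlim_compose[OF G[of x, unfolded has_field_derivative_iff] lim] by simp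
      ultimately show "a = d x" by (rule LIMSEQ_unique)
    qed
  qed
qed

lemma slice_continuous_on:
  fixes f :: "real \<Rightarrow> real \<Rightarrow> real"
  assumes "continuous_on (UNIV \<times> S) (\<lambda>(x, t). f x t)" "t \<in> S"
  shows "continuous_on UNIV (\<lambda>x. f x t)"
proof -
  have "continuous_on UNIV (\<lambda>x. (\<lambda>(x, t). f x t) (x, t))"
    by (rule continuous_on_compose2[OF assms(1)]) (use assms(2) in \<open>auto intro!: continuous_intros\<close>)
  then show ?thesis by simp
qed

text \<open>The system is stated for the given functions, the regularity belongs to their
  representatives. Quantities with an \<open>x\<close>-derivative at every point are continuous and
  agree with the representatives everywhere; time derivatives agree for almost every
  \<open>x\<close>. The resulting identities extend to all \<open>x\<close> by continuity, except
  for the momentum equation, which is recovered through the stress.\<close>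

lemma NS_solution_flow:
  assumes \<mu>: "\<mu> > 0" and \<gamma>: "\<gamma> > 1" and T: "T > 0" and m: "m \<ge> 2"
    and c0: "continuous_on UNIV \<rho>0" "continuous_on UNIV u0" "continuous_on UNIV e0"
    and C1: "C1_H m T \<rho>" "C1_H m T u" "C1_H m T e"
    and NS: "NS_solution \<mu> \<gamma> T \<rho>0 u0 e0 \<rho> u e"
  obtains T0 B R Rx Rt V Vx Vt E Ex Et where "0 < T0"
    "\<And>\<tau>. 0 < \<tau> \<Longrightarrow> \<tau> \<le> T0 \<Longrightarrow> flow \<mu> \<gamma> \<tau> B R Rx Rt V Vx Vt E Ex Et"
    "\<And>x. R x 0 = \<rho>0 x" "\<And>x. V x 0 = u0 x" "\<And>x. E x 0 = e0 x"
proof -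
  obtain R Rx Rt GR BR TR where R:
    "\<And>t. t \<in> {0..T} \<Longrightarrow> AE x in lborel. \<rho> x t = R x t"
    "\<And>x t. t \<in> {0..T} \<Longrightarrow> ((\<lambda>y. R y t) has_real_derivative Rx x t) (at x)"
    "\<And>t a b. t \<in> {0..T} \<Longrightarrow> a \<le> b \<Longrightarrow> (GR t has_integral Rx b t - Rx a t) {a..b}"
    "\<And>x t. t \<in> {0..T} \<Longrightarrow> (R x has_real_derivative Rt x t) (at t within {0..T})"
    "continuous_on (UNIV \<times> {0..T}) (\<lambda>(x, t). R x t)"
    "continuous_on (UNIV \<times> {0..T}) (\<lambda>(x, t). Rx x t)"
    "continuous_on (UNIV \<times> {0..T}) (\<lambda>(x, t). Rt x t)"
    "\<And>t. t \<in> {0..T} \<Longrightarrow> integrable lborel (\<lambda>x. (R x t)\<^sup>2)"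
    "0 < TR" "TR \<le> T"
    "\<And>x t. t \<in> {0..TR} \<Longrightarrow> \<bar>R x t\<bar> \<le> BR" "\<And>x t. t \<in> {0..TR} \<Longrightarrow> \<bar>Rx x t\<bar> \<le> BR"
    by (rule C1_H_representative[OF C1(1) m T]) (rule that)
  obtain V Vx Vt GV B T0 where V:
    "\<And>t. t \<in> {0..T} \<Longrightarrow> AE x in lborel. u x t = V x t"
    "\<And>x t. t \<in> {0..T} \<Longrightarrow> ((\<lambda>y. V y t) has_real_derivative Vx x t) (at x)"
    "\<And>t a b. t \<in> {0..T} \<Longrightarrow> a \<le> b \<Longrightarrow> (GV t has_integral Vx b t - Vx a t) {a..b}"
    "\<And>x t. t \<in> {0..T} \<Longrightarrow> (V x has_real_derivative Vt x t) (at t within {0..T})"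
    "continuous_on (UNIV \<times> {0..T}) (\<lambda>(x, t). V x t)"
    "continuous_on (UNIV \<times> {0..T}) (\<lambda>(x, t). Vx x t)"
    "continuous_on (UNIV \<times> {0..T}) (\<lambda>(x, t). Vt x t)"
    "\<And>t. t \<in> {0..T} \<Longrightarrow> integrable lborel (\<lambda>x. (V x t)\<^sup>2)"
    "0 < T0" "T0 \<le> T"
    "\<And>x t. t \<in> {0..T0} \<Longrightarrow> \<bar>V x t\<bar> \<le> B" "\<And>x t. t \<in> {0..T0} \<Longrightarrow> \<bar>Vx x t\<bar> \<le> B"
    by (rule C1_H_representative[OF C1(2) m T]) (rule that)
  obtain E Ex Et GE BE TE where E:
    "\<And>t. t \<in> {0..T} \<Longrightarrow> AE x in lborel. e x t = E x t"
    "\<And>x t. t \<in> {0..T} \<Longrightarrow> ((\<lambda>y. E y t) has_real_derivative Ex x t) (at x)"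
    "\<And>t a b. t \<in> {0..T} \<Longrightarrow> a \<le> b \<Longrightarrow> (GE t has_integral Ex b t - Ex a t) {a..b}"
    "\<And>x t. t \<in> {0..T} \<Longrightarrow> (E x has_real_derivative Et x t) (at t within {0..T})"
    "continuous_on (UNIV \<times> {0..T}) (\<lambda>(x, t). E x t)"
    "continuous_on (UNIV \<times> {0..T}) (\<lambda>(x, t). Ex x t)"
    "continuous_on (UNIV \<times> {0..T}) (\<lambda>(x, t). Et x t)"
    "\<And>t. t \<in> {0..T} \<Longrightarrow> integrable lborel (\<lambda>x. (E x t)\<^sup>2)"
    "0 < TE" "TE \<le> T"
    "\<And>x t. t \<in> {0..TE} \<Longrightarrow> \<bar>E x t\<bar> \<le> BE" "\<And>x t. t \<in> {0..TE} \<Longrightarrow> \<bar>Ex x t\<bar> \<le> BE"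
    by (rule C1_H_representative[OF C1(3) m T]) (rule that)
  note cs = slice_continuous_on[OF R(5)] slice_continuous_on[OF R(6)] slice_continuous_on[OF R(7)]
    slice_continuous_on[OF V(5)] slice_continuous_on[OF V(6)] slice_continuous_on[OF V(7)]
    slice_continuous_on[OF E(5)] slice_continuous_on[OF E(6)] slice_continuous_on[OF E(7)]
  note N = NS[unfolded NS_solution_def Let_def]
  have init: "\<rho> x 0 = \<rho>0 x" "u x 0 = u0 x" "e x 0 = e0 x" for x using N by auto
  have t0: "0 \<in> {0..T}" using T by auto
  have "R x 0 = \<rho>0 x" for x
    by (rule AE_eq_continuous[OF _ cs(1)[OF t0] c0(1)]) (use R(1)[OF t0] init in auto)
  moreover have "V x 0 = u0 x" for x
    by (rule AE_eq_continuous[OF _ cs(4)[OF t0] c0(2)]) (use V(1)[OF t0] init in auto)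
  moreover have "E x 0 = e0 x" for x
    by (rule AE_eq_continuous[OF _ cs(7)[OF t0] c0(3)]) (use E(1)[OF t0] init in auto)
  moreover
  {
    fix t assume t: "t \<in> {0<..T}"
    then have t': "t \<in> {0..T}" by auto
    note cs = cs[OF t']
    note dx' = R(2)[OF t'] V(2)[OF t'] E(2)[OF t']
    have N1: "\<exists>a b. dt T \<rho> x t a \<and> dx (\<lambda>y s. \<rho> y s * u y s) x t b \<and> a + b = 0" for x
      using N t by blast
    have N2: "AE x in lborel. \<exists>a b c g. dt T (\<lambda>y s. \<rho> y s * u y s) x t a \<and>
        dx (\<lambda>y s. \<rho> y s * (u y s)\<^sup>2 + (\<gamma> - 1) * \<rho> y s * e y s) x t b \<and>
        (\<forall>y. dx u y t (g y)) \<and> (g has_real_derivative c) (at x) \<and> a + b = \<mu> * c"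
      using N t by blast
    have N3: "\<exists>a b c. dt T (\<lambda>y s. \<rho> y s * e y s) x t a \<and> dx (\<lambda>y s. \<rho> y s * e y s * u y s) x t b \<and>
        dx u x t c \<and> a + b + (\<gamma> - 1) * \<rho> x t * e x t * c = \<mu> * c\<^sup>2" for x
      using N t by blast
    have cont_if: "continuous_on UNIV f" if "\<And>x. \<exists>b. (f has_real_derivative b) (at x)" for f :: "real \<Rightarrow> real"
      by (rule continuous_at_imp_continuous_on) (use that DERIV_isCont in blast)
    \<comment> \<open>The energy equation contains \<open>u_x\<close> at every point, so
      \<open>u\<close> is continuous in \<open>x\<close> and equal to its representative. Only
      certain products with \<open>\<rho>\<close> and \<open>e\<close> can be identified everywhere
      in this way.\<close>
    have uV: "(\<lambda>x. u x t) = (\<lambda>x. V x t)"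
    proof
      fix x
      have "continuous_on UNIV (\<lambda>x. u x t)"
        by (rule cont_if) (use N3 in \<open>unfold dx_def, blast\<close>)
      then show "u x t = V x t"
        by (rule AE_eq_continuous[OF V(1)[OF t'] _ cs(4)])
    qed
    have ruV: "(\<lambda>x. \<rho> x t * u x t) = (\<lambda>x. R x t * V x t)"
    proof
      fix x
      have "continuous_on UNIV (\<lambda>x. \<rho> x t * u x t)"
        by (rule cont_if) (use N1 in \<open>unfold dx_def, blast\<close>)
      then show "\<rho> x t * u x t = R x t * V x t"
        by (rule AE_eq_continuous[rotated]) (use R(1)[OF t'] V(1)[OF t'] in \<open>auto intro!: continuous_intros cs\<close>)
    qed
    have reuV: "(\<lambda>x. \<rho> x t * e x t * u x t) = (\<lambda>x. R x t * E x t * V x t)"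
    proof
      fix x
      have "continuous_on UNIV (\<lambda>x. \<rho> x t * e x t * u x t)"
        by (rule cont_if) (use N3 in \<open>unfold dx_def, blast\<close>)
      then show "\<rho> x t * e x t * u x t = R x t * E x t * V x t"
        by (rule AE_eq_continuous[rotated]) (use R(1)[OF t'] V(1)[OF t'] E(1)[OF t'] in \<open>auto intro!: continuous_intros cs\<close>)
    qed
    have d\<rho>: "AE x in lborel. \<forall>a. dt T \<rho> x t a \<longrightarrow> a = Rt x t"
      by (rule dt_unique_AE[OF t R(1) R(4)[OF t']])
    have d\<rho>u: "AE x in lborel. \<forall>a. dt T (\<lambda>x s. \<rho> x s * u x s) x t a \<longrightarrow> a = Rt x t * V x t + Vt x t * R x t"
    proof (rule dt_unique_AE[OF t _ DERIV_mult[OF R(4)[OF t'] V(4)[OF t']]])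
      fix s assume s: "s \<in> {0..T}"
      show "AE x in lborel. \<rho> x s * u x s = R x s * V x s"
        using R(1)[OF s] V(1)[OF s] by eventually_elim simp
    qed
    have d\<rho>e: "AE x in lborel. \<forall>a. dt T (\<lambda>x s. \<rho> x s * e x s) x t a \<longrightarrow> a = Rt x t * E x t + Et x t * R x t"
    proof (rule dt_unique_AE[OF t _ DERIV_mult[OF R(4)[OF t'] E(4)[OF t']]])
      fix s assume s: "s \<in> {0..T}"
      show "AE x in lborel. \<rho> x s * e x s = R x s * E x s"
        using R(1)[OF s] E(1)[OF s] by eventually_elim simp
    qed
    have mass: "Rt x t + Rx x t * V x t + R x t * Vx x t = 0" for x
    proof (rule AE_eq_continuous[where f = "\<lambda>x. Rt x t + Rx x t * V x t + R x t * Vx x t" and g = "\<lambda>x. 0"])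
      show "AE x in lborel. Rt x t + Rx x t * V x t + R x t * Vx x t = 0"
        using d\<rho>
      proof eventually_elim
        case (elim x)
        obtain a b where ab: "dt T \<rho> x t a" "dx (\<lambda>y s. \<rho> y s * u y s) x t b" "a + b = 0"
          using N1 by blast
        have "((\<lambda>y. R y t * V y t) has_real_derivative b) (at x)"
          using ab(2) unfolding dx_def ruV .
        then have "b = Rx x t * V x t + Vx x t * R x t"
          using DERIV_mult[OF dx'(1,2)] by (rule DERIV_unique)
        then show ?case using elim ab by (simp add: algebra_simps)
      qed
    qed (intro continuous_intros cs)+
    have energy: "R x t * (Et x t + V x t * Ex x t + (\<gamma> - 1) * E x t * Vx x t) = \<mu> * (Vx x t)\<^sup>2" for x
    proof (rule AE_eq_continuous[where g = "\<lambda>x. \<mu> * (Vx x t)\<^sup>2"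
          and f = "\<lambda>x. R x t * (Et x t + V x t * Ex x t + (\<gamma> - 1) * E x t * Vx x t)"])
      show "AE x in lborel. R x t * (Et x t + V x t * Ex x t + (\<gamma> - 1) * E x t * Vx x t) = \<mu> * (Vx x t)\<^sup>2"
        using d\<rho>e R(1)[OF t'] E(1)[OF t']
      proof eventually_elim
        case (elim x)
        obtain a b c where abc: "dt T (\<lambda>y s. \<rho> y s * e y s) x t a"
          "dx (\<lambda>y s. \<rho> y s * e y s * u y s) x t b" "dx u x t c"
          "a + b + (\<gamma> - 1) * \<rho> x t * e x t * c = \<mu> * c\<^sup>2"
          using N3 by blast
        have "((\<lambda>y. R y t * E y t * V y t) has_real_derivative b) (at x)"
          using abc(2) unfolding dx_def reuV .
        then have b: "b = (Rx x t * E x t + Ex x t * R x t) * V x t + Vx x t * (R x t * E x t)"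
          using DERIV_mult[OF DERIV_mult[OF dx'(1,3)] dx'(2)] by (rule DERIV_unique)
        have c: "c = Vx x t"
          using abc(3) dx'(2) unfolding dx_def uV by (rule DERIV_unique)
        have a: "a = Rt x t * E x t + Et x t * R x t" using elim(1) abc(1) by blast
        \<comment> \<open>Subtracting \<open>E\<close> times the mass equation turns the
          conservative energy equation into transport form.\<close>
        have "(Rt x t + Rx x t * V x t + R x t * Vx x t) * E x t = 0" using mass by simp
        then show ?case
          using abc(4) unfolding a b c elim(2,3) by (simp add: algebra_simps)
      qed
    qed (intro continuous_intros cs)+
    have momentum: "((\<lambda>y. \<mu> * Vx y t - (\<gamma> - 1) * R y t * E y t) has_real_derivative
        R x t * (Vt x t + V x t * Vx x t)) (at x)" for x
    proof (rule primitive_AE_deriv[where r = "\<lambda>x. R x t * (Vt x t + V x t * Vx x t)"])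
      let ?p' = "\<lambda>y. (\<gamma> - 1) * (Rx y t * E y t + Ex y t * R y t)"
      have dp: "((\<lambda>y. (\<gamma> - 1) * R y t * E y t) has_real_derivative ?p' y) (at y)" for y
        using DERIV_cmult[OF DERIV_mult[OF dx'(1,3)], of "\<gamma> - 1"] by (simp add: mult.assoc)
      \<comment> \<open>The stress is an integral because \<open>Vx\<close> is one and the pressure
        is \<open>C^1\<close>. Its derivative is found almost everywhere from the momentum equation
        and is continuous there, so it is the derivative everywhere.\<close>
      show "((\<lambda>y. \<mu> * GV t y - ?p' y) has_integral
          (\<mu> * Vx b t - (\<gamma> - 1) * R b t * E b t) - (\<mu> * Vx a t - (\<gamma> - 1) * R a t * E a t)) {a..b}"
        if "a \<le> b" for a b
      proof -
        have "(?p' has_integral (\<gamma> - 1) * R b t * E b t - (\<gamma> - 1) * R a t * E a t) {a..b}"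
          using that by (intro fundamental_theorem_of_calculus)
            (auto simp flip: has_real_derivative_iff_has_vector_derivative intro: has_field_derivative_at_within[OF dp])
        from has_integral_diff[OF has_integral_mult_right[OF V(3)[OF t' that], of \<mu>] this]
        show ?thesis by (simp add: algebra_simps)
      qed
      have F: "AE y in lborel. \<rho> y t * (u y t)\<^sup>2 + (\<gamma> - 1) * \<rho> y t * e y t
          = R y t * (V y t)\<^sup>2 + (\<gamma> - 1) * R y t * E y t"
        using R(1)[OF t'] V(1)[OF t'] E(1)[OF t'] by eventually_elim simp
      show "AE x in lborel. ((\<lambda>y. \<mu> * Vx y t - (\<gamma> - 1) * R y t * E y t) has_real_derivative
          R x t * (Vt x t + V x t * Vx x t)) (at x)"
        using N2 d\<rho>u F
      proof eventually_elim
        case (elim x)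
        obtain a b c g where abc: "dt T (\<lambda>y s. \<rho> y s * u y s) x t a"
          "dx (\<lambda>y s. \<rho> y s * (u y s)\<^sup>2 + (\<gamma> - 1) * \<rho> y s * e y s) x t b"
          "\<And>y. dx u y t (g y)" "(g has_real_derivative c) (at x)" "a + b = \<mu> * c"
          using elim(1) by blast
        have "g y = Vx y t" for y
          using abc(3)[of y] dx'(2) unfolding dx_def uV by (rule DERIV_unique)
        \<comment> \<open>Once \<open>g\<close> is identified with \<open>Vx\<close>, the number
          \<open>c\<close> is a derivative of \<open>Vx\<close> at the given point, so
          \<open>u_xx\<close> exists classically there.\<close>
        then have "g = (\<lambda>y. Vx y t)" by auto
        with abc(4) have c: "((\<lambda>y. Vx y t) has_real_derivative c) (at x)" by simp
        have "((\<lambda>y. R y t * (V y t)\<^sup>2 + (\<gamma> - 1) * R y t * E y t) has_real_derivative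
            Rx x t * (V x t)\<^sup>2 + 2 * V x t * Vx x t * R x t + ?p' x) (at x)"
          by (rule DERIV_add[OF _ dp]) (auto intro!: derivative_eq_intros dx')
        then have b: "b = Rx x t * (V x t)\<^sup>2 + 2 * V x t * Vx x t * R x t + ?p' x"
          using DERIV_unique_AE[OF F elim(3) abc(2)[unfolded dx_def]] by blast
        have a: "a = Rt x t * V x t + Vt x t * R x t" using elim(2) abc(1) by blast
        have "((\<lambda>y. \<mu> * Vx y t - (\<gamma> - 1) * R y t * E y t) has_real_derivative \<mu> * c - ?p' x) (at x)"
          by (intro DERIV_diff DERIV_cmult c dp)
        moreover have "\<mu> * c - ?p' x = R x t * (Vt x t + V x t * Vx x t)"
        proof -
          have rt: "Rt x t = - Rx x t * V x t - R x t * Vx x t" using mass[of x] by linarith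
          show ?thesis unfolding abc(5)[symmetric] a b rt by (simp add: algebra_simps power2_eq_square)
        qed
        ultimately show ?case by simp
      qed
      show "continuous_on UNIV (\<lambda>x. R x t * (Vt x t + V x t * Vx x t))"
        by (intro continuous_intros cs)
    qed
    note mass energy momentum
  }
  note eqs = this
  have "flow \<mu> \<gamma> \<tau> B R Rx Rt V Vx Vt E Ex Et" if \<tau>: "0 < \<tau>" "\<tau> \<le> T0" for \<tau>
  proof
    have sub: "{0..\<tau>} \<subseteq> {0..T}" using \<tau> V(10) by auto
    have c: "continuous_on (UNIV \<times> {0..\<tau>}) (\<lambda>(x, t). f x t)"
      if "continuous_on (UNIV \<times> {0..T}) (\<lambda>(x, t). f x t)" for f :: "real \<Rightarrow> real \<Rightarrow> real"
      by (rule continuous_on_subset[OF that]) (use sub in auto)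
    show "continuous_on (UNIV \<times> {0..\<tau>}) (\<lambda>(x, t). R x t)" "continuous_on (UNIV \<times> {0..\<tau>}) (\<lambda>(x, t). Rx x t)"
      "continuous_on (UNIV \<times> {0..\<tau>}) (\<lambda>(x, t). Rt x t)" by (rule c, rule R)+
    show "continuous_on (UNIV \<times> {0..\<tau>}) (\<lambda>(x, t). V x t)" "continuous_on (UNIV \<times> {0..\<tau>}) (\<lambda>(x, t). Vx x t)"
      "continuous_on (UNIV \<times> {0..\<tau>}) (\<lambda>(x, t). Vt x t)" by (rule c, rule V)+
    show "continuous_on (UNIV \<times> {0..\<tau>}) (\<lambda>(x, t). E x t)" "continuous_on (UNIV \<times> {0..\<tau>}) (\<lambda>(x, t). Ex x t)"
      "continuous_on (UNIV \<times> {0..\<tau>}) (\<lambda>(x, t). Et x t)" by (rule c, rule E)+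
    show "\<mu> > 0" "\<gamma> > 1" "\<tau> > 0" by (fact \<mu> \<gamma> \<tau>)+
    fix x t
    {
      assume t: "t \<in> {0..\<tau>}"
      then have t': "t \<in> {0..T}" "t \<in> {0..T0}" using sub \<tau> by auto
      show "((\<lambda>y. R y t) has_real_derivative Rx x t) (at x)" "((\<lambda>y. V y t) has_real_derivative Vx x t) (at x)"
        "((\<lambda>y. E y t) has_real_derivative Ex x t) (at x)"
        by (fact R(2)[OF t'(1)] V(2)[OF t'(1)] E(2)[OF t'(1)])+
      show "(R x has_real_derivative Rt x t) (at t within {0..\<tau>})"
        by (rule has_field_derivative_subset[OF R(4)[OF t'(1)] sub])
      show "(V x has_real_derivative Vt x t) (at t within {0..\<tau>})"
        by (rule has_field_derivative_subset[OF V(4)[OF t'(1)] sub])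
      show "(E x has_real_derivative Et x t) (at t within {0..\<tau>})"
        by (rule has_field_derivative_subset[OF E(4)[OF t'(1)] sub])
      show "\<bar>V x t\<bar> \<le> B" "\<bar>Vx x t\<bar> \<le> B" using V(11,12)[OF t'(2)] by auto
      show "integrable lborel (\<lambda>x. (V x t)\<^sup>2)" by (rule V(8)[OF t'(1)])
    next
      assume "t \<in> {0<..\<tau>}"
      then have t: "t \<in> {0<..T}" using \<tau> V(10) by auto
      show "Rt x t + Rx x t * V x t + R x t * Vx x t = 0"
        "((\<lambda>y. \<mu> * Vx y t - (\<gamma> - 1) * R y t * E y t) has_real_derivative R x t * (Vt x t + V x t * Vx x t)) (at x)"
        "R x t * (Et x t + V x t * Ex x t + (\<gamma> - 1) * E x t * Vx x t) = \<mu> * (Vx x t)\<^sup>2"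
        by (fact eqs[OF t])+
    }
  qed
  ultimately show thesis using that[of T0 B R Rx Rt V Vx Vt E Ex Et] V(9) by blast
qed

section \<open>Short times and the two ends of the support\<close>

lemma short_time_exists:
  fixes a B T0 :: real
  assumes "a < 1" "0 < T0"
  obtains \<tau> where "0 < \<tau>" "\<tau> \<le> T0" "B * \<tau> \<le> 1 / 2" "a * exp (B * \<tau>) < 1"
proof -
  have "((\<lambda>\<tau>. a * exp (B * \<tau>)) \<longlongrightarrow> a * exp (B * 0)) (at_right 0)"
    by (intro tendsto_intros)
  then have "\<forall>\<^sub>F \<tau> in at_right 0. a * exp (B * \<tau>) < 1"
    by (rule order_tendstoD) (use assms(1) in simp)
  moreover have "((\<lambda>\<tau>. B * \<tau>) \<longlongrightarrow> B * 0) (at_right 0)"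
    by (intro tendsto_intros)
  then have "\<forall>\<^sub>F \<tau> in at_right 0. B * \<tau> < 1 / 2"
    by (rule order_tendstoD) simp
  moreover have "\<forall>\<^sub>F \<tau> in at_right 0. \<tau> \<in> {0<..<T0}"
    by (rule eventually_at_right_real[OF assms(2)])
  ultimately have "\<forall>\<^sub>F \<tau> in at_right 0. 0 < \<tau> \<and> \<tau> \<le> T0 \<and> B * \<tau> \<le> 1 / 2 \<and> a * exp (B * \<tau>) < 1"
    by eventually_elim auto
  then show thesis using eventually_happens[of _ "at_right (0::real)"] that trivial_limit_at_right_real by blast
qed

theorem theorem1p2:
  fixes \<mu> \<gamma> lam5 lam6 lam7 lam8 T m :: real
    and \<rho>0 u0 e0 :: "real \<Rightarrow> real"
  assumes "\<mu> > 0" and "\<gamma> > 1"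
    and "continuous_on UNIV \<rho>0" and "continuous_on UNIV u0" and "continuous_on UNIV e0"
    and "closure {x. \<rho>0 x \<noteq> 0} = {0..1}"
    and "\<forall>x\<in>{0<..<1}. \<rho>0 x > 0"
    and "\<forall>x\<in>{0<..<1}. e0 x \<ge> 0" and "\<exists>x\<in>{0<..<1}. e0 x \<noteq> 0"
    and "lam5 > 0" and "lam6 > 0" and "0 < lam7" and "lam7 < 1" and "0 < lam8" and "lam8 < 1"
    and "(\<forall>x\<in>{0<..<lam7}. \<exists>a b. (\<rho>0 has_real_derivative a) (at x) \<and>
              (e0 has_real_derivative b) (at x) \<and> a / \<rho>0 x + b / \<rho>0 x \<ge> lam5)
          \<and> u0 lam7 < 0 \<and> (\<forall>x\<in>{0<..<lam7}. u0 x \<le> 0)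
       \<or> (\<forall>x\<in>{lam8<..<1}. \<exists>a b. (\<rho>0 has_real_derivative a) (at x) \<and>
              (e0 has_real_derivative b) (at x) \<and> a / \<rho>0 x + b / \<rho>0 x \<le> - lam6)
          \<and> u0 lam8 > 0 \<and> (\<forall>x\<in>{lam8<..<1}. u0 x \<ge> 0)"
    and "T > 0" and "m > 2"
  shows "\<not> (\<exists>\<rho> u e. C1_H m T \<rho> \<and> C1_H m T u \<and> C1_H m T e \<and>
                     NS_solution \<mu> \<gamma> T \<rho>0 u0 e0 \<rho> u e)"
proof
  assume "\<exists>\<rho> u e. C1_H m T \<rho> \<and> C1_H m T u \<and> C1_H m T e \<and> NS_solution \<mu> \<gamma> T \<rho>0 u0 e0 \<rho> u e"
  then obtain \<rho> u e where C1: "C1_H m T \<rho>" "C1_H m T u" "C1_H m T e"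
    and NS: "NS_solution \<mu> \<gamma> T \<rho>0 u0 e0 \<rho> u e" by blast
  obtain T0 B R Rx Rt V Vx Vt E Ex Et where T0: "0 < T0"
    and fl: "\<And>\<tau>. 0 < \<tau> \<Longrightarrow> \<tau> \<le> T0 \<Longrightarrow> flow \<mu> \<gamma> \<tau> B R Rx Rt V Vx Vt E Ex Et"
    and init: "\<And>x. R x 0 = \<rho>0 x" "\<And>x. V x 0 = u0 x" "\<And>x. E x 0 = e0 x"
    using NS_solution_flow[OF assms(1,2) \<open>T > 0\<close> _ assms(3-5) C1 NS] \<open>m > 2\<close> by (metis less_imp_le)
  have out: "\<rho>0 x = 0" if "x \<notin> {0..1}" for x
    using that closure_subset[of "{x. \<rho>0 x \<noteq> 0}"] unfolding assms(6) by blast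
  \<comment> \<open>The closure only determines \<open>\<rho>0\<close> outside
    \<open>[0, 1]\<close>; continuity adds the endpoints, which the vacuum lemmas include.\<close>
  have z: "\<rho>0 x = 0" if "x \<le> 0 \<or> 1 \<le> x" for x
  proof -
    have "\<rho>0 x = 0" if "x \<in> closure ({..<0} \<union> {1<..})" for x
      by (rule continuous_constant_on_closure[OF continuous_on_subset[OF assms(3)] _ that]) (auto intro: out)
    then show ?thesis using that by (auto simp: closure_Un)
  qed
  from assms(16) show False
  proof (elim disjE conjE)
    assume u: "u0 lam7 < 0" "\<forall>x\<in>{0<..<lam7}. u0 x \<le> 0"
    obtain \<tau> where \<tau>: "0 < \<tau>" "\<tau> \<le> T0" "B * \<tau> \<le> 1 / 2" "lam7 * exp (B * \<tau>) < 1"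
      using short_time_exists[OF \<open>lam7 < 1\<close> T0] by blast
    show False
      by (rule flow.inflow_impossible[OF fl[OF \<tau>(1,2)] _ _ _ \<tau>(3) \<open>0 < lam7\<close> \<tau>(4)])
         (use u assms(7,8) z in \<open>auto simp: init\<close>)
  next
    assume u: "u0 lam8 > 0" "\<forall>x\<in>{lam8<..<1}. u0 x \<ge> 0"
    \<comment> \<open>In reflected coordinates the inner point \<open>lam8\<close> lies at distance
      \<open>1 - lam8\<close> from the vacuum.\<close>
    have l: "0 < 1 - lam8" "1 - lam8 < 1" using assms by auto
    obtain \<tau> where \<tau>: "0 < \<tau>" "\<tau> \<le> T0" "B * \<tau> \<le> 1 / 2" "(1 - lam8) * exp (B * \<tau>) < 1"
      using short_time_exists[OF l(2) T0] by blast
    show False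
      by (rule flow.inflow_impossible[OF flow.reflection[OF fl[OF \<tau>(1,2)]] _ _ _ \<tau>(3) l(1) \<tau>(4)])
         (use u assms(7,8) z in \<open>auto simp: init\<close>)
  qed
qed

end
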